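(* Let $d\ge1$ be an integer and $\sigma>0$. For $A>0$ and $N\in\mathbb{N}$ let \[ \mathcal{R}_N(u)=\frac{\sigma}{3}\int_{\mathbb{T}^d}:\!u_N^3\!:\,dx-A\Big(\int_{\mathbb{T}^d}:\!u_N^2\!:\,dx\Big)^2 . \] Given any finite $p\ge1$, there exists sufficiently large $A=A(\sigma,p)>0$ such that $\mathcal{R}_N$ converges to some limit $\mathcal{R}$ in $L^p(\mu)$, and there exists $C_{p,d,A}>0$ such that \[ \sup_{N\in\mathbb{N}}\big\|e^{\mathcal{R}_N(u)}\big\|_{L^p(\mu)}\le C_{p,d,A}<\infty . \] In particular $e^{\mathcal{R}_N(u)}\to e^{\mathcal{R}(u)}$ in $L^p(\mu)$ as $N\to\infty$. Consequently, the truncated measures $d\rho_N=Z_N^{-1}e^{\mathcal{R}_N(u)}d\mu(u)$ converge (in the sense that their densities converge in $L^p(\mu)$) to the Gibbs measure $d\rho=Z^{-1}e^{\mathcal{R}(u)}d\mu(u)$, and $\rho$ is equivalent (mutually absolutely continuous) to $\mu$.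
   Context: $\mathbb{T}^d=(\mathbb{R}/2\pi\mathbb{Z})^d$ is equipped with the normalized Lebesgue measure $dx=(2\pi)^{-d}dx_{\mathrm{Leb}}$; $e_n(x)=e^{in\cdot x}$, $\langle n\rangle=(1+|n|^2)^{1/2}$. The log-correlated Gaussian field $\mu$ is the law of the random distribution $u=\sum_{n\in\mathbb{Z}^d}\langle n\rangle^{-d/2}g_n e_n$, where $\{g_n\}_{n\in\mathbb{Z}^d}$ are independent standard complex Gaussian random variables conditioned on $g_{-n}=\overline{g_n}$ (so $g_0$ is standard real Gaussian). For $N\in\mathbb{N}$, $\pi_N f=\sum_{|n|\le N}\widehat f(n)e_n$, $u_N=\pi_N u$, and $\sigma_N=\mathbb{E}[u_N(x)^2]=\sum_{|n|\le N}\langle n\rangle^{-d}$. Wick powers: $:\!u_N^2\!:\,=u_N^2-\sigma_N$, $:\!u_N^3\!:\,=u_N^3-3\sigma_N u_N$ (Hermite polynomials $H_k(u_N;\sigma_N)$ with variance parameter $\sigma_N$). *)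

theory Defs
  imports "HOL-Probability.Probability"
begin

text \<open>Lattice points n in Z^d are modelled as int ^ 'd (d = CARD('d)); points of
  the torus as real ^ 'd, the torus being the box [0, 2 pi]^d.\<close>

definition lat_norm :: "int ^ 'd \<Rightarrow> real" where
  "lat_norm n = sqrt (\<Sum>i\<in>UNIV. (real_of_int (n $ i))\<^sup>2)"

definition japan :: "int ^ 'd \<Rightarrow> real" where
  "japan n = sqrt (1 + (lat_norm n)\<^sup>2)"

definition lat_dot :: "int ^ 'd \<Rightarrow> real ^ 'd \<Rightarrow> real" where
  "lat_dot n x = (\<Sum>i\<in>UNIV. real_of_int (n $ i) * x $ i)"

definition e_n :: "int ^ 'd \<Rightarrow> real ^ 'd \<Rightarrow> complex" where
  "e_n n x = cis (lat_dot n x)"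

definition ball_N :: "nat \<Rightarrow> (int ^ 'd) set" where
  "ball_N N = {n. lat_norm n \<le> real N}"

definition torus_int :: "(real ^ 'd \<Rightarrow> real) \<Rightarrow> real" where
  "torus_int f = (1 / (2 * pi) ^ CARD('d)) * integral (cbox 0 (\<chi> i. 2 * pi)) f"

definition Omega :: "(int ^ 'd \<Rightarrow> real) measure" where
  "Omega = (\<Pi>\<^sub>M n\<in>UNIV. density lborel std_normal_density)"

text \<open>g_n = ((xi_n + xi_{-n}) + i (xi_n - xi_{-n}))/2: for n \<noteq> 0 these are standard
  complex Gaussians (E |g_n|^2 = 1), independent modulo g_{-n} = conj g_n,
  and g_0 = xi_0 is standard real Gaussian.  So the law of (g_n) is the one in the paper.\<close>
definition gcoef :: "(int ^ 'd \<Rightarrow> real) \<Rightarrow> int ^ 'd \<Rightarrow> complex" where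
  "gcoef \<omega> n = Complex ((\<omega> n + \<omega> (- n)) / 2) ((\<omega> n - \<omega> (- n)) / 2)"

definition uN :: "nat \<Rightarrow> (int ^ 'd \<Rightarrow> real) \<Rightarrow> real ^ 'd \<Rightarrow> real" where
  "uN N \<omega> x = Re (\<Sum>n\<in>ball_N N. complex_of_real (japan n powr (- real CARD('d) / 2))
                                     * gcoef \<omega> n * e_n n x)"

definition sigmaN :: "('d::finite) itself \<Rightarrow> nat \<Rightarrow> real" where
  "sigmaN _ N = (\<Sum>n\<in>(ball_N N :: (int ^ 'd) set). japan n powr (- real CARD('d)))"

definition wick2 :: "nat \<Rightarrow> (int ^ 'd \<Rightarrow> real) \<Rightarrow> real ^ 'd \<Rightarrow> real" where
  "wick2 N \<omega> x = (uN N \<omega> x)\<^sup>2 - sigmaN TYPE('d) N"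

definition wick3 :: "nat \<Rightarrow> (int ^ 'd \<Rightarrow> real) \<Rightarrow> real ^ 'd \<Rightarrow> real" where
  "wick3 N \<omega> x = (uN N \<omega> x) ^ 3 - 3 * sigmaN TYPE('d) N * uN N \<omega> x"

definition RN :: "real \<Rightarrow> real \<Rightarrow> nat \<Rightarrow> (int ^ 'd \<Rightarrow> real) \<Rightarrow> real" where
  "RN \<sigma> A N \<omega> = \<sigma> / 3 * torus_int (wick3 N \<omega>) - A * (torus_int (wick2 N \<omega>))\<^sup>2"

definition in_Lp :: "'a measure \<Rightarrow> real \<Rightarrow> ('a \<Rightarrow> real) \<Rightarrow> bool" where
  "in_Lp M p f \<longleftrightarrow> f \<in> borel_measurable M \<and> (\<integral>\<^sup>+ x. ennreal (\<bar>f x\<bar> powr p) \<partial>M) < \<infinity>"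

definition Lp_norm :: "'a measure \<Rightarrow> real \<Rightarrow> ('a \<Rightarrow> real) \<Rightarrow> real" where
  "Lp_norm M p f = (enn2real (\<integral>\<^sup>+ x. ennreal (\<bar>f x\<bar> powr p) \<partial>M)) powr (1 / p)"

end

theory Submission
  imports Defs
begin

text \<open>
  The uniform bound on the exponential moments comes from Maurey's inequality for Gaussian product
  measures: if \<open>a x * b y \<le> exp (|x - y|\<^sup>2 / 4)\<close> for all \<open>x\<close>, \<open>y\<close>, then the product of the integrals of
  \<open>a\<close> and \<open>b\<close> is at most 1. It follows from the one-dimensional Prekopa--Leindler inequality by
  tensorisation, so the constant does not depend on the dimension. Taking for \<open>b\<close> a multiple of the
  indicator of a set \<open>E\<close> of probability at least 1/2 gives \<open>\<integral> a \<le> 2 K\<close> whenever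
  \<open>a (y + \<theta>) \<le> K exp (|\<theta>|\<^sup>2 / 4)\<close> for all \<open>y \<in> E\<close>. This replaces both the Boue--Dupuis variational
  formula and hypercontractivity.

  On the set \<open>E\<close> where the stochastic objects built from \<open>y\<close> have bounded norms, expanding the cubic
  interaction at \<open>y + \<theta>\<close> leaves as critical term the integral of \<open>\<Theta>\<^sup>3\<close>, at most \<open>C l\<^sup>2 h\<close> where \<open>l\<close> is the
  norm of \<open>\<Theta>\<close> in \<open>L\<^sup>2\<close> and \<open>h = |\<theta>|\<close> its Cameron--Martin norm (Sobolev order \<open>d / 2\<close>). It is absorbed
  by \<open>h\<^sup>2 / 4\<close> and by the taming term, which is about \<open>- A l\<^sup>4\<close>, once \<open>A\<close> is large.

  The second moments of the Wick integrals are the double integrals of powers of the covariance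
  function; these are bounded and increase with the truncation, whence the interactions form a
  Cauchy sequence in \<open>L\<^sup>1\<close>. Interpolation with the uniform bounds upgrades this to \<open>L\<^sup>p\<close>.
\<close>

text \<open>The constant 4 in Maurey's inequality belongs to the midpoint: the Gaussian density
  \<open>g\<close> satisfies \<open>g x * g y * exp ((x - y)\<^sup>2 / 4) = (g ((x + y) /
  2))\<^sup>2\<close>. It fixes a budget of \<open>h\<^sup>2 / 4\<close> for a shift, whatever
  exponent \<open>P\<close> multiplies the interaction. The obstacle is that the cubic term has no
  power to spare against this budget. Young's inequality turns \<open>l\<^sup>2 * h\<close> into a
  small multiple of \<open>h\<^sup>2\<close> plus a multiple of
  \<open>P\<^sup>2 * \<sigma>\<^sup>2 * l ^ 4\<close>, so \<open>P * A\<close> must dominate the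
  latter coefficient and \<open>A\<close> has to grow with the exponent. For the same reason the
  cubic estimate may not lose even a logarithm of \<open>h / l\<close>. The terms that carry random
  norms are of lower order and only affect additive constants, so the threshold for \<open>A\<close>
  does not depend on the size of the random data. Exponential moments are taken at exponent
  \<open>2 * p\<close>, because convergence at exponent \<open>p\<close> is obtained between 1 and
  \<open>2 * p\<close>.\<close>

section \<open>Brunn--Minkowski, Prekopa--Leindler and Maurey's inequality\<close>

text \<open>A supremum over the points of an uncountable set becomes a monotone limit along a
  sequence, which is what continuity of measure from below requires. Without a maximum, every point
  lies below a rational that in turn lies below another point of the set, so one point chosen above
  each such rational suffices.\<close>

lemma cofinal_sequence_real:
  fixes A :: "real set"
  assumes "A \<noteq> {}"
  obtains a :: "nat \<Rightarrow> real" where "\<And>k. a k \<in> A" "\<And>x. x \<in> A \<Longrightarrow> \<exists>k. x \<le> a k"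
proof -
  obtain x0 where x0: "x0 \<in> A" using assms by auto
  define a where "a k = (let q = real_of_rat (nat_to_rat_surj k) in
     if (\<exists>x\<in>A. q < x) then (SOME x. x \<in> A \<and> q < x) else x0)" for k
  have sel: "(SOME x. x \<in> A \<and> q < x) \<in> A \<and> q < (SOME x. x \<in> A \<and> q < x)" if "\<exists>x\<in>A. q < x" for q
    by (rule someI_ex) (use that in blast)
  have aA: "a k \<in> A" for k
    using sel x0 unfolding a_def Let_def by auto
  show thesis
  proof (cases "\<exists>m\<in>A. \<forall>x\<in>A. x \<le> m")
    case True
    then obtain m where "m \<in> A" "\<forall>x\<in>A. x \<le> m" by blast
    then show ?thesis using that[of "\<lambda>_. m"] by auto
  next
    case False
    have "\<exists>k. x \<le> a k" if xA: "x \<in> A" for x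
    proof -
      obtain y where y: "y \<in> A" "x < y" using False xA not_le by blast
      obtain q where q: "x < real_of_rat q" "real_of_rat q < y" using of_rat_dense[OF y(2)] by blast
      obtain k where k: "q = nat_to_rat_surj k" using surj_nat_to_rat_surj by (metis surjD)
      have "\<exists>x\<in>A. real_of_rat q < x" using y q by blast
      then have "a k = (SOME x. x \<in> A \<and> real_of_rat q < x)" "real_of_rat q < (SOME x. x \<in> A \<and> real_of_rat q < x)"
        using sel[of "real_of_rat q"] unfolding a_def k Let_def by simp_all
      then have "x < a k" using q by linarith
      then show ?thesis by (meson less_imp_le)
    qed
    then show ?thesis using aA that by blast
  qed
qed

text \<open>The cut points are taken in \<open>A\<close> because Brunn--Minkowski translates by
  them. Running maxima of a cofinal sequence stay in \<open>A\<close> and give an increasing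
  exhaustion.\<close>

lemma emeasure_eq_SUP_truncated_above:
  fixes A :: "real set"
  assumes [measurable]: "A \<in> sets borel" and ne: "A \<noteq> {}"
  shows "emeasure lborel A = (SUP a\<in>A. emeasure lborel (A \<inter> {..a}))"
proof (rule antisym)
  obtain a :: "nat \<Rightarrow> real" where a: "\<And>k. a k \<in> A" "\<And>x. x \<in> A \<Longrightarrow> \<exists>k. x \<le> a k"
    using cofinal_sequence_real[OF ne] by blast
  define S where "S k = A \<inter> {..Max (a ` {..k})}" for k
  have inc: "incseq S"
    unfolding S_def by (rule incseq_SucI) (auto simp: atMost_Suc)
  have "Max (a ` {..k}) \<in> A" for k
    using Max_in[of "a ` {..k}"] a(1) by (metis (no_types, lifting) finite_atMost finite_imageI image_is_empty atMost_iff empty_iff imageE le_refl)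
  then have le: "emeasure lborel (S k) \<le> (SUP a\<in>A. emeasure lborel (A \<inter> {..a}))" for k
    unfolding S_def by (intro SUP_upper) auto
  have "(\<Union>k. S k) = A"
    unfolding S_def using a(2) by (force simp: Max_ge_iff)
  then have "emeasure lborel A = (SUP k. emeasure lborel (S k))"
    using SUP_emeasure_incseq[OF _ inc, of lborel] by (simp add: S_def image_subset_iff)
  also have "\<dots> \<le> (SUP a\<in>A. emeasure lborel (A \<inter> {..a}))"
    by (rule SUP_least) (rule le)
  finally show "emeasure lborel A \<le> (SUP a\<in>A. emeasure lborel (A \<inter> {..a}))" .
qed (auto intro!: SUP_least emeasure_mono)

lemma emeasure_lborel_uminus:
  fixes A :: "real set"
  assumes [measurable]: "A \<in> sets borel"
  shows "emeasure lborel (uminus ` A) = emeasure lborel A"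
proof -
  have "uminus ` A = uminus -` A" by (auto simp: image_iff) (metis minus_minus)
  moreover have "emeasure (distr lborel borel (uminus :: real \<Rightarrow> real)) A = emeasure lborel (uminus -` A)"
    by (subst emeasure_distr) auto
  ultimately show ?thesis by (simp add: lborel_distr_uminus)
qed

lemma emeasure_lborel_translate:
  fixes A :: "real set"
  assumes [measurable]: "A \<in> sets borel"
  shows "emeasure lborel ((+) c ` A) = emeasure lborel A"
proof -
  have "(+) c ` A = (+) (- c) -` A" by (force simp: image_iff)
  moreover have "emeasure (distr lborel borel ((+) (- c))) A = emeasure lborel ((+) (- c) -` A)"
    by (subst emeasure_distr) auto
  ultimately show ?thesis by (simp add: lborel_distr_plus)
qed

lemma emeasure_eq_SUP_truncated_below:
  fixes A :: "real set"
  assumes [measurable]: "A \<in> sets borel" and ne: "A \<noteq> {}"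
  shows "emeasure lborel A = (SUP a\<in>A. emeasure lborel (A \<inter> {a..}))"
proof -
  have m: "uminus ` A \<in> sets borel"
  proof -
    have "uminus ` A = uminus -` A \<inter> space borel" by (auto simp: image_iff) (metis minus_minus)
    also have "\<dots> \<in> sets borel" by measurable
    finally show ?thesis .
  qed
  have "emeasure lborel A = (SUP a\<in>uminus ` A. emeasure lborel (uminus ` A \<inter> {..a}))"
    using emeasure_eq_SUP_truncated_above[OF m] ne emeasure_lborel_uminus[of A] by simp
  also have "\<dots> = (SUP a\<in>A. emeasure lborel (uminus ` A \<inter> {..- a}))"
    by (simp add: image_image)
  also have "\<dots> = (SUP a\<in>A. emeasure lborel (A \<inter> {a..}))"
  proof (rule SUP_cong[OF refl])
    fix a
    have "uminus ` A \<inter> {..- a} = uminus ` (A \<inter> {a..})" by auto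
    then show "emeasure lborel (uminus ` A \<inter> {..- a}) = emeasure lborel (A \<inter> {a..})"
      by (simp add: emeasure_lborel_uminus)
  qed
  finally show ?thesis .
qed

text \<open>
  For \<open>a \<in> A\<close> and \<open>b \<in> B\<close>, the translates of \<open>A \<inter> {..a}\<close> by \<open>b\<close> and of \<open>B \<inter> {b..}\<close> by \<open>a\<close> lie in \<open>C\<close> and
  meet in at most one point, so no compactness is needed.
\<close>

lemma brunn_minkowski_real:
  fixes A B C :: "real set"
  assumes [measurable]: "A \<in> sets borel" "B \<in> sets borel" "C \<in> sets borel"
    and ne: "A \<noteq> {}" "B \<noteq> {}"
    and sub: "\<And>a b. a \<in> A \<Longrightarrow> b \<in> B \<Longrightarrow> a + b \<in> C"
  shows "emeasure lborel A + emeasure lborel B \<le> emeasure lborel C"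
proof -
  have *: "emeasure lborel (A \<inter> {..a}) + emeasure lborel (B \<inter> {b..}) \<le> emeasure lborel C"
    if "a \<in> A" "b \<in> B" for a b
  proof -
    let ?S = "(+) b ` (A \<inter> {..a})" and ?T = "(+) a ` (B \<inter> {b..})"
    have img: "(+) c ` X \<in> sets borel" if [measurable]: "X \<in> sets borel" for c :: real and X
    proof -
      have "(+) c ` X = (+) (- c) -` X \<inter> space borel" by (force simp: image_iff)
      also have "\<dots> \<in> sets borel" by measurable
      finally show ?thesis .
    qed
    have [measurable]: "?S \<in> sets borel" "?T \<in> sets borel" by (auto intro!: img)
    have "emeasure lborel (A \<inter> {..a}) + emeasure lborel (B \<inter> {b..}) = emeasure lborel ?S + emeasure lborel ?T"
      by (simp add: emeasure_lborel_translate)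
    also have "emeasure lborel ?T = emeasure lborel (?T - {a + b})"
      by (rule emeasure_Diff_null_set[symmetric]) auto
    also have "emeasure lborel ?S + emeasure lborel (?T - {a + b}) = emeasure lborel (?S \<union> (?T - {a + b}))"
      by (rule plus_emeasure) (measurable, auto)
    also have "\<dots> \<le> emeasure lborel C"
      using sub[of a] sub[of _ b] that by (intro emeasure_mono) (auto simp: add.commute[of b])
    finally show ?thesis .
  qed
  have "emeasure lborel A + emeasure lborel B
      = (SUP b\<in>B. SUP a\<in>A. emeasure lborel (A \<inter> {..a}) + emeasure lborel (B \<inter> {b..}))"
    by (subst emeasure_eq_SUP_truncated_above[of A], simp, rule ne,
        subst emeasure_eq_SUP_truncated_below[of B], simp, rule ne)
       (simp add: ennreal_SUP_add_left[symmetric] ennreal_SUP_add_right ne del: ennreal_SUP_add_left)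
  also have "\<dots> \<le> emeasure lborel C"
    by (intro SUP_least *)
  finally show ?thesis .
qed

section \<open>Level sets and the one-dimensional Prekopa--Leindler inequality\<close>

lemma nn_integral_layer_cake:
  fixes u :: "real \<Rightarrow> real"
  assumes [measurable]: "u \<in> borel_measurable borel" and nn: "\<And>x. 0 \<le> u x"
  shows "(\<integral>\<^sup>+x. ennreal (u x) \<partial>lborel)
    = (\<integral>\<^sup>+t. emeasure lborel {x. t < u x} * indicator {0<..} t \<partial>lborel)"
proof -
  have "ennreal (u x) = (\<integral>\<^sup>+t. indicator {0<..<u x} t \<partial>lborel)" for x
    using nn[of x] by simp
  then have "(\<integral>\<^sup>+x. ennreal (u x) \<partial>lborel) = (\<integral>\<^sup>+x. (\<integral>\<^sup>+t. indicator {0<..<u x} t \<partial>lborel) \<partial>lborel)"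
    by presburger
  also have "\<dots> = (\<integral>\<^sup>+x. (\<integral>\<^sup>+t. indicator {(x, t). 0 < t \<and> t < u x} (x, t) \<partial>lborel) \<partial>lborel)"
    by (intro nn_integral_cong) (auto simp: indicator_def)
  also have "\<dots> = (\<integral>\<^sup>+t. (\<integral>\<^sup>+x. indicator {(x, t). 0 < t \<and> t < u x} (x, t) \<partial>lborel) \<partial>lborel)"
    by (rule lborel_pair.Fubini'[symmetric]) (simp add: lborel_prod[symmetric] split_beta', measurable)
  also have "\<dots> = (\<integral>\<^sup>+t. emeasure lborel {x. t < u x} * indicator {0<..} t \<partial>lborel)"
  proof (intro nn_integral_cong)
    fix t
    have "(\<integral>\<^sup>+x. indicator {(x, t). 0 < t \<and> t < u x} (x, t) \<partial>lborel)
       = (\<integral>\<^sup>+x. indicator {x. t < u x} x * indicator {0<..} t \<partial>lborel)"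
      by (intro nn_integral_cong) (auto simp: indicator_def)
    also have "\<dots> = emeasure lborel {x. t < u x} * indicator {0<..} t"
      by (subst nn_integral_multc) (auto simp: nn_integral_indicator)
    finally show "(\<integral>\<^sup>+x. indicator {(x, t). 0 < t \<and> t < u x} (x, t) \<partial>lborel)
       = emeasure lborel {x. t < u x} * indicator {0<..} t" .
  qed
  finally show ?thesis .
qed

text \<open>For \<open>t < 1\<close> a point of \<open>{x. t < u x}\<close> and a point of
  \<open>{x. t < v x}\<close> add up to a point of the doubled superlevel set of \<open>w\<close>.
  Brunn--Minkowski at each level and integration over \<open>t\<close> give the additive form. Equal
  suprema guarantee that no level below 1 has exactly one empty set, a case that Brunn--Minkowski
  does not cover.\<close>

lemma prekopa_leindler_normalised:
  fixes u v w :: "real \<Rightarrow> real"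
  assumes [measurable]: "u \<in> borel_measurable borel" "v \<in> borel_measurable borel" "w \<in> borel_measurable borel"
    and nn: "\<And>x. 0 \<le> u x" "\<And>x. 0 \<le> v x" "\<And>x. 0 \<le> w x"
    and le1: "\<And>x. u x \<le> 1" "\<And>x. v x \<le> 1"
    and sup: "\<And>t. t < 1 \<Longrightarrow> \<exists>x. t < u x" "\<And>t. t < 1 \<Longrightarrow> \<exists>x. t < v x"
    and uvw: "\<And>x y. u x * v y \<le> (w ((x + y) / 2))\<^sup>2"
  shows "(\<integral>\<^sup>+x. ennreal (u x) \<partial>lborel) + (\<integral>\<^sup>+x. ennreal (v x) \<partial>lborel) \<le> 2 * (\<integral>\<^sup>+x. ennreal (w x) \<partial>lborel)"
proof -
  have lev: "emeasure lborel {x. t < u x} + emeasure lborel {x. t < v x} \<le> 2 * emeasure lborel {x. t < w x}"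
    if t: "0 < t" "t < 1" for t
  proof -
    let ?C = "{z. t < w (z / 2)}"
    have "emeasure lborel {x. t < u x} + emeasure lborel {x. t < v x} \<le> emeasure lborel ?C"
    proof (rule brunn_minkowski_real)
      fix a b assume "a \<in> {x. t < u x}" "b \<in> {x. t < v x}"
      then have "t * t < u a * v b" using t by (intro mult_strict_mono) auto
      also have "\<dots> \<le> (w ((a + b) / 2))\<^sup>2" by (rule uvw)
      finally have "t\<^sup>2 < (w ((a + b) / 2))\<^sup>2" by (simp add: power2_eq_square)
      then show "a + b \<in> ?C" using nn(3) t power_less_imp_less_base by blast
    qed (use sup[OF t(2)] in \<open>auto, measurable\<close>)
    also have "emeasure lborel ?C = (\<integral>\<^sup>+z. indicator ?C z \<partial>lborel)" by simp
    also have "\<dots> = 2 * (\<integral>\<^sup>+z. indicator ?C (0 + 2 * z) \<partial>lborel)"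
      by (subst nn_integral_real_affine[where c=2 and t=0]) auto
    also have "(\<integral>\<^sup>+z. indicator ?C (0 + 2 * z) \<partial>lborel) = (\<integral>\<^sup>+z. indicator {x. t < w x} z \<partial>lborel)"
      by (intro nn_integral_cong) (auto simp: indicator_def)
    also have "\<dots> = emeasure lborel {x. t < w x}" by simp
    finally show ?thesis .
  qed
  have "(\<integral>\<^sup>+x. ennreal (u x) \<partial>lborel) + (\<integral>\<^sup>+x. ennreal (v x) \<partial>lborel)
      = (\<integral>\<^sup>+t. emeasure lborel {x. t < u x} * indicator {0<..} t
          + emeasure lborel {x. t < v x} * indicator {0<..} t \<partial>lborel)"
    by (subst nn_integral_add) (auto simp: nn_integral_layer_cake nn)
  also have "\<dots> \<le> (\<integral>\<^sup>+t. 2 * (emeasure lborel {x. t < w x} * indicator {0<..} t) \<partial>lborel)"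
  proof (rule nn_integral_mono)
    fix t :: real
    show "emeasure lborel {x. t < u x} * indicator {0<..} t + emeasure lborel {x. t < v x} * indicator {0<..} t
      \<le> 2 * (emeasure lborel {x. t < w x} * indicator {0<..} t)"
    proof (cases "0 < t \<and> t < 1")
      case True then show ?thesis using lev[of t] by simp
    next
      case False
      have "{x. t < u x} = {}" "{x. t < v x} = {}" if "1 \<le> t"
        using le1 that by (auto simp: not_less intro: order_trans)
      then show ?thesis using False by (auto simp: indicator_def)
    qed
  qed
  also have "\<dots> = 2 * (\<integral>\<^sup>+x. ennreal (w x) \<partial>lborel)"
    by (subst nn_integral_cmult) (auto simp: nn_integral_layer_cake nn)
  finally show ?thesis .
qed

lemma four_mult_le_square_sum: "4 * (x * y) \<le> (x + y)\<^sup>2" for x y :: real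
  using zero_le_power2[of "x - y"] by (simp add: power2_eq_square algebra_simps)

text \<open>Dividing \<open>u\<close> and \<open>v\<close> by their suprema and \<open>w\<close> by
  the geometric mean \<open>r\<close> of these suprema keeps the hypothesis, so the normalised form
  applies. The arithmetic-geometric mean inequality then turns the sum of the integrals into their
  product, and the suprema cancel.\<close>

lemma prekopa_leindler_real:
  fixes u v w :: "real \<Rightarrow> real"
  assumes [measurable]: "u \<in> borel_measurable borel" "v \<in> borel_measurable borel" "w \<in> borel_measurable borel"
    and nn: "\<And>x. 0 \<le> u x" "\<And>x. 0 \<le> v x" "\<And>x. 0 \<le> w x"
    and bdd: "bdd_above (range u)" "bdd_above (range v)"
    and pos: "0 < u x0" "0 < v y0"
    and uvw: "\<And>x y. u x * v y \<le> (w ((x + y) / 2))\<^sup>2"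
    and W: "(\<integral>\<^sup>+x. ennreal (w x) \<partial>lborel) = ennreal W" "0 \<le> W"
  shows "(\<integral>\<^sup>+x. ennreal (u x) \<partial>lborel) * (\<integral>\<^sup>+x. ennreal (v x) \<partial>lborel) \<le> ennreal (W\<^sup>2)"
proof -
  define su sv where "su = (SUP x. u x)" and "sv = (SUP x. v x)"
  have up: "u x \<le> su" "v x \<le> sv" for x
    unfolding su_def sv_def using bdd by (auto intro: cSUP_upper)
  have spos: "0 < su" "0 < sv" using up[of x0] up[of y0] pos by auto
  define r where "r = sqrt (su * sv)"
  have r: "0 < r" "r\<^sup>2 = su * sv" unfolding r_def using spos by auto
  have exu: "\<exists>x. t < u x / su" if "t < 1" for t
  proof -
    have "t * su < su" using that spos by simp
    then obtain x where "t * su < u x" unfolding su_def using less_cSUP_iff[OF _ bdd(1)] by auto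
    then show ?thesis using spos by (auto simp: field_simps)
  qed
  have exv: "\<exists>x. t < v x / sv" if "t < 1" for t
  proof -
    have "t * sv < sv" using that spos by simp
    then obtain x where "t * sv < v x" unfolding sv_def using less_cSUP_iff[OF _ bdd(2)] by auto
    then show ?thesis using spos by (auto simp: field_simps)
  qed
  have scale: "(\<integral>\<^sup>+x. ennreal (h x / c) \<partial>lborel) = ennreal (1 / c) * (\<integral>\<^sup>+x. ennreal (h x) \<partial>lborel)"
    if [measurable]: "h \<in> borel_measurable borel" and "\<And>x. 0 \<le> h x" "0 < c" for h :: "real \<Rightarrow> real" and c
    using that by (subst nn_integral_cmult[symmetric]) (auto simp: ennreal_mult'[symmetric] intro!: nn_integral_cong)
  have uvw': "u x / su * (v y / sv) \<le> (w ((x + y) / 2) / r)\<^sup>2" for x y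
    using uvw[of x y] spos r by (simp add: power_divide divide_right_mono)
  have main: "ennreal (1 / su) * (\<integral>\<^sup>+x. ennreal (u x) \<partial>lborel) + ennreal (1 / sv) * (\<integral>\<^sup>+x. ennreal (v x) \<partial>lborel)
       \<le> 2 * (ennreal (1 / r) * ennreal W)"
    using prekopa_leindler_normalised[of "\<lambda>x. u x / su" "\<lambda>x. v x / sv" "\<lambda>x. w x / r"] exu exv uvw' up spos r nn
    by (simp add: scale W)
  also have "\<dots> = ennreal (2 * W / r)"
    using W r by (simp add: ennreal_mult'[symmetric] ennreal_numeral[symmetric] del: ennreal_numeral)
  finally have main': "ennreal (1 / su) * (\<integral>\<^sup>+x. ennreal (u x) \<partial>lborel) + ennreal (1 / sv) * (\<integral>\<^sup>+x. ennreal (v x) \<partial>lborel)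
       \<le> ennreal (2 * W / r)" .
  have "ennreal (1 / su) * (\<integral>\<^sup>+x. ennreal (u x) \<partial>lborel) < \<infinity>"
       "ennreal (1 / sv) * (\<integral>\<^sup>+x. ennreal (v x) \<partial>lborel) < \<infinity>"
    by (rule le_less_trans[OF order_trans[OF _ main']], simp_all)+
  then have fin: "(\<integral>\<^sup>+x. ennreal (u x) \<partial>lborel) < \<infinity>" "(\<integral>\<^sup>+x. ennreal (v x) \<partial>lborel) < \<infinity>"
    using spos by (auto simp: ennreal_mult_less_top)
  obtain U where U: "(\<integral>\<^sup>+x. ennreal (u x) \<partial>lborel) = ennreal U" "0 \<le> U"
    using fin(1) by (cases "\<integral>\<^sup>+x. ennreal (u x) \<partial>lborel") auto
  obtain V where V: "(\<integral>\<^sup>+x. ennreal (v x) \<partial>lborel) = ennreal V" "0 \<le> V"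
    using fin(2) by (cases "\<integral>\<^sup>+x. ennreal (v x) \<partial>lborel") auto
  have "ennreal (U / su + V / sv) \<le> ennreal (2 * W / r)"
    using main' U V spos by (simp add: ennreal_mult'[symmetric] ennreal_plus[symmetric] del: ennreal_plus)
  then have le: "U / su + V / sv \<le> 2 * W / r"
    using W r by (subst (asm) ennreal_le_iff) auto
  have "4 * (U / su * (V / sv)) \<le> (U / su + V / sv)\<^sup>2"
    by (rule four_mult_le_square_sum)
  also have "\<dots> \<le> (2 * W / r)\<^sup>2"
    using le U V spos by (intro power_mono) auto
  finally have "U * V \<le> W\<^sup>2" using spos r
    by (simp add: power_divide power_mult_distrib field_simps)
  then show ?thesis using U V by (simp add: ennreal_mult'[symmetric] ennreal_leI)
qed

section \<open>Maurey's inequality, from one coordinate to functions of finitely many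
  coordinates\<close>

abbreviation std_gauss :: "real measure" where
  "std_gauss \<equiv> density lborel std_normal_density"

text \<open>Multiplying by the Gaussian density \<open>g\<close> reduces the claim to
  Prekopa--Leindler with \<open>w = g\<close>, since the exponential factor exactly compensates the
  log-concavity of \<open>g\<close> at the midpoint.\<close>

lemma maurey_inequality_real:
  fixes a b :: "real \<Rightarrow> ennreal"
  assumes [measurable]: "a \<in> borel_measurable borel" "b \<in> borel_measurable borel"
    and ab: "\<And>x y. a x * b y \<le> ennreal (exp ((x - y)\<^sup>2 / 4))"
  shows "(\<integral>\<^sup>+x. a x \<partial>std_gauss) * (\<integral>\<^sup>+x. b x \<partial>std_gauss) \<le> 1"
proof -
  \<comment> \<open>If one function vanishes everywhere, the product is 0. Otherwise a point where
    the other function is nonzero bounds each function by a finite value, so both are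
    real-valued.\<close>
  consider "\<forall>x. a x = 0" | "\<forall>x. b x = 0" | x0 y0 where "a x0 \<noteq> 0" "b y0 \<noteq> 0" by blast
  then show ?thesis
  proof cases
    case 3
    have afin: "a x \<noteq> \<top>" for x
      using ab[of x y0] 3 by (auto simp: ennreal_top_mult top_unique)
    have bfin: "b x \<noteq> \<top>" for x
      using ab[of x0 x] 3 by (auto simp: ennreal_mult_top top_unique)
    define \<alpha> \<beta> where "\<alpha> x = enn2real (a x)" and "\<beta> x = enn2real (b x)" for x
    have a: "a x = ennreal (\<alpha> x)" and b: "b x = ennreal (\<beta> x)" for x
      using afin bfin by (simp_all add: \<alpha>_def \<beta>_def less_top)
    have [measurable]: "\<alpha> \<in> borel_measurable borel" "\<beta> \<in> borel_measurable borel"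
      unfolding \<alpha>_def \<beta>_def by measurable
    have nn: "0 \<le> \<alpha> x" "0 \<le> \<beta> x" for x by (simp_all add: \<alpha>_def \<beta>_def)
    have pos: "0 < \<alpha> x0" "0 < \<beta> y0" using 3 nn[of x0] nn[of y0] by (auto simp: a b less_le)
    have \<alpha>\<beta>: "\<alpha> x * \<beta> y \<le> exp ((x - y)\<^sup>2 / 4)" for x y
      using ab[of x y] nn by (simp add: a b ennreal_mult'[symmetric])
    define g where "g = std_normal_density"
    have gpos: "0 < g x" for x by (simp add: g_def normal_density_pos)
    have gg: "exp ((x - y)\<^sup>2 / 4) * (g x * g y) = (g ((x + y) / 2))\<^sup>2" for x y
      unfolding g_def std_normal_density_def
      by (simp add: power_mult_distrib power_divide exp_of_nat_mult[symmetric] exp_add[symmetric] mult_exp_exp)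
         (simp add: power2_eq_square field_simps)
    \<comment> \<open>With one argument fixed, the Gaussian decay beats the growth of
      \<open>exp ((x - y)\<^sup>2 / 4)\<close> because \<open>(x + y)\<^sup>2\<close> is
      nonnegative. This makes \<open>\<alpha> * g\<close> and \<open>\<beta> * g\<close> bounded, as
      Prekopa--Leindler demands.\<close>
    have gb: "exp ((x - y)\<^sup>2 / 4) * g x \<le> exp (y\<^sup>2 / 2)" for x y
    proof -
      have "(x - y)\<^sup>2 / 4 - x\<^sup>2 / 2 \<le> y\<^sup>2 / 2"
        using zero_le_power2[of "x + y"] by (simp add: power2_eq_square algebra_simps)
      then have "exp ((x - y)\<^sup>2 / 4) * exp (- x\<^sup>2 / 2) \<le> exp (y\<^sup>2 / 2)"
        by (simp add: mult_exp_exp)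
      moreover have "g x \<le> exp (- x\<^sup>2 / 2)"
        unfolding g_def std_normal_density_def using pi_ge_two
        by (simp add: divide_le_eq)
      ultimately show ?thesis
        by (meson exp_ge_zero mult_left_mono order_trans)
    qed
    have ba: "\<alpha> x * g x \<le> exp (y0\<^sup>2 / 2) / \<beta> y0" for x
    proof -
      have "\<alpha> x * \<beta> y0 * g x \<le> exp ((x - y0)\<^sup>2 / 4) * g x"
        using \<alpha>\<beta>[of x y0] gpos[of x] by (intro mult_right_mono) auto
      also have "\<dots> \<le> exp (y0\<^sup>2 / 2)" by (rule gb)
      finally show ?thesis using pos by (simp add: field_simps)
    qed
    have bb: "\<beta> x * g x \<le> exp (x0\<^sup>2 / 2) / \<alpha> x0" for x
    proof -
      have "\<alpha> x0 * \<beta> x * g x \<le> exp ((x - x0)\<^sup>2 / 4) * g x"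
        using \<alpha>\<beta>[of x0 x] gpos[of x] by (intro mult_right_mono) (auto simp: power2_commute)
      also have "\<dots> \<le> exp (x0\<^sup>2 / 2)" by (rule gb)
      finally show ?thesis using pos by (simp add: field_simps)
    qed
    have "(\<integral>\<^sup>+x. ennreal (\<alpha> x * g x) \<partial>lborel) * (\<integral>\<^sup>+x. ennreal (\<beta> x * g x) \<partial>lborel) \<le> ennreal (1\<^sup>2)"
    proof (rule prekopa_leindler_real[where w=g and ?x0.0=x0 and ?y0.0=y0])
      show "(\<integral>\<^sup>+x. ennreal (g x) \<partial>lborel) = ennreal 1"
        unfolding g_def by (subst nn_integral_eq_integral) auto
      show "\<alpha> x * g x * (\<beta> y * g y) \<le> (g ((x + y) / 2))\<^sup>2" for x y
      proof -
        have "\<alpha> x * \<beta> y * (g x * g y) \<le> exp ((x - y)\<^sup>2 / 4) * (g x * g y)"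
          using \<alpha>\<beta>[of x y] gpos by (intro mult_right_mono) (auto intro: less_imp_le)
        then show ?thesis unfolding gg by (simp add: mult_ac)
      qed
      show "bdd_above (range (\<lambda>x. \<alpha> x * g x))" "bdd_above (range (\<lambda>x. \<beta> x * g x))"
        using ba bb by (auto intro!: bdd_aboveI2)
    qed (use pos gpos nn in \<open>auto simp: g_def less_imp_le\<close>)
    moreover have "(\<integral>\<^sup>+x. a x \<partial>std_gauss) = (\<integral>\<^sup>+x. ennreal (\<alpha> x * g x) \<partial>lborel)"
      by (subst nn_integral_density)
         (auto simp: a g_def ennreal_mult'' nn mult.commute intro!: nn_integral_cong)
    moreover have "(\<integral>\<^sup>+x. b x \<partial>std_gauss) = (\<integral>\<^sup>+x. ennreal (\<beta> x * g x) \<partial>lborel)"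
      by (subst nn_integral_density)
         (auto simp: b g_def ennreal_mult'' nn mult.commute intro!: nn_integral_cong)
    ultimately show ?thesis by simp
  qed simp_all
qed


lemma prob_space_std_gauss: "prob_space std_gauss"
  by (rule prob_space_normal_density) simp

lemma product_prob_space_gauss: "product_prob_space (\<lambda>_::'i. std_gauss)"
  by (simp add: product_prob_space_def product_prob_space_axioms_def prob_space_std_gauss product_sigma_finite_def
     prob_space_imp_sigma_finite)

abbreviation gauss_prod :: "('i \<Rightarrow> real) measure" where
  "gauss_prod \<equiv> PiM UNIV (\<lambda>_. std_gauss)"

text \<open>Tensorisation: integrating out the coordinate \<open>i\<close> gives functions
  \<open>A\<close> and \<open>B\<close> of the other coordinates, and the one-dimensional inequality
  on the fibres shows that they satisfy the hypothesis for \<open>I\<close>. No constant is lost in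
  a step.\<close>

lemma maurey_inequality_PiM:
  fixes a b :: "('i \<Rightarrow> real) \<Rightarrow> ennreal"
  assumes "finite I"
    and "a \<in> borel_measurable (PiM I (\<lambda>_. std_gauss))" "b \<in> borel_measurable (PiM I (\<lambda>_. std_gauss))"
    and "\<And>x y. x \<in> space (PiM I (\<lambda>_. std_gauss)) \<Longrightarrow> y \<in> space (PiM I (\<lambda>_. std_gauss)) \<Longrightarrow>
           a x * b y \<le> ennreal (exp ((\<Sum>i\<in>I. (x i - y i)\<^sup>2) / 4))"
  shows "(\<integral>\<^sup>+x. a x \<partial>PiM I (\<lambda>_. std_gauss)) * (\<integral>\<^sup>+x. b x \<partial>PiM I (\<lambda>_. std_gauss)) \<le> 1"
  using assms
proof (induction I arbitrary: a b rule: finite_induct)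
  case empty
  interpret product_prob_space "\<lambda>_::'i. std_gauss" UNIV by (rule product_prob_space_gauss)
  show ?case
    using empty(3)[of "\<lambda>_. undefined" "\<lambda>_. undefined"]
    by (simp add: nn_integral_empty space_PiM)
next
  case (insert i I)
  interpret product_prob_space "\<lambda>_::'i. std_gauss" UNIV by (rule product_prob_space_gauss)
  note [measurable] = insert.prems(1,2)
  let ?M = "PiM I (\<lambda>_::'i. std_gauss)"
  define A where "A x = (\<integral>\<^sup>+y. a (x(i := y)) \<partial>std_gauss)" for x
  define B where "B x = (\<integral>\<^sup>+y. b (x(i := y)) \<partial>std_gauss)" for x
  have mA[measurable]: "A \<in> borel_measurable ?M" unfolding A_def by measurable
  have mB[measurable]: "B \<in> borel_measurable ?M" unfolding B_def by measurable
  have "A x * B y \<le> ennreal (exp ((\<Sum>i\<in>I. (x i - y i)\<^sup>2) / 4))"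
    if x: "x \<in> space ?M" and y: "y \<in> space ?M" for x y
  proof -
    define s where "s = (\<Sum>i\<in>I. (x i - y i)\<^sup>2) / 4"
    have [measurable]: "(\<lambda>t. a (x(i := t))) \<in> borel_measurable std_gauss"
      "(\<lambda>t. b (y(i := t))) \<in> borel_measurable std_gauss"
      using x y by measurable
    have "(\<integral>\<^sup>+t. a (x(i := t)) \<partial>std_gauss) * (\<integral>\<^sup>+t. ennreal (exp (- s)) * b (y(i := t)) \<partial>std_gauss) \<le> 1"
    proof (rule maurey_inequality_real)
      fix p q
      have "x(i := p) \<in> space (PiM (insert i I) (\<lambda>_::'i. std_gauss))" "y(i := q) \<in> space (PiM (insert i I) (\<lambda>_::'i. std_gauss))"
        using x y by (auto simp: space_PiM PiE_def extensional_def)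
      from insert.prems(3)[OF this]
      have "a (x(i := p)) * b (y(i := q)) \<le> ennreal (exp ((\<Sum>j\<in>insert i I. ((x(i := p)) j - (y(i := q)) j)\<^sup>2) / 4))" .
      also have "(\<Sum>j\<in>insert i I. ((x(i := p)) j - (y(i := q)) j)\<^sup>2) = (p - q)\<^sup>2 + (\<Sum>j\<in>I. (x j - y j)\<^sup>2)"
        using insert.hyps by (auto intro!: sum.cong)
      also have "((p - q)\<^sup>2 + (\<Sum>j\<in>I. (x j - y j)\<^sup>2)) / 4 = (p - q)\<^sup>2 / 4 + s"
        by (simp add: s_def add_divide_distrib)
      finally have "ennreal (exp (- s)) * (a (x(i := p)) * b (y(i := q))) \<le> ennreal (exp (- s)) * ennreal (exp ((p - q)\<^sup>2 / 4 + s))"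
        by (rule mult_left_mono) simp
      also have "\<dots> = ennreal (exp ((p - q)\<^sup>2 / 4))"
        by (simp add: ennreal_mult'[symmetric] mult_exp_exp)
      finally show "a (x(i := p)) * (ennreal (exp (- s)) * b (y(i := q))) \<le> ennreal (exp ((p - q)\<^sup>2 / 4))"
        by (simp add: mult_ac)
    qed (use measurable_lborel1 in simp_all)
    then have "ennreal (exp (- s)) * (A x * B y) \<le> 1"
      unfolding A_def B_def by (subst (asm) nn_integral_cmult) (simp_all add: mult_ac)
    then have "ennreal (exp s) * (ennreal (exp (- s)) * (A x * B y)) \<le> ennreal (exp s) * 1"
      by (rule mult_left_mono) simp
    moreover have "ennreal (exp s) * (ennreal (exp (- s)) * (A x * B y)) = A x * B y"
      unfolding mult.assoc[symmetric] by (simp add: ennreal_mult'[symmetric] mult_exp_exp)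
    ultimately show ?thesis by (simp add: s_def)
  qed
  from insert.IH[OF mA mB this]
  show ?case
    unfolding A_def B_def using insert.hyps by (simp add: product_nn_integral_insert)
qed

text \<open>Points of the product over \<open>I\<close> are \<open>undefined\<close> outside
  \<open>I\<close>; padding with 0 makes them arguments of functions on the full product.\<close>

lemma measurable_extend_zero:
  "(\<lambda>x i. if i \<in> I then x i else 0) \<in> measurable (PiM I (\<lambda>_. std_gauss)) gauss_prod"
proof (rule measurable_PiM_single')
  fix i
  show "(\<lambda>x. if i \<in> I then x i else 0) \<in> measurable (PiM I (\<lambda>_. std_gauss)) std_gauss"
    by (cases "i \<in> I") auto
qed auto

lemma PiM_nn_integral_finite_dependence:
  fixes h :: "('i \<Rightarrow> real) \<Rightarrow> ennreal"
  assumes I: "finite I" and [measurable]: "h \<in> borel_measurable gauss_prod"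
    and dep: "\<And>x y. (\<And>i. i \<in> I \<Longrightarrow> x i = y i) \<Longrightarrow> h x = h y"
  shows "(\<integral>\<^sup>+x. h x \<partial>gauss_prod)
       = (\<integral>\<^sup>+x. h (\<lambda>i. if i \<in> I then x i else 0) \<partial>PiM I (\<lambda>_. std_gauss))"
    and "(\<lambda>x. h (\<lambda>i. if i \<in> I then x i else 0)) \<in> borel_measurable (PiM I (\<lambda>_. std_gauss))"
proof -
  interpret product_prob_space "\<lambda>_::'i. std_gauss" UNIV by (rule product_prob_space_gauss)
  show m[measurable]: "(\<lambda>x. h (\<lambda>i. if i \<in> I then x i else 0)) \<in> borel_measurable (PiM I (\<lambda>_. std_gauss))"
    by (rule measurable_compose[OF measurable_extend_zero]) simp
  have "(\<integral>\<^sup>+x. h (\<lambda>i. if i \<in> I then x i else 0) \<partial>PiM I (\<lambda>_. std_gauss))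
     = (\<integral>\<^sup>+x. h (\<lambda>i. if i \<in> I then x i else 0) \<partial>distr gauss_prod (PiM I (\<lambda>_. std_gauss)) (\<lambda>x. restrict x I))"
    by (subst distr_PiM_restrict_finite) (use I in auto)
  also have "\<dots> = (\<integral>\<^sup>+x. h (\<lambda>i. if i \<in> I then restrict x I i else 0) \<partial>gauss_prod)"
    by (subst nn_integral_distr) (auto intro: measurable_restrict_subset)
  also have "\<dots> = (\<integral>\<^sup>+x. h x \<partial>gauss_prod)"
    by (intro nn_integral_cong dep) auto
  finally show "(\<integral>\<^sup>+x. h x \<partial>gauss_prod)
       = (\<integral>\<^sup>+x. h (\<lambda>i. if i \<in> I then x i else 0) \<partial>PiM I (\<lambda>_. std_gauss))" by simp
qed

lemma gaussian_concentration:
  fixes a :: "('i \<Rightarrow> real) \<Rightarrow> real"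
  assumes I: "finite I" and [measurable]: "a \<in> borel_measurable gauss_prod"
    and E[measurable]: "E \<in> sets gauss_prod"
    and depa: "\<And>x y. (\<And>i. i \<in> I \<Longrightarrow> x i = y i) \<Longrightarrow> a x = a y"
    and depE: "\<And>x y. (\<And>i. i \<in> I \<Longrightarrow> x i = y i) \<Longrightarrow> x \<in> E \<longleftrightarrow> y \<in> E"
    and half: "emeasure gauss_prod E \<ge> ennreal (1 / 2)"
    and K: "0 < K" and bound: "\<And>x y. y \<in> E \<Longrightarrow> a x \<le> K * exp ((\<Sum>i\<in>I. (x i - y i)\<^sup>2) / 4)"
  shows "(\<integral>\<^sup>+x. ennreal (a x) \<partial>gauss_prod) \<le> ennreal (2 * K)"
proof -
  let ?M = "gauss_prod" and ?MI = "PiM I (\<lambda>_::'i. std_gauss)"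
  let ?e = "\<lambda>x i. if i \<in> I then x i else (0::real)"
  define A where "A x = ennreal (a x)" for x
  define B :: "('i \<Rightarrow> real) \<Rightarrow> ennreal" where "B x = ennreal (1 / K) * indicator E x" for x
  have [measurable]: "A \<in> borel_measurable ?M" "B \<in> borel_measurable ?M"
    unfolding A_def B_def by measurable
  have dA: "(\<And>i. i \<in> I \<Longrightarrow> x i = y i) \<Longrightarrow> A x = A y" for x y
    unfolding A_def using depa[of x y] by simp
  have dB: "(\<And>i. i \<in> I \<Longrightarrow> x i = y i) \<Longrightarrow> B x = B y" for x y
    unfolding B_def using depE[of x y] by (auto simp: indicator_def)
  have iA: "(\<integral>\<^sup>+x. A x \<partial>?M) = (\<integral>\<^sup>+x. A (?e x) \<partial>?MI)"
    by (rule PiM_nn_integral_finite_dependence(1)[OF I]) (auto intro: dA)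
  have iB: "(\<integral>\<^sup>+x. B x \<partial>?M) = (\<integral>\<^sup>+x. B (?e x) \<partial>?MI)"
    by (rule PiM_nn_integral_finite_dependence(1)[OF I]) (auto intro: dB)
  have "(\<integral>\<^sup>+x. A (?e x) \<partial>?MI) * (\<integral>\<^sup>+x. B (?e x) \<partial>?MI) \<le> 1"
  proof (rule maurey_inequality_PiM[OF I])
    fix x y :: "'i \<Rightarrow> real"
    show "A (?e x) * B (?e y) \<le> ennreal (exp ((\<Sum>i\<in>I. (x i - y i)\<^sup>2) / 4))"
    proof (cases "?e y \<in> E")
      case True
      have "a (?e x) \<le> K * exp ((\<Sum>i\<in>I. (?e x i - ?e y i)\<^sup>2) / 4)" by (rule bound[OF True])
      also have "(\<Sum>i\<in>I. (?e x i - ?e y i)\<^sup>2) = (\<Sum>i\<in>I. (x i - y i)\<^sup>2)" by (intro sum.cong) auto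
      finally have "a (?e x) / K \<le> exp ((\<Sum>i\<in>I. (x i - y i)\<^sup>2) / 4)" using K by (simp add: field_simps)
      then show ?thesis
        using True K by (simp add: A_def B_def ennreal_mult''[symmetric] ennreal_leI)
    qed (simp add: B_def)
  qed (intro PiM_nn_integral_finite_dependence(2)[OF I]; auto intro: dA dB)+
  then have le: "(\<integral>\<^sup>+x. A x \<partial>?M) * (\<integral>\<^sup>+x. B x \<partial>?M) \<le> 1" unfolding iA iB .
  have "(\<integral>\<^sup>+x. B x \<partial>?M) = ennreal (1 / K) * emeasure ?M E"
    unfolding B_def by (subst nn_integral_cmult) auto
  then have "ennreal (1 / K) * ennreal (1 / 2) \<le> (\<integral>\<^sup>+x. B x \<partial>?M)"
    using half by (simp add: mult_left_mono)
  then have "(\<integral>\<^sup>+x. A x \<partial>?M) * (ennreal (1 / K) * ennreal (1 / 2)) \<le> 1"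
    using le by (meson mult_left_mono order_trans zero_le)
  then have "ennreal (2 * K) * ((\<integral>\<^sup>+x. A x \<partial>?M) * ennreal (1 / K * (1 / 2))) \<le> ennreal (2 * K) * 1"
    using K by (intro mult_left_mono) (auto simp: ennreal_mult'[of "1 / K" "1 / 2"] simp del: times_divide_eq_left times_divide_eq_right)
  moreover have "ennreal (2 * K) * ((\<integral>\<^sup>+x. A x \<partial>?M) * ennreal (1 / K * (1 / 2)))
     = (ennreal (2 * K) * ennreal (1 / K * (1 / 2))) * (\<integral>\<^sup>+x. A x \<partial>?M)" by (simp add: mult_ac)
  moreover have "ennreal (2 * K) * ennreal (1 / K * (1 / 2)) = 1"
    using K by (subst ennreal_mult'[symmetric]) auto
  ultimately show ?thesis by (simp add: A_def)
qed

section \<open>Hermite covariances of Gaussian linear forms\<close>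

lemma prob_space_gauss_prod: "prob_space (gauss_prod :: ('i \<Rightarrow> real) measure)"
  by (intro prob_space_PiM prob_space_std_gauss)

lemma distr_gauss_prod_component:
  "distr gauss_prod std_gauss (\<lambda>x. x i) = std_gauss"
  by (rule distr_PiM_component) (auto intro: prob_space_std_gauss)

lemma indep_vars_gauss_prod:
  "prob_space.indep_vars (gauss_prod :: ('i \<Rightarrow> real) measure) (\<lambda>_. std_gauss) (\<lambda>i x. x i) UNIV"
proof -
  interpret prob_space "gauss_prod :: ('i \<Rightarrow> real) measure" by (rule prob_space_gauss_prod)
  have "distr gauss_prod gauss_prod (\<lambda>x::'i \<Rightarrow> real. \<lambda>i\<in>UNIV. x i) = gauss_prod"
    by (simp add: restrict_UNIV distr_id2)
  then show ?thesis
    by (subst indep_vars_iff_distr_eq_PiM) (auto simp: distr_gauss_prod_component)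
qed

lemma gauss_prod_split:
  fixes h :: "('i \<Rightarrow> real) \<Rightarrow> real" and g :: "real \<Rightarrow> real"
  assumes I: "i \<notin> I" and h: "integrable gauss_prod h"
    and dep: "\<And>x y. (\<And>i. i \<in> I \<Longrightarrow> x i = y i) \<Longrightarrow> h x = h y"
    and g: "integrable std_gauss g"
  shows "integrable gauss_prod (\<lambda>x. h x * g (x i))"
    and "(\<integral>x. h x * g (x i) \<partial>gauss_prod) = (\<integral>x. h x \<partial>gauss_prod) * (\<integral>t. g t \<partial>std_gauss)"
proof -
  interpret prob_space "gauss_prod :: ('i \<Rightarrow> real) measure" by (rule prob_space_gauss_prod)
  have [measurable]: "h \<in> borel_measurable gauss_prod" using h by simp
  have [measurable]: "g \<in> borel_measurable borel" using g by (simp add: borel_measurable_integrable[OF g, simplified])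
  let ?h = "\<lambda>x. h (\<lambda>i. if i \<in> I then x i else 0)"
  have "indep_var (PiM I (\<lambda>_. std_gauss)) (\<lambda>x. restrict (\<lambda>i. x i) I) (PiM {i} (\<lambda>_. std_gauss)) (\<lambda>x. restrict (\<lambda>i. x i) {i})"
    by (rule indep_var_restrict[OF indep_vars_gauss_prod]) (use I in auto)
  then have "indep_var borel (?h \<circ> (\<lambda>x. restrict (\<lambda>i. x i) I)) borel ((\<lambda>x. g (x i)) \<circ> (\<lambda>x. restrict (\<lambda>i. x i) {i}))"
    by (rule indep_var_compose) (auto intro!: measurable_compose[OF measurable_extend_zero])
  moreover have "?h \<circ> (\<lambda>x. restrict (\<lambda>i. x i) I) = h" 
    by (auto simp: fun_eq_iff intro!: dep)
  moreover have "(\<lambda>x. g (x i)) \<circ> (\<lambda>x. restrict (\<lambda>i. x i) {i}) = (\<lambda>x. g (x i))"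
    by (auto simp: fun_eq_iff)
  ultimately have iv: "indep_var borel h borel (\<lambda>x. g (x i))" by simp
  have dg: "integrable gauss_prod (\<lambda>x. g (x i))" "(\<integral>x. g (x i) \<partial>gauss_prod) = (\<integral>t. g t \<partial>std_gauss)"
    using g distr_gauss_prod_component[of i]
    using integrable_distr_eq[of "\<lambda>x. x i" gauss_prod std_gauss g] integral_distr[of "\<lambda>x. x i" gauss_prod std_gauss g]
    by auto
  show "integrable gauss_prod (\<lambda>x. h x * g (x i))"
    by (rule indep_var_integrable[OF iv h dg(1)])
  show "(\<integral>x. h x * g (x i) \<partial>gauss_prod) = (\<integral>x. h x \<partial>gauss_prod) * (\<integral>t. g t \<partial>std_gauss)"
    using indep_var_lebesgue_integral[OF iv h dg(1)] dg(2) by simp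
qed

text \<open>The polynomials orthogonal for the centred Gaussian law of variance \<open>v\<close>.
  With \<open>v\<close> the variance of the field, degrees 2 and 3 are its Wick powers.\<close>

fun hermite :: "nat \<Rightarrow> real \<Rightarrow> real \<Rightarrow> real" where
  "hermite 0 v x = 1"
| "hermite (Suc 0) v x = x"
| "hermite (Suc (Suc n)) v x = x * hermite (Suc n) v x - real (Suc n) * v * hermite n v x"

lemma hermite_numeral:
  "hermite 1 v x = x" "hermite 2 v x = x\<^sup>2 - v" "hermite 3 v x = x ^ 3 - 3 * v * x"
  by (simp_all add: numeral_eq_Suc algebra_simps)

lemma hermite_scale: "hermite n (c\<^sup>2) (c * x) = c ^ n * hermite n 1 x"
  by (induction n "1::real" x rule: hermite.induct) (simp_all add: algebra_simps power2_eq_square)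

lemma le3_cases:
  fixes k :: nat assumes "k \<le> 3" obtains "k = 0" | "k = 1" | "k = 2" | "k = 3"
  using assms by linarith

text \<open>The generating function \<open>exp (t * x - t\<^sup>2 * v / 2)\<close> is multiplicative
  when arguments and variances add. For degrees at most 3 the identity is verified by
  expansion.\<close>

lemma hermite_add:
  assumes "k \<le> 3"
  shows "hermite k (v + w) (x + y) = (\<Sum>l\<le>k. real (k choose l) * (hermite l v x * hermite (k - l) w y))"
  using assms
  by (cases rule: le3_cases)
     (simp_all add: numeral_eq_Suc algebra_simps)

lemma std_gauss_moment:
  "integrable std_gauss (\<lambda>x. x ^ k)"
  "(\<integral>x. x ^ k \<partial>std_gauss) = (if even k then fact k / (2 ^ (k div 2) * fact (k div 2)) else 0)"
proof -
  show "integrable std_gauss (\<lambda>x. x ^ k)"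
    using integrable_std_normal_moment[of k] by (simp add: integrable_density)
  have eq: "(\<integral>x. x ^ k \<partial>std_gauss) = (\<integral>x. std_normal_density x * x ^ k \<partial>lborel)"
    by (simp add: integral_density)
  show "(\<integral>x. x ^ k \<partial>std_gauss) = (if even k then fact k / (2 ^ (k div 2) * fact (k div 2)) else 0)"
  proof (cases "even k")
    case True
    then show ?thesis unfolding eq using integral_std_normal_moment_even[of "k div 2"] by simp
  next
    case False
    then show ?thesis unfolding eq using integral_std_normal_moment_odd[of "k div 2"] by simp
  qed
qed

lemma std_gauss_moments_small:
  "(\<integral>x. x \<partial>std_gauss) = 0" "(\<integral>x. x ^ 2 \<partial>std_gauss) = 1" "(\<integral>x. x ^ 3 \<partial>std_gauss) = 0"
  "(\<integral>x. x ^ 4 \<partial>std_gauss) = 3" "(\<integral>x. x ^ 5 \<partial>std_gauss) = 0" "(\<integral>x. x ^ 6 \<partial>std_gauss) = 15"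
  using std_gauss_moment(2)[of 1] by (simp_all add: std_gauss_moment(2) fact_numeral)

text \<open>The products have degree at most 6, so everything reduces to the moments 0, 1, 0, 3, 0,
  15.\<close>

lemma hermite_orthogonal_std_gauss:
  assumes "j \<le> 3" "k \<le> 3"
  shows "integrable std_gauss (\<lambda>x. hermite j 1 x * hermite k 1 x)
    \<and> (\<integral>x. hermite j 1 x * hermite k 1 x \<partial>std_gauss) = (if j = k then fact k else 0)"
proof -
  interpret prob_space std_gauss by (rule prob_space_std_gauss)
  have I1: "integrable std_gauss (\<lambda>x. x)" using std_gauss_moment(1)[of 1] by simp
  have p: "\<And>x::real. (x^2 - 1) * (x^2 - 1) = x^4 - 2 * x^2 + 1"
     "\<And>x::real. (x^3 - 3 * x) * (x^3 - 3 * x) = x^6 - 6 * x^4 + 9 * x^2"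
     "\<And>x::real. (x^2 - 1) * (x^3 - 3 * x) = x^5 - 4 * x^3 + 3 * x"
     "\<And>x::real. (x^3 - 3 * x) * (x^2 - 1) = x^5 - 4 * x^3 + 3 * x"
     "\<And>x::real. x * (x^2 - 1) = x^3 - x" "\<And>x::real. (x^2 - 1) * x = x^3 - x"
     "\<And>x::real. x * (x^3 - 3 * x) = x^4 - 3 * x^2" "\<And>x::real. (x^3 - 3 * x) * x = x^4 - 3 * x^2"
     "\<And>x::real. x * x = x^2" "\<And>x::real. (x^2 - 1)^2 = x^4 - 2 * x^2 + 1"
     "\<And>x::real. (x^3 - 3 * x)^2 = x^6 - 6 * x^4 + 9 * x^2"
    by (simp_all add: algebra_simps power2_eq_square power3_eq_cube power4_eq_xxxx numeral_eq_Suc)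
  show ?thesis
    using assms(1)
    by (cases rule: le3_cases; use assms(2) in \<open>cases rule: le3_cases\<close>)
       (simp_all add: hermite_numeral p std_gauss_moment(1) I1 std_gauss_moments_small prob_space[simplified] fact_numeral del: hermite.simps(3) One_nat_def add: One_nat_def[symmetric])
qed

lemma hermite_covariance_std_gauss:
  assumes "j \<le> 3" "k \<le> 3"
  shows "integrable std_gauss (\<lambda>x. hermite j (\<alpha>\<^sup>2) (\<alpha> * x) * hermite k (\<beta>\<^sup>2) (\<beta> * x))"
    and "(\<integral>x. hermite j (\<alpha>\<^sup>2) (\<alpha> * x) * hermite k (\<beta>\<^sup>2) (\<beta> * x) \<partial>std_gauss) = (if j = k then fact k * (\<alpha> * \<beta>) ^ k else 0)"
proof -
  have eq: "hermite j (\<alpha>\<^sup>2) (\<alpha> * x) * hermite k (\<beta>\<^sup>2) (\<beta> * x) = \<alpha> ^ j * \<beta> ^ k * (hermite j 1 x * hermite k 1 x)" for x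
    by (simp add: hermite_scale mult_ac)
  show "integrable std_gauss (\<lambda>x. hermite j (\<alpha>\<^sup>2) (\<alpha> * x) * hermite k (\<beta>\<^sup>2) (\<beta> * x))"
    unfolding eq using hermite_orthogonal_std_gauss[OF assms] by auto
  show "(\<integral>x. hermite j (\<alpha>\<^sup>2) (\<alpha> * x) * hermite k (\<beta>\<^sup>2) (\<beta> * x) \<partial>std_gauss) = (if j = k then fact k * (\<alpha> * \<beta>) ^ k else 0)"
    unfolding eq using hermite_orthogonal_std_gauss[OF assms]
    by (auto simp: power_mult_distrib)
qed

text \<open>The Wick formula for two Gaussian linear forms, obtained by splitting off one
  independent coordinate at a time with the addition formula. This mixes the degrees, so the
  induction runs over all \<open>j\<close> and \<open>k\<close> at once.\<close>

lemma hermite_covariance: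
  fixes \<alpha> \<beta> :: "'i \<Rightarrow> real"
  assumes "finite I" "j \<le> 3" "k \<le> 3"
  shows "integrable gauss_prod (\<lambda>x. hermite j (\<Sum>i\<in>I. (\<alpha> i)\<^sup>2) (\<Sum>i\<in>I. \<alpha> i * x i)
                                * hermite k (\<Sum>i\<in>I. (\<beta> i)\<^sup>2) (\<Sum>i\<in>I. \<beta> i * x i))
       \<and> (\<integral>x. hermite j (\<Sum>i\<in>I. (\<alpha> i)\<^sup>2) (\<Sum>i\<in>I. \<alpha> i * x i)
                                * hermite k (\<Sum>i\<in>I. (\<beta> i)\<^sup>2) (\<Sum>i\<in>I. \<beta> i * x i) \<partial>gauss_prod)
         = (if j = k then fact k * (\<Sum>i\<in>I. \<alpha> i * \<beta> i) ^ k else 0)"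
  using assms
proof (induction I arbitrary: j k rule: finite_induct)
  case empty
  interpret prob_space "gauss_prod :: ('i \<Rightarrow> real) measure" by (rule prob_space_gauss_prod)
  show ?case
    using empty(1) by (cases rule: le3_cases; use empty(2) in \<open>cases rule: le3_cases\<close>) (simp_all add: prob_space numeral_eq_Suc)
next
  case (insert i I)
  define F where "F l m x = hermite l (\<Sum>i\<in>I. (\<alpha> i)\<^sup>2) (\<Sum>i\<in>I. \<alpha> i * x i)
       * hermite m (\<Sum>i\<in>I. (\<beta> i)\<^sup>2) (\<Sum>i\<in>I. \<beta> i * x i)" for l m and x :: "'i \<Rightarrow> real"
  define G where "G l m t = hermite l ((\<alpha> i)\<^sup>2) (\<alpha> i * t) * hermite m ((\<beta> i)\<^sup>2) (\<beta> i * t)" for l m t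
  have IH: "integrable gauss_prod (F l m)" "(\<integral>x. F l m x \<partial>gauss_prod) = (if l = m then fact m * (\<Sum>i\<in>I. \<alpha> i * \<beta> i) ^ m else 0)"
    if "l \<le> 3" "m \<le> 3" for l m
    using insert.IH[OF that] unfolding F_def by auto
  have G: "integrable std_gauss (G l m)" "(\<integral>x. G l m x \<partial>std_gauss) = (if l = m then fact m * (\<alpha> i * \<beta> i) ^ m else 0)"
    if "l \<le> 3" "m \<le> 3" for l m
    using hermite_covariance_std_gauss[OF that] unfolding G_def by auto
  have FG: "integrable gauss_prod (\<lambda>x. F l m x * G l' m' (x i))"
    "(\<integral>x. F l m x * G l' m' (x i) \<partial>gauss_prod) =
      (if l = m then fact m * (\<Sum>i\<in>I. \<alpha> i * \<beta> i) ^ m else 0) * (if l' = m' then fact m' * (\<alpha> i * \<beta> i) ^ m' else 0)"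
    if "l \<le> 3" "m \<le> 3" "l' \<le> 3" "m' \<le> 3" for l m l' m'
  proof -
    have dep: "F l m x = F l m y" if "\<And>i. i \<in> I \<Longrightarrow> x i = y i" for x y
    proof -
      have "(\<Sum>i\<in>I. \<alpha> i * x i) = (\<Sum>i\<in>I. \<alpha> i * y i)" "(\<Sum>i\<in>I. \<beta> i * x i) = (\<Sum>i\<in>I. \<beta> i * y i)"
        using that by (auto intro!: sum.cong)
      then show ?thesis unfolding F_def by simp
    qed
    show "integrable gauss_prod (\<lambda>x. F l m x * G l' m' (x i))"
      by (rule gauss_prod_split(1)[OF insert.hyps(2) IH(1)[OF that(1,2)] dep G(1)[OF that(3,4)]])
    show "(\<integral>x. F l m x * G l' m' (x i) \<partial>gauss_prod) =
      (if l = m then fact m * (\<Sum>i\<in>I. \<alpha> i * \<beta> i) ^ m else 0) * (if l' = m' then fact m' * (\<alpha> i * \<beta> i) ^ m' else 0)"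
      by (rule gauss_prod_split(2)[OF insert.hyps(2) IH(1)[OF that(1,2)] dep G(1)[OF that(3,4)],
            unfolded IH(2)[OF that(1,2)] G(2)[OF that(3,4)]])
  qed
  have expand: "hermite j (\<Sum>i\<in>insert i I. (\<alpha> i)\<^sup>2) (\<Sum>i\<in>insert i I. \<alpha> i * x i)
                * hermite k (\<Sum>i\<in>insert i I. (\<beta> i)\<^sup>2) (\<Sum>i\<in>insert i I. \<beta> i * x i)
       = (\<Sum>l\<le>j. \<Sum>m\<le>k. real (j choose l) * real (k choose m) * (F l m x * G (j - l) (k - m) (x i)))" for x
  proof -
    have s: "(\<Sum>i\<in>insert i I. h i) = (\<Sum>i\<in>I. h i) + h i" for h :: "'i \<Rightarrow> real"
      using insert.hyps by (simp add: add.commute)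
    show ?thesis
      unfolding s hermite_add[OF insert.prems(1)] hermite_add[OF insert.prems(2)] sum_product F_def G_def
      by (intro sum.cong refl) (simp add: mult_ac)
  qed
  have int: "integrable gauss_prod (\<lambda>x. F l m x * G (j - l) (k - m) (x i))" if "l \<le> j" "m \<le> k" for l m
    using that insert.prems by (intro FG(1)) auto
  have val: "(\<integral>x. F l m x * G (j - l) (k - m) (x i) \<partial>gauss_prod) =
      (if l = m then fact m * (\<Sum>i\<in>I. \<alpha> i * \<beta> i) ^ m else 0) * (if j - l = k - m then fact (k - m) * (\<alpha> i * \<beta> i) ^ (k - m) else 0)"
    if "l \<le> j" "m \<le> k" for l m
    using that insert.prems by (intro FG(2)) auto
  have "(\<integral>x. (\<Sum>l\<le>j. \<Sum>m\<le>k. real (j choose l) * real (k choose m) * (F l m x * G (j - l) (k - m) (x i))) \<partial>gauss_prod)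
     = (\<Sum>l\<le>j. \<Sum>m\<le>k. real (j choose l) * real (k choose m) * (\<integral>x. F l m x * G (j - l) (k - m) (x i) \<partial>gauss_prod))"
  proof (subst Bochner_Integration.integral_sum)
    show "integrable gauss_prod (\<lambda>x. \<Sum>m\<le>k. real (j choose l) * real (k choose m) * (F l m x * G (j - l) (k - m) (x i)))"
      if "l \<in> {..j}" for l
      using that by (intro Bochner_Integration.integrable_sum integrable_mult_right int) auto
    show "(\<Sum>l\<le>j. \<integral>x. (\<Sum>m\<le>k. real (j choose l) * real (k choose m) * (F l m x * G (j - l) (k - m) (x i))) \<partial>gauss_prod)
     = (\<Sum>l\<le>j. \<Sum>m\<le>k. real (j choose l) * real (k choose m) * (\<integral>x. F l m x * G (j - l) (k - m) (x i) \<partial>gauss_prod))"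
    proof (rule sum.cong[OF refl])
      fix l assume "l \<in> {..j}"
      then show "(\<integral>x. (\<Sum>m\<le>k. real (j choose l) * real (k choose m) * (F l m x * G (j - l) (k - m) (x i))) \<partial>gauss_prod)
        = (\<Sum>m\<le>k. real (j choose l) * real (k choose m) * (\<integral>x. F l m x * G (j - l) (k - m) (x i) \<partial>gauss_prod))"
        by (subst Bochner_Integration.integral_sum) (auto intro!: integrable_mult_right int)
    qed
  qed
  also have "\<dots> = (\<Sum>l\<le>j. \<Sum>m\<le>k. real (j choose l) * real (k choose m) *
     ((if l = m then fact m * (\<Sum>i\<in>I. \<alpha> i * \<beta> i) ^ m else 0) * (if j - l = k - m then fact (k - m) * (\<alpha> i * \<beta> i) ^ (k - m) else 0)))"
    by (intro sum.cong refl) (simp add: val)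
  also have "\<dots> = (if j = k then fact k * ((\<Sum>i\<in>I. \<alpha> i * \<beta> i) + \<alpha> i * \<beta> i) ^ k else 0)"
  proof (cases "j = k")
    case True
    \<comment> \<open>Both Kronecker deltas reduce to \<open>m = l\<close>. One of the two binomial
      coefficients is then absorbed by the factorials, and a binomial sum remains.\<close>
    have "(\<Sum>l\<le>j. \<Sum>m\<le>k. real (j choose l) * real (k choose m) *
     ((if l = m then fact m * (\<Sum>i\<in>I. \<alpha> i * \<beta> i) ^ m else 0) * (if j - l = k - m then fact (k - m) * (\<alpha> i * \<beta> i) ^ (k - m) else 0)))
      = (\<Sum>l\<le>k. \<Sum>m\<le>k. if m = l then real (k choose l) * (real (k choose l) * fact l * fact (k - l)) * ((\<Sum>i\<in>I. \<alpha> i * \<beta> i) ^ l * (\<alpha> i * \<beta> i) ^ (k - l)) else 0)"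
      unfolding True by (intro sum.cong refl) auto
    also have "\<dots> = (\<Sum>l\<le>k. real (k choose l) * (real (k choose l) * fact l * fact (k - l)) * ((\<Sum>i\<in>I. \<alpha> i * \<beta> i) ^ l * (\<alpha> i * \<beta> i) ^ (k - l)))"
      by (intro sum.cong refl) (simp add: sum.delta)
    also have "\<dots> = (\<Sum>l\<le>k. fact k * (real (k choose l) * (\<Sum>i\<in>I. \<alpha> i * \<beta> i) ^ l * (\<alpha> i * \<beta> i) ^ (k - l)))"
    proof (intro sum.cong refl)
      fix l assume "l \<in> {..k}"
      then have "real (k choose l) * fact l * fact (k - l) = fact k"
        using binomial_fact_lemma[of l k] by (simp add: binomial_fact)
      then show "real (k choose l) * (real (k choose l) * fact l * fact (k - l)) * ((\<Sum>i\<in>I. \<alpha> i * \<beta> i) ^ l * (\<alpha> i * \<beta> i) ^ (k - l))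
        = fact k * (real (k choose l) * (\<Sum>i\<in>I. \<alpha> i * \<beta> i) ^ l * (\<alpha> i * \<beta> i) ^ (k - l))" by simp
    qed
    also have "\<dots> = fact k * ((\<Sum>i\<in>I. \<alpha> i * \<beta> i) + \<alpha> i * \<beta> i) ^ k"
      by (simp add: sum_distrib_left[symmetric] binomial_ring)
    finally show ?thesis using True by simp
  next
    case False
    \<comment> \<open>Since \<open>l \<le> j\<close> and \<open>m \<le> k\<close>, natural
      subtraction does not truncate, and \<open>l = m\<close> together with
      \<open>j - l = k - m\<close> would force \<open>j = k\<close>.\<close>
    then show ?thesis by (auto intro!: sum.neutral)
  qed
  also have "(\<Sum>i\<in>I. \<alpha> i * \<beta> i) + \<alpha> i * \<beta> i = (\<Sum>i\<in>insert i I. \<alpha> i * \<beta> i)"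
    using insert.hyps by simp
  finally show ?case
    unfolding expand
    by (intro conjI Bochner_Integration.integrable_sum integrable_mult_right int) auto
qed

section \<open>Fourier analysis on the torus\<close>

text \<open>Packaging the normalised box integral as a measure on all of \<open>real ^ 'd\<close>
  gives access to Fubini's theorem and to products with the Gaussian space. Its total mass is read
  off from the zero Fourier mode.\<close>

definition torus :: "(real ^ 'd) measure" where
  "torus = density lborel (\<lambda>x. ennreal (indicator (cbox 0 (\<chi> i. 2 * pi)) x / (2 * pi) ^ CARD('d)))"

lemma sets_torus[measurable_cong, simp]: "sets torus = sets borel"
  and space_torus[simp]: "space torus = UNIV"
  by (simp_all add: torus_def)

lemma integrable_torus:
  fixes f :: "real ^ 'd \<Rightarrow> 'b::{banach, second_countable_topology}"
  assumes "continuous_on UNIV f"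
  shows "integrable torus f"
proof -
  have [measurable]: "f \<in> borel_measurable borel" using assms by (rule borel_measurable_continuous_onI)
  have "set_integrable lborel (cbox 0 (\<chi> i. 2 * pi)) f"
    unfolding set_integrable_def
    using borel_integrable_compact[of "cbox 0 (\<chi> i. 2 * pi)" f] continuous_on_subset[OF assms] by auto
  then have "integrable lborel (\<lambda>x. (1 / (2 * pi) ^ CARD('d)) *\<^sub>R (indicator (cbox 0 (\<chi> i. 2 * pi)) x *\<^sub>R f x))"
    unfolding set_integrable_def by (rule integrable_scaleR_right)
  then show ?thesis
    unfolding torus_def by (subst integrable_density) simp_all
qed

lemma integral_torus:
  fixes f :: "real ^ 'd \<Rightarrow> 'b::{banach, second_countable_topology}"
  assumes [measurable]: "f \<in> borel_measurable borel"
  shows "(\<integral>x. f x \<partial>torus) = (1 / (2 * pi) ^ CARD('d)) *\<^sub>R (\<integral>x. indicator (cbox 0 (\<chi> i. 2 * pi)) x *\<^sub>R f x \<partial>lborel)"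
proof -
  have "(\<integral>x. f x \<partial>torus) = (\<integral>x. (1 / (2 * pi) ^ CARD('d)) *\<^sub>R (indicator (cbox 0 (\<chi> i. 2 * pi)) x *\<^sub>R f x) \<partial>lborel)"
    unfolding torus_def by (subst integral_density) simp_all
  then show ?thesis by (simp only: Bochner_Integration.integral_scaleR_right)
qed

text \<open>Bridges the gauge integral behind \<open>torus_int\<close> and the Lebesgue integral in
  which the estimates are made.\<close>

lemma torus_int_eq_integral_torus:
  fixes f :: "real ^ 'd \<Rightarrow> real"
  assumes "continuous_on UNIV f"
  shows "torus_int f = (\<integral>x. f x \<partial>torus)"
proof -
  have [measurable]: "f \<in> borel_measurable borel" using assms by (rule borel_measurable_continuous_onI)
  have "set_integrable lborel (cbox 0 (\<chi> i. 2 * pi)) f"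
    unfolding set_integrable_def
    using borel_integrable_compact[of "cbox 0 (\<chi> i. 2 * pi)" f] continuous_on_subset[OF assms] by auto
  from set_borel_integral_eq_integral(2)[OF this]
  show ?thesis
    unfolding torus_int_def set_lebesgue_integral_def by (simp add: integral_torus)
qed

lemma cis_sum: "finite I \<Longrightarrow> cis (\<Sum>i\<in>I. f i) = (\<Prod>i\<in>I. cis (f i))"
  by (induction I rule: finite_induct) (simp_all add: cis_mult[symmetric])

lemma integral_cis_period:
  assumes "k \<in> \<int>"
  shows "(\<integral>t. indicator {0..2 * pi} t *\<^sub>R cis (k * t) \<partial>lborel) = (if k = 0 then 2 * pi else 0)"
proof (cases "k = 0")
  case True
  have "(\<integral>t. indicator {0..2 * pi} t *\<^sub>R (1::complex) \<partial>lborel) = complex_of_real (2 * pi)"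
    by (subst Bochner_Integration.integral_scaleR_left) (simp_all add: scaleR_conv_of_real)
  with True show ?thesis by simp
next
  case False
  obtain m where m: "k = of_int m" using assms by (auto elim: Ints_cases)
  have "(\<integral>t. indicator {0..2 * pi} t *\<^sub>R cis (k * t) \<partial>lborel) = cis (k * (2 * pi)) / (\<i> * k) - cis (k * 0) / (\<i> * k)"
  proof (rule integral_FTC_atLeastAtMost)
    fix t :: real
    have "((\<lambda>z. exp (\<i> * (k * z)) / (\<i> * k)) has_field_derivative exp (\<i> * (k * complex_of_real t))) (at (complex_of_real t))"
      using False by (auto intro!: derivative_eq_intros simp: field_simps)
    from has_vector_derivative_real_field[OF this]
    show "((\<lambda>t. cis (k * t) / (\<i> * k)) has_vector_derivative cis (k * t)) (at t within {0..2 * pi})"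
      by (simp add: cis_conv_exp)
  qed (auto intro!: continuous_intros simp: cis_conv_exp)
  also have "cis (k * (2 * pi)) = 1"
    unfolding m by (metis cis_multiple_2pi Ints_of_int mult.commute)
  finally show ?thesis using False by simp
qed

lemma lborel_integral_prod_Basis:
  fixes F :: "'a::euclidean_space \<Rightarrow> real \<Rightarrow> complex"
  assumes "\<And>b. b \<in> Basis \<Longrightarrow> integrable lborel (F b)"
  shows "(\<integral>x. (\<Prod>b\<in>Basis. F b (x \<bullet> b)) \<partial>lborel) = (\<Prod>b\<in>Basis. \<integral>t. F b t \<partial>lborel)"
proof -
  interpret product_sigma_finite "\<lambda>_::'a. lborel :: real measure" ..
  have [measurable]: "F b \<in> borel_measurable borel" if "b \<in> Basis" for b
    using borel_measurable_integrable[OF assms[OF that]] by simp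
  have "(\<integral>x. (\<Prod>b\<in>Basis. F b (x \<bullet> b)) \<partial>lborel)
      = (\<integral>f. (\<Prod>b\<in>Basis. F b ((\<Sum>b\<in>Basis. f b *\<^sub>R b) \<bullet> b)) \<partial>(\<Pi>\<^sub>M b\<in>Basis. lborel))"
    by (subst lborel_eq, subst integral_distr) (auto simp: inner_sum_left)
  also have "\<dots> = (\<integral>f. (\<Prod>b\<in>Basis. F b (f b)) \<partial>(\<Pi>\<^sub>M b\<in>Basis. lborel))"
    by (intro Bochner_Integration.integral_cong refl prod.cong) simp
  also have "\<dots> = (\<Prod>b\<in>Basis. \<integral>t. F b t \<partial>lborel)"
    by (rule product_integral_prod) (auto intro: assms)
  finally show ?thesis .
qed

lemma continuous_lat_dot[continuous_intros]: "continuous_on S (lat_dot n)"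
  unfolding lat_dot_def by (intro continuous_intros)

lemma lat_dot_add: "lat_dot (a + b) x = lat_dot a x + lat_dot b x"
  and lat_dot_minus: "lat_dot (- a) x = - lat_dot a x"
  and lat_dot_diff: "lat_dot (a - b) x = lat_dot a x - lat_dot b x"
  and lat_dot_0: "lat_dot 0 x = 0"
  by (simp_all add: lat_dot_def sum.distrib sum_negf sum_subtractf algebra_simps)

lemma integral_torus_cis:
  fixes n :: "int ^ 'd"
  shows "(\<integral>x. cis (lat_dot n x) \<partial>torus) = (if n = 0 then 1 else 0)"
proof -
  define v :: "real ^ 'd" where "v = (\<chi> i. real_of_int (n $ i))"
  have dot: "lat_dot n x = (\<Sum>b\<in>Basis. (v \<bullet> b) * (x \<bullet> b))" for x
    by (subst euclidean_inner[symmetric]) (simp add: lat_dot_def v_def inner_vec_def)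
  have vb: "v \<bullet> b \<in> \<int>" if "b \<in> Basis" for b
    using that by (auto simp: Basis_vec_def inner_axis v_def)
  have v0: "(\<forall>b\<in>Basis. v \<bullet> b = 0) \<longleftrightarrow> n = 0"
    by (subst euclidean_all_zero_iff) (simp add: v_def vec_eq_iff)
  let ?box = "cbox 0 (\<chi> i. 2 * pi) :: (real ^ 'd) set"
  have ind: "indicator ?box x = (\<Prod>b\<in>Basis. indicator {0..2 * pi} (x \<bullet> b) :: real)" for x
  proof -
    have "x \<in> ?box \<longleftrightarrow> (\<forall>b\<in>Basis. x \<bullet> b \<in> {0..2 * pi})"
      by (auto simp: mem_box Basis_vec_def inner_axis)
    then show ?thesis by (auto simp: indicator_def)
  qed
  have "(\<integral>x. indicator ?box x *\<^sub>R cis (lat_dot n x) \<partial>lborel)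
      = (\<integral>x. (\<Prod>b\<in>Basis. indicator {0..2 * pi} (x \<bullet> b) *\<^sub>R cis ((v \<bullet> b) * (x \<bullet> b))) \<partial>lborel)"
    by (intro Bochner_Integration.integral_cong refl)
       (simp add: ind dot cis_sum scaleR_conv_of_real prod.distrib)
  also have "\<dots> = (\<Prod>b\<in>(Basis :: (real ^ 'd) set). \<integral>t. indicator {0..2 * pi} t *\<^sub>R cis ((v \<bullet> b) * t) \<partial>lborel)"
  proof (rule lborel_integral_prod_Basis)
    fix b :: "real ^ 'd"
    show "integrable lborel (\<lambda>t. indicator {0..2 * pi} t *\<^sub>R cis ((v \<bullet> b) * t))"
      by (rule borel_integrable_compact) (auto intro!: continuous_intros simp: cis_conv_exp)
  qed
  also have "\<dots> = (\<Prod>b\<in>(Basis :: (real ^ 'd) set). if v \<bullet> b = 0 then complex_of_real (2 * pi) else 0)"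
    by (intro prod.cong refl) (simp add: integral_cis_period vb)
  also have "\<dots> = (if n = 0 then complex_of_real ((2 * pi) ^ CARD('d)) else 0)"
  proof (cases "n = 0")
    case True
    then have "\<forall>b\<in>(Basis :: (real ^ 'd) set). v \<bullet> b = 0" using v0 by blast
    then show ?thesis using True by simp
  next
    case False
    then obtain b where "b \<in> Basis" "v \<bullet> b \<noteq> 0" using v0 by blast
    then have "(\<Prod>b\<in>(Basis :: (real ^ 'd) set). if v \<bullet> b = 0 then complex_of_real (2 * pi) else 0) = 0"
      by (intro prod_zero) auto
    then show ?thesis using False by simp
  qed
  finally show ?thesis
    by (subst integral_torus) (auto intro!: borel_measurable_continuous_onI continuous_intros simp: cis_conv_exp scaleR_conv_of_real)
qed

lemma prob_space_torus: "prob_space (torus :: (real ^ 'd) measure)"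
proof
  have "(\<integral>x. 1 \<partial>(torus :: (real ^ 'd) measure)) = (1::complex)"
    using integral_torus_cis[of "0 :: int ^ 'd"] by (simp add: lat_dot_0)
  then have m: "measure (torus :: (real ^ 'd) measure) UNIV = 1"
    by (simp add: scaleR_conv_of_real)
  then have "emeasure (torus :: (real ^ 'd) measure) UNIV \<noteq> \<infinity>"
    by (auto simp: measure_def)
  with m show "emeasure (torus :: (real ^ 'd) measure) (space torus) = 1"
    by (simp add: emeasure_eq_ennreal_measure)
qed

text \<open>
  The functions \<open>cas n\<close> form a real orthonormal system on the torus, in which the coordinates of the
  field \<open>u\<^sub>N\<close> are exactly the independent Gaussians \<open>\<omega> n\<close>.
\<close>

definition cas :: "int ^ 'd \<Rightarrow> real ^ 'd \<Rightarrow> real" where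
  "cas n x = cos (lat_dot n x) - sin (lat_dot n x)"

lemma continuous_cas[continuous_intros]: "continuous_on S (cas n)"
  unfolding cas_def by (intro continuous_intros)

lemma abs_cas_le: "\<bar>cas n x\<bar> \<le> 2"
  unfolding cas_def using abs_cos_le_one[of "lat_dot n x"] abs_sin_le_one[of "lat_dot n x"] by linarith

lemma integral_cas: "(\<integral>x. cas n x \<partial>torus) = (if n = 0 then 1 else 0)"
proof -
  have int: "integrable torus (\<lambda>x. cis (lat_dot n x))"
    by (rule integrable_torus) (auto intro!: continuous_intros simp: cis_conv_exp)
  have "(\<integral>x. cas n x \<partial>torus) = (\<integral>x. Re (cis (lat_dot n x)) \<partial>torus) - (\<integral>x. Im (cis (lat_dot n x)) \<partial>torus)"
    unfolding cas_def using integrable_Re[OF int] integrable_Im[OF int] by simp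
  also have "\<dots> = (if n = 0 then 1 else 0)"
    by (subst integral_Re[OF int], subst integral_Im[OF int]) (simp add: integral_torus_cis)
  finally show ?thesis .
qed

text \<open>The price of a real basis: a product of two modes spreads over four frequencies, one of
  them with a negative sign.\<close>

lemma cas_mult: "cas a x * cas b x = (cas (a + b) x + cas (a - b) x + cas (b - a) x - cas (- a - b) x) / 2"
proof -
  have "cas (- a - b) x = cas (- (a + b)) x" "cas (b - a) x = cas (- (a - b)) x" by simp_all
  then show ?thesis
    unfolding cas_def lat_dot_minus lat_dot_add lat_dot_diff cos_minus sin_minus
    by (simp add: cos_add sin_add cos_diff sin_diff algebra_simps)
qed

text \<open>The frequencies \<open>a + b\<close> and \<open>- a - b\<close> vanish together and
  enter with opposite signs, so only the two halves coming from \<open>a - b\<close> and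
  \<open>b - a\<close> survive.\<close>

lemma integral_cas_mult: "(\<integral>x. cas a x * cas b x \<partial>torus) = of_bool (b = a)"
proof -
  have int: "integrable torus (cas n)" for n by (intro integrable_torus continuous_intros)
  have "a + b = 0 \<longleftrightarrow> - a - b = 0" by (metis add.inverse_inverse minus_add_distrib neg_equal_0_iff_equal uminus_add_conv_diff diff_conv_add_uminus)
  then show ?thesis
    unfolding cas_mult by (auto simp: integral_cas int)
qed

text \<open>The structure constants of pointwise multiplication in the basis of the functions
  \<open>cas n\<close>.\<close>

definition cas3 :: "int ^ 'd \<Rightarrow> int ^ 'd \<Rightarrow> int ^ 'd \<Rightarrow> real" where
  "cas3 a b c = (\<integral>x. cas a x * cas b x * cas c x \<partial>torus)"

lemma cas3_eq: "cas3 a b c = (of_bool (c = a + b) + of_bool (c = a - b) + of_bool (c = b - a) - of_bool (c = - a - b)) / 2"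
proof -
  have int: "integrable torus (\<lambda>x. cas n x * cas c x)" for n by (intro integrable_torus continuous_intros)
  have eq: "cas a x * cas b x * cas c x = (cas (a + b) x * cas c x + cas (a - b) x * cas c x + cas (b - a) x * cas c x - cas (- a - b) x * cas c x) / 2" for x
    unfolding cas_mult[of a] by (simp add: algebra_simps)
  show ?thesis
    unfolding cas3_def eq by (simp add: integral_cas_mult int)
qed

section \<open>Lattice sums\<close>

lemma lat_norm_eq_norm: "lat_norm n = norm (\<chi> i. real_of_int (n $ i))"
  by (simp add: lat_norm_def norm_vec_def L2_set_def)

lemma lat_norm_nonneg: "0 \<le> lat_norm n"
  by (simp add: lat_norm_eq_norm)

lemma lat_norm_minus[simp]: "lat_norm (- n) = lat_norm n"
  by (simp add: lat_norm_def)

lemma lat_norm_triangle: "lat_norm (a + b) \<le> lat_norm a + lat_norm b"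
proof -
  have "(\<chi> i. real_of_int ((a + b) $ i)) = (\<chi> i. real_of_int (a $ i)) + (\<chi> i. real_of_int (b $ i))"
    by (simp add: vec_eq_iff)
  then show ?thesis unfolding lat_norm_eq_norm by (simp add: norm_triangle_ineq)
qed

lemma component_le_lat_norm: "\<bar>real_of_int (n $ i)\<bar> \<le> lat_norm n"
  unfolding lat_norm_eq_norm using component_le_norm_cart[of "\<chi> i. real_of_int (n $ i)" i] by simp

lemma uminus_mem_ball_N[simp]: "- n \<in> ball_N N \<longleftrightarrow> n \<in> ball_N N"
  by (simp add: ball_N_def)

lemma ball_N_mono: "M \<le> N \<Longrightarrow> ball_N M \<subseteq> ball_N N"
  by (auto simp: ball_N_def)

text \<open>Enclosing balls in cubes, on which product functions factor, reduces the lattice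
  estimates below to one-dimensional sums.\<close>

lemma sum_box_prod:
  fixes h :: "int \<Rightarrow> real"
  shows "finite {n :: int ^ 'd. \<forall>i. n $ i \<in> {- int N..int N}}" (is "finite ?box")
    and "(\<Sum>n\<in>{n :: int ^ 'd. \<forall>i. n $ i \<in> {- int N..int N}}. \<Prod>i\<in>UNIV. h (n $ i))
        = (\<Sum>k\<in>{- int N..int N}. h k) ^ CARD('d)"
proof -
  let ?P = "PiE (UNIV :: 'd set) (\<lambda>_. {- int N..int N})"
  have img: "?box = vec_lambda ` ?P"
  proof (intro equalityI subsetI)
    fix n :: "int ^ 'd" assume "n \<in> ?box"
    then have "(\<lambda>i. n $ i) \<in> ?P" by auto
    then show "n \<in> vec_lambda ` ?P" by (metis image_eqI vec_nth_inverse)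
  qed auto
  have fP: "finite ?P" by (intro finite_PiE) auto
  then show "finite ?box" unfolding img by simp
  have inj: "inj_on vec_lambda ?P" by (rule inj_onI) (metis vec_lambda_inverse UNIV_I)
  have "(\<Sum>n\<in>?box. \<Prod>i\<in>UNIV. h (n $ i)) = (\<Sum>g\<in>?P. \<Prod>i\<in>UNIV. h (g i))"
    unfolding img by (subst sum.reindex[OF inj]) simp
  also have "\<dots> = (\<Prod>i\<in>(UNIV :: 'd set). \<Sum>k\<in>{- int N..int N}. h k)"
    by (subst prod_sum_PiE) auto
  finally show "(\<Sum>n\<in>?box. \<Prod>i\<in>UNIV. h (n $ i)) = (\<Sum>k\<in>{- int N..int N}. h k) ^ CARD('d)" by simp
qed

lemma ball_N_subset_box: "ball_N N \<subseteq> {n. \<forall>i. n $ i \<in> {- int N..int N}}"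
proof
  fix n assume n: "n \<in> ball_N N"
  have "\<bar>n $ i\<bar> \<le> int N" for i
  proof -
    have "\<bar>real_of_int (n $ i)\<bar> \<le> real N" using component_le_lat_norm[of n i] n by (simp add: ball_N_def)
    then have "real_of_int \<bar>n $ i\<bar> \<le> real_of_int (int N)" by simp
    then show ?thesis by (simp only: of_int_le_iff)
  qed
  then show "n \<in> {n. \<forall>i. n $ i \<in> {- int N..int N}}" by (auto simp: abs_le_iff minus_le_iff)
qed

lemma finite_ball_N[simp]: "finite (ball_N N)"
  using finite_subset[OF ball_N_subset_box sum_box_prod(1)] .

lemma sum_symmetric_interval_le:
  fixes g :: "nat \<Rightarrow> real"
  assumes "\<And>k. 0 \<le> g k"
  shows "(\<Sum>k\<in>{- int N..int N}. g (nat \<bar>k\<bar>)) \<le> 2 * (\<Sum>k\<le>N. g k)"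
proof -
  have "{- int N..int N} \<subseteq> int ` {..N} \<union> (\<lambda>k. - int k) ` {..N}"
  proof
    fix k assume "k \<in> {- int N..int N}"
    then show "k \<in> int ` {..N} \<union> (\<lambda>k. - int k) ` {..N}"
      by (cases "0 \<le> k") (auto simp: image_iff Bex_def intro: exI[of _ "nat k"] exI[of _ "nat (- k)"])
  qed
  then have "(\<Sum>k\<in>{- int N..int N}. g (nat \<bar>k\<bar>)) \<le> (\<Sum>k\<in>int ` {..N} \<union> (\<lambda>k. - int k) ` {..N}. g (nat \<bar>k\<bar>))"
    using assms by (intro sum_mono2) auto
  also have "\<dots> \<le> (\<Sum>k\<in>int ` {..N}. g (nat \<bar>k\<bar>)) + (\<Sum>k\<in>(\<lambda>k. - int k) ` {..N}. g (nat \<bar>k\<bar>))"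
    using assms by (subst sum_Un) (auto intro!: sum_nonneg)
  also have "\<dots> = 2 * (\<Sum>k\<le>N. g k)"
    by (subst sum.reindex, simp add: inj_on_def, subst sum.reindex, simp add: inj_on_def) simp
  finally show ?thesis .
qed

text \<open>The variance of mode \<open>n\<close>. Its reciprocal is the weight of the squared norm
  in the Sobolev space of order d / 2.\<close>

definition wt :: "int ^ 'd \<Rightarrow> real" where
  "wt n = japan n powr (- real CARD('d))"

lemma japan_ge_1: "1 \<le> japan n"
  by (simp add: japan_def)

lemma japan_mono: "lat_norm a \<le> lat_norm b \<Longrightarrow> japan a \<le> japan b"
  by (simp add: japan_def power_mono lat_norm_nonneg)

lemma japan_add: "lat_norm b \<le> lat_norm a \<Longrightarrow> japan (a + b) \<le> 2 * japan a"
proof -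
  assume "lat_norm b \<le> lat_norm a"
  then have "lat_norm (a + b) \<le> 2 * lat_norm a" using lat_norm_triangle[of a b] by simp
  then have "(lat_norm (a + b))\<^sup>2 \<le> (2 * lat_norm a)\<^sup>2" by (intro power_mono lat_norm_nonneg)
  then have "1 + (lat_norm (a + b))\<^sup>2 \<le> 4 * (1 + (lat_norm a)\<^sup>2)" by simp
  then have "japan (a + b) \<le> sqrt (4 * (1 + (lat_norm a)\<^sup>2))" unfolding japan_def by simp
  then show ?thesis unfolding japan_def real_sqrt_mult by simp
qed

lemma wt_pos[simp]: "0 < wt n"
  using japan_ge_1[of n] by (simp add: wt_def)

lemma wt_nonneg[simp]: "0 \<le> wt n" using wt_pos[of n] by linarith

lemma wt_ne_0[simp]: "wt n \<noteq> 0" using wt_pos[of n] by linarith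

lemma wt_le_1[simp]: "wt n \<le> 1"
  unfolding wt_def using powr_mono[of "- real CARD('a)" 0 "japan n"] japan_ge_1[of n] by simp

lemma wt_minus[simp]: "wt (- n) = wt n"
  by (simp add: wt_def japan_def)

lemma wt_antimono: "lat_norm a \<le> lat_norm b \<Longrightarrow> wt b \<le> wt a" for a b :: "int ^ 'd"
  unfolding wt_def using japan_mono[of a b] japan_ge_1[of a] by (intro powr_mono2') auto

text \<open>Adding a frequency that is no longer than \<open>a\<close> at most doubles
  \<open>japan a\<close>; the power \<open>- d\<close> turns this factor into the constant.\<close>

lemma wt_add:
  fixes a b :: "int ^ 'd"
  assumes "lat_norm b \<le> lat_norm a" shows "wt a \<le> 2 ^ CARD('d) * wt (a + b)"
proof -
  have "(2 * japan a) powr (- real CARD('d)) \<le> wt (a + b)"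
    unfolding wt_def using japan_add[OF assms] japan_ge_1[of "a + b"] by (intro powr_mono2') auto
  moreover have "(2 * japan a) powr (- real CARD('d)) = wt a / 2 ^ CARD('d)"
    using japan_ge_1[of a] by (simp add: wt_def powr_mult powr_minus powr_realpow field_simps)
  ultimately have "wt a / 2 ^ CARD('d) \<le> wt (a + b)" by linarith
  then show ?thesis by (simp only: pos_divide_le_eq zero_less_power zero_less_numeral mult.commute)
qed

lemma prod_le_japan:
  fixes n :: "int ^ 'd"
  shows "(\<Prod>i\<in>UNIV. 1 + (real_of_int (n $ i))\<^sup>2) \<le> ((japan n)\<^sup>2) ^ CARD('d)"
proof -
  have "(\<Prod>i\<in>UNIV. 1 + (real_of_int (n $ i))\<^sup>2) \<le> (\<Prod>i\<in>(UNIV :: 'd set). (japan n)\<^sup>2)"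
  proof (intro prod_mono conjI)
    fix i
    have "(real_of_int (n $ i))\<^sup>2 \<le> (lat_norm n)\<^sup>2"
      using component_le_lat_norm[of n i] by (simp add: abs_le_square_iff[symmetric] lat_norm_nonneg)
    then show "1 + (real_of_int (n $ i))\<^sup>2 \<le> (japan n)\<^sup>2" by (simp add: japan_def)
  qed auto
  then show ?thesis by simp
qed

text \<open>The sums of the weights themselves diverge logarithmically; the exponent 5/4 is the one
  that arises in \<open>quadratic_sum_le\<close> and in the mean of \<open>lowN\<close>. The product
  of the factors \<open>1 + n_i^2\<close> is at most \<open>japan n\<close> to the power 2 d, which
  leaves one-dimensional series whose terms decay like \<open>k\<close> to the power -5/4.\<close>

lemma sum_wt_powr_bounded:
  "\<exists>S>0. \<forall>N. (\<Sum>n\<in>(ball_N N :: (int ^ 'd) set). wt n powr (5 / 4)) \<le> S"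
proof -
  define g :: "nat \<Rightarrow> real" where "g k = (1 + (real k)\<^sup>2) powr (- 5 / 8)" for k
  have g0: "0 \<le> g k" for k by (simp add: g_def)
  have "summable (\<lambda>k. real k powr (- 5 / 4))" by (simp add: summable_real_powr_iff)
  then have s1: "summable (\<lambda>k. real (Suc k) powr (- 5 / 4))" using summable_Suc_iff[of "\<lambda>k. real k powr (- 5 / 4)"] by simp
  have s2: "norm (g (Suc k)) \<le> real (Suc k) powr (- 5 / 4)" for k
  proof -
    have "g (Suc k) \<le> ((real (Suc k))\<^sup>2) powr (- 5 / 8)"
      unfolding g_def by (intro powr_mono2') auto
    also have "\<dots> = real (Suc k) powr (- 5 / 4)"
      using powr_powr[of "real (Suc k)" 2 "- 5 / 8"] by (simp add: powr_numeral)
    finally show ?thesis using g0 by simp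
  qed
  have "summable (\<lambda>k. g (Suc k))"
    by (rule summable_comparison_test'[OF s1, of 0]) (rule s2)
  then have sg: "summable g" by (subst (asm) summable_Suc_iff)
  define C where "C = 2 * suminf g + 1"
  have C: "0 < C" unfolding C_def using suminf_nonneg[OF sg g0] by simp
  have "(\<Sum>n\<in>(ball_N N :: (int ^ 'd) set). wt n powr (5 / 4)) \<le> C ^ CARD('d)" for N
  proof -
    let ?box = "{n :: int ^ 'd. \<forall>i. n $ i \<in> {- int N..int N}}"
    have pt: "wt n powr (5 / 4) \<le> (\<Prod>i\<in>UNIV. g (nat \<bar>n $ i\<bar>))" for n :: "int ^ 'd"
    proof -
      have "wt n powr (5 / 4) = (((japan n)\<^sup>2) ^ CARD('d)) powr (- 5 / 8)"
      proof -
        have "((japan n)\<^sup>2) ^ CARD('d) = japan n powr real (2 * CARD('d))"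
          using japan_ge_1[of n] by (subst powr_realpow) (auto simp: power_mult)
        then show ?thesis by (simp add: wt_def powr_powr mult.commute)
      qed
      also have "\<dots> \<le> (\<Prod>i\<in>UNIV. 1 + (real_of_int (n $ i))\<^sup>2) powr (- 5 / 8)"
        by (intro powr_mono2' prod_le_japan prod_pos) (auto simp: add_pos_nonneg)
      also have "\<dots> = (\<Prod>i\<in>UNIV. (1 + (real_of_int (n $ i))\<^sup>2) powr (- 5 / 8))"
        by (subst prod_powr_distrib) auto
      also have "\<dots> = (\<Prod>i\<in>UNIV. g (nat \<bar>n $ i\<bar>))"
        by (simp add: g_def)
      finally show ?thesis .
    qed
    have "(\<Sum>n\<in>(ball_N N :: (int ^ 'd) set). wt n powr (5 / 4)) \<le> (\<Sum>n\<in>ball_N N. \<Prod>i\<in>(UNIV::'d set). g (nat \<bar>n $ i\<bar>))"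
      by (intro sum_mono pt)
    also have "\<dots> \<le> (\<Sum>n\<in>?box. \<Prod>i\<in>(UNIV::'d set). g (nat \<bar>n $ i\<bar>))"
      by (intro sum_mono2 sum_box_prod(1) ball_N_subset_box prod_nonneg) (use g0 in auto)
    also have "\<dots> = (\<Sum>k\<in>{- int N..int N}. g (nat \<bar>k\<bar>)) ^ CARD('d)"
      by (rule sum_box_prod(2))
    also have "\<dots> \<le> C ^ CARD('d)"
    proof (intro power_mono sum_nonneg g0)
      have "(\<Sum>k\<in>{- int N..int N}. g (nat \<bar>k\<bar>)) \<le> 2 * (\<Sum>k\<le>N. g k)"
        by (rule sum_symmetric_interval_le[OF g0])
      also have "(\<Sum>k\<le>N. g k) \<le> suminf g" by (intro sum_le_suminf sg) (use g0 in auto)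
      finally show "(\<Sum>k\<in>{- int N..int N}. g (nat \<bar>k\<bar>)) \<le> C" by (simp add: C_def)
    qed
    finally show ?thesis .
  qed
  then show ?thesis using C by (intro exI[of _ "C ^ CARD('d)"]) auto
qed

text \<open>Comparison with a telescoping sum: by
  \<open>(R + k)\<^sup>2 \<le> 2 * (R\<^sup>2 + k\<^sup>2)\<close>, each term with
  \<open>k \<ge> 1\<close> is at most \<open>4 * R\<^sup>2\<close> times
  \<open>1 / (R + k - 1) - 1 / (R + k)\<close>. These add up to at most \<open>4 * R\<close>, and
  the term for \<open>k = 0\<close> is 2.\<close>

lemma sum_cauchy_kernel_le:
  fixes R :: real assumes "1 \<le> R"
  shows "(\<Sum>k\<le>N. 2 / (1 + (real k / R)\<^sup>2)) \<le> 6 * R"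
proof -
  have "(\<Sum>k=1..N. 2 / (1 + (real k / R)\<^sup>2)) \<le> (\<Sum>k=1..N. - (4 * R\<^sup>2 / (R + real k)) - - (4 * R\<^sup>2 / (R + real (k - 1))))"
  proof (rule sum_mono)
    fix k assume k: "k \<in> {1..N}"
    define x where "x = real (k - 1)"
    have kx: "real k = x + 1" "0 \<le> x" using k by (auto simp: x_def)
    have "2 / (1 + (real k / R)\<^sup>2) = 2 * R\<^sup>2 / (R\<^sup>2 + (real k)\<^sup>2)"
      using assms by (simp add: field_simps power2_eq_square)
    also have "\<dots> \<le> 2 * R\<^sup>2 / ((R + real k)\<^sup>2 / 2)"
    proof (rule divide_left_mono)
      show "(R + real k)\<^sup>2 / 2 \<le> R\<^sup>2 + (real k)\<^sup>2"
        using zero_le_power2[of "R - real k"] by (simp add: power2_eq_square algebra_simps)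
      show "0 < (R\<^sup>2 + (real k)\<^sup>2) * ((R + real k)\<^sup>2 / 2)"
        using assms by (intro mult_pos_pos) (auto simp: add_pos_nonneg zero_less_power2)
    qed simp
    also have "\<dots> = 4 * R\<^sup>2 / ((R + real k) * (R + real k))" by (simp add: power2_eq_square)
    also have "\<dots> \<le> 4 * R\<^sup>2 / ((R + x) * (R + real k))"
      using assms kx by (intro divide_left_mono mult_right_mono mult_pos_pos) auto
    also have "\<dots> = - (4 * R\<^sup>2 / (R + real k)) - - (4 * R\<^sup>2 / (R + x))"
      using assms kx by (simp add: divide_simps) (simp add: algebra_simps)
    finally show "2 / (1 + (real k / R)\<^sup>2) \<le> - (4 * R\<^sup>2 / (R + real k)) - - (4 * R\<^sup>2 / (R + real (k - 1)))"
      by (simp add: x_def)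
  qed
  also have "\<dots> = - (4 * R\<^sup>2 / (R + real N)) - - (4 * R\<^sup>2 / (R + real 0))"
    by (induction N) simp_all
  also have "\<dots> \<le> 4 * R\<^sup>2 / R" using assms by simp
  also have "\<dots> = 4 * R" using assms by (simp add: power2_eq_square)
  finally have "(\<Sum>k=1..N. 2 / (1 + (real k / R)\<^sup>2)) \<le> 4 * R" .
  moreover have "(\<Sum>k\<le>N. 2 / (1 + (real k / R)\<^sup>2)) = 2 + (\<Sum>k=1..N. 2 / (1 + (real k / R)\<^sup>2))"
    by (simp add: atMost_atLeast0 sum.atLeast_Suc_atMost)
  ultimately show ?thesis using assms by simp
qed

text \<open>
  The borderline sum: \<open>min 1 (wt n * \<rho>)\<close> alone would cost a factor \<open>ln \<rho>\<close>. The square is dominated by a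
  product of one-dimensional Cauchy kernels of width \<open>\<rho>\<close> to the power \<open>1 / d\<close>.
\<close>

lemma sum_min_wt_le:
  fixes \<rho> :: real assumes "1 \<le> \<rho>"
  shows "(\<Sum>n\<in>(ball_N N :: (int ^ 'd) set). min 1 ((wt n * \<rho>)\<^sup>2)) \<le> 12 ^ CARD('d) * \<rho>"
proof -
  define R where "R = \<rho> powr (1 / real CARD('d))"
  have R1: "1 \<le> R" unfolding R_def using assms by (simp add: ge_one_powr_ge_zero)
  have R\<rho>: "R ^ CARD('d) = \<rho>"
    unfolding R_def using assms by (simp add: powr_power)
  define g :: "nat \<Rightarrow> real" where "g k = 2 / (1 + (real k / R)\<^sup>2)" for k
  have g0: "0 \<le> g k" for k by (simp add: g_def)
  have pt: "min 1 ((wt n * \<rho>)\<^sup>2) \<le> (\<Prod>i\<in>UNIV. g (nat \<bar>n $ i\<bar>))" for n :: "int ^ 'd"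
  proof -
    \<comment> \<open>As \<open>R ^ CARD('d) = \<rho>\<close>, the quantity
      \<open>(wt n * \<rho>)\<^sup>2\<close> is the power \<open>(1 / y) ^ CARD('d)\<close>. The
      majorant \<open>2 / (1 + y)\<close> of \<open>min 1 (1 / y)\<close> decreases in
      \<open>y\<close>, so each of its d factors may be evaluated at a single coordinate of
      \<open>n\<close>.\<close>
    define y where "y = (japan n / R)\<^sup>2"
    have y: "0 < y" unfolding y_def using R1 japan_ge_1[of n] by simp
    have "wt n = 1 / japan n ^ CARD('d)"
      using japan_ge_1[of n] by (simp add: wt_def powr_minus powr_realpow divide_simps)
    then have "(wt n * \<rho>)\<^sup>2 = (1 / y) ^ CARD('d)"
      unfolding R\<rho>[symmetric] y_def using R1 japan_ge_1[of n]
      by (simp add: power_divide power_mult[symmetric] mult.commute)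
    moreover have "min 1 ((1 / y) ^ CARD('d)) \<le> (2 / (1 + y)) ^ CARD('d)"
    proof (cases "y \<le> 1")
      case True
      then have "1 \<le> 2 / (1 + y)" using y by (simp add: field_simps)
      then show ?thesis by (simp add: one_le_power min.coboundedI1)
    next
      case False
      then have "1 / y \<le> 2 / (1 + y)" using y by (simp add: field_simps)
      then have "(1 / y) ^ CARD('d) \<le> (2 / (1 + y)) ^ CARD('d)" using y by (intro power_mono) auto
      then show ?thesis by (simp add: min.coboundedI2)
    qed
    moreover have "(2 / (1 + y)) ^ CARD('d) \<le> (\<Prod>i\<in>(UNIV :: 'd set). g (nat \<bar>n $ i\<bar>))"
    proof -
      have "(\<Prod>i\<in>(UNIV :: 'd set). 2 / (1 + y)) \<le> (\<Prod>i\<in>(UNIV :: 'd set). g (nat \<bar>n $ i\<bar>))"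
      proof (intro prod_mono conjI)
        fix i
        have "(real_of_int (n $ i))\<^sup>2 \<le> (lat_norm n)\<^sup>2"
          using component_le_lat_norm[of n i] by (simp add: abs_le_square_iff[symmetric] lat_norm_nonneg)
        also have "\<dots> \<le> (japan n)\<^sup>2" by (simp add: japan_def)
        finally have "(real_of_int (n $ i) / R)\<^sup>2 \<le> y"
          unfolding y_def power_divide by (intro divide_right_mono) auto
        moreover have "(real (nat \<bar>n $ i\<bar>) / R)\<^sup>2 = (real_of_int (n $ i) / R)\<^sup>2"
          by (simp add: power_divide)
        ultimately show "2 / (1 + y) \<le> g (nat \<bar>n $ i\<bar>)"
          unfolding g_def by (intro divide_left_mono) (auto intro!: mult_pos_pos simp: add_pos_nonneg y less_imp_le[OF y])
      qed (use y in auto)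
      then show ?thesis by simp
    qed
    ultimately show ?thesis by linarith
  qed
  let ?box = "{n :: int ^ 'd. \<forall>i. n $ i \<in> {- int N..int N}}"
  have "(\<Sum>n\<in>(ball_N N :: (int ^ 'd) set). min 1 ((wt n * \<rho>)\<^sup>2)) \<le> (\<Sum>n\<in>ball_N N. \<Prod>i\<in>(UNIV::'d set). g (nat \<bar>n $ i\<bar>))"
    by (intro sum_mono pt)
  also have "\<dots> \<le> (\<Sum>n\<in>?box. \<Prod>i\<in>(UNIV::'d set). g (nat \<bar>n $ i\<bar>))"
    by (intro sum_mono2 sum_box_prod(1) ball_N_subset_box prod_nonneg) (use g0 in auto)
  also have "\<dots> = (\<Sum>k\<in>{- int N..int N}. g (nat \<bar>k\<bar>)) ^ CARD('d)"
    by (rule sum_box_prod(2))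
  also have "\<dots> \<le> (12 * R) ^ CARD('d)"
  proof (intro power_mono sum_nonneg g0)
    have "(\<Sum>k\<in>{- int N..int N}. g (nat \<bar>k\<bar>)) \<le> 2 * (\<Sum>k\<le>N. g k)"
      by (rule sum_symmetric_interval_le[OF g0])
    also have "(\<Sum>k\<le>N. g k) \<le> 6 * R" unfolding g_def by (rule sum_cauchy_kernel_le[OF R1])
    finally show "(\<Sum>k\<in>{- int N..int N}. g (nat \<bar>k\<bar>)) \<le> 12 * R" by simp
  qed
  also have "\<dots> = 12 ^ CARD('d) * \<rho>" by (simp add: power_mult_distrib R\<rho>)
  finally show ?thesis .
qed

section \<open>Trilinear estimates\<close>

lemma sum_mult_le_sqrt:
  fixes u v :: "'a \<Rightarrow> real"
  shows "(\<Sum>i\<in>I. u i * v i) \<le> sqrt (\<Sum>i\<in>I. (u i)\<^sup>2) * sqrt (\<Sum>i\<in>I. (v i)\<^sup>2)"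
proof -
  have "(\<Sum>i\<in>I. u i * v i) \<le> (\<Sum>i\<in>I. \<bar>u i\<bar> * \<bar>v i\<bar>)"
    by (intro sum_mono) (metis abs_ge_self abs_mult)
  also have "\<dots> \<le> L2_set u I * L2_set v I" by (rule L2_set_mult_ineq)
  finally show ?thesis by (simp add: L2_set_def)
qed

lemma sum_translate_le:
  fixes s :: "'a::ab_group_add \<Rightarrow> real"
  assumes B: "finite B" and s: "\<And>n. 0 \<le> s n" and supp: "\<And>n. n \<notin> B \<Longrightarrow> s n = 0"
  shows "(\<Sum>b\<in>B. s (a + b)) \<le> (\<Sum>n\<in>B. s n)"
proof -
  have "(\<Sum>b\<in>B. s (a + b)) = (\<Sum>n\<in>(+) a ` B. s n)"
    by (subst sum.reindex) (auto simp: inj_on_def)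
  also have "\<dots> = (\<Sum>n\<in>(+) a ` B \<inter> B. s n)"
    using B supp by (intro sum.mono_neutral_right) auto
  also have "\<dots> \<le> (\<Sum>n\<in>B. s n)"
    using B s by (intro sum_mono2) auto
  finally show ?thesis .
qed

lemma correlation_le_sqrt:
  fixes u v :: "'a::ab_group_add \<Rightarrow> real"
  assumes B: "finite B" and u: "\<And>n. 0 \<le> u n" and supp: "\<And>n. n \<notin> B \<Longrightarrow> v n = 0"
  shows "(\<Sum>b\<in>B. u b * v (a + b)) \<le> sqrt (\<Sum>n\<in>B. (u n)\<^sup>2) * sqrt (\<Sum>n\<in>B. (v n)\<^sup>2)"
proof -
  have "(\<Sum>b\<in>B. u b * v (a + b)) \<le> sqrt (\<Sum>b\<in>B. (u b)\<^sup>2) * sqrt (\<Sum>b\<in>B. (v (a + b))\<^sup>2)"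
    by (rule sum_mult_le_sqrt)
  also have "\<dots> \<le> sqrt (\<Sum>n\<in>B. (u n)\<^sup>2) * sqrt (\<Sum>n\<in>B. (v n)\<^sup>2)"
    using sum_translate_le[OF B, of "\<lambda>n. (v n)\<^sup>2" a] supp
    by (intro mult_left_mono real_sqrt_le_mono) (auto intro!: sum_nonneg)
  finally show ?thesis .
qed

text \<open>Models the absolute values of the coefficients of a trigonometric polynomial. Vanishing
  outside the ball lets translated frequencies leave it at no cost.\<close>

locale sobolev_seq =
  fixes N :: nat and t :: "int ^ 'd \<Rightarrow> real"
  assumes nonneg: "\<And>n. 0 \<le> t n" and supp: "\<And>n. n \<notin> ball_N N \<Longrightarrow> t n = 0"
begin

text \<open>\<open>L\<close> and \<open>H\<close> are the norms in \<open>L^2\<close> and in the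
  Sobolev space of order d / 2.\<close>

definition L where "L = sqrt (\<Sum>n\<in>ball_N N. (t n)\<^sup>2)"
definition H where "H = sqrt (\<Sum>n\<in>ball_N N. (t n)\<^sup>2 / wt n)"

lemma L_nonneg: "0 \<le> L" and H_nonneg: "0 \<le> H"
  unfolding L_def H_def by (auto intro!: sum_nonneg divide_nonneg_nonneg)

lemma H_eq: "H = sqrt (\<Sum>n\<in>ball_N N. (t n / sqrt (wt n))\<^sup>2)"
  unfolding H_def by (simp add: power_divide)

lemma L_le_H: "L \<le> H"
  unfolding L_def H_def
proof (intro real_sqrt_le_mono sum_mono)
  fix n
  show "(t n)\<^sup>2 \<le> (t n)\<^sup>2 / wt n"
    by (simp add: pos_le_divide_eq mult_left_le)
qed

text \<open>Cauchy--Schwarz gives the first bound directly. It gives the second after distributing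
  the weights, because \<open>a\<close> is the shortest frequency and hence \<open>wt b\<close> and
  \<open>wt (a + b)\<close> are at most \<open>wt a\<close>. Keeping the minimum of both is what
  later avoids a logarithm.\<close>

lemma high_correlation_le:
  "(\<Sum>b\<in>ball_N N. of_bool (lat_norm a \<le> lat_norm b \<and> lat_norm a \<le> lat_norm (a + b)) * (t b * t (a + b)))
    \<le> min (L\<^sup>2) (wt a * H\<^sup>2)" (is "?lhs \<le> _")
proof -
  have "?lhs \<le> (\<Sum>b\<in>ball_N N. t b * t (a + b))"
    by (intro sum_mono) (auto simp: nonneg)
  also have "\<dots> \<le> sqrt (\<Sum>n\<in>ball_N N. (t n)\<^sup>2) * sqrt (\<Sum>n\<in>ball_N N. (t n)\<^sup>2)"
    by (rule correlation_le_sqrt) (auto simp: nonneg supp)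
  also have "\<dots> = L\<^sup>2" by (simp add: L_def power2_eq_square)
  finally have 1: "?lhs \<le> L\<^sup>2" .
  have "?lhs \<le> (\<Sum>b\<in>ball_N N. wt a * (t b / sqrt (wt b) * (t (a + b) / sqrt (wt (a + b)))))"
  proof (intro sum_mono)
    fix b
    show "of_bool (lat_norm a \<le> lat_norm b \<and> lat_norm a \<le> lat_norm (a + b)) * (t b * t (a + b))
      \<le> wt a * (t b / sqrt (wt b) * (t (a + b) / sqrt (wt (a + b))))"
    proof (cases "lat_norm a \<le> lat_norm b \<and> lat_norm a \<le> lat_norm (a + b)")
      case True
      then have "sqrt (wt b) * sqrt (wt (a + b)) \<le> sqrt (wt a) * sqrt (wt a)"
        by (intro mult_mono real_sqrt_le_mono wt_antimono) auto
      also have "\<dots> = wt a" by simp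
      finally have le: "sqrt (wt b) * sqrt (wt (a + b)) \<le> wt a" .
      have "t b * t (a + b) = (sqrt (wt b) * sqrt (wt (a + b))) * (t b / sqrt (wt b) * (t (a + b) / sqrt (wt (a + b))))"
        by simp
      also have "\<dots> \<le> wt a * (t b / sqrt (wt b) * (t (a + b) / sqrt (wt (a + b))))"
        by (intro mult_right_mono le) (auto simp: nonneg)
      finally show ?thesis using True by simp
    next
      case False
      then show ?thesis by (auto intro!: mult_nonneg_nonneg divide_nonneg_nonneg simp: nonneg)
    qed
  qed
  also have "\<dots> = wt a * (\<Sum>b\<in>ball_N N. t b / sqrt (wt b) * (t (a + b) / sqrt (wt (a + b))))"
    by (simp add: sum_distrib_left)
  also have "\<dots> \<le> wt a * (sqrt (\<Sum>n\<in>ball_N N. (t n / sqrt (wt n))\<^sup>2) * sqrt (\<Sum>n\<in>ball_N N. (t n / sqrt (wt n))\<^sup>2))"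
    by (intro mult_left_mono correlation_le_sqrt[where v="\<lambda>n. t n / sqrt (wt n)"]) (auto simp: nonneg supp)
  also have "\<dots> = wt a * H\<^sup>2" by (simp add: H_eq power2_eq_square)
  finally show ?thesis using 1 by simp
qed

text \<open>Cauchy--Schwarz in \<open>a\<close> leaves the squares of the minima. With
  \<open>\<rho> = H\<^sup>2 / L\<^sup>2\<close> these equal
  \<open>L ^ 4 * min 1 ((wt a * \<rho>)\<^sup>2)\<close>, and their sum is at most a constant times
  \<open>L ^ 4 * \<rho> = L\<^sup>2 * H\<^sup>2\<close>.\<close>

lemma sum_min_le: "(\<Sum>a\<in>ball_N N. t a * min (L\<^sup>2) (wt a * H\<^sup>2)) \<le> sqrt (12 ^ CARD('d)) * (L\<^sup>2 * H)"
proof (cases "L = 0")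
  case True
  then show ?thesis by simp
next
  case False
  then have L: "0 < L" using L_nonneg by simp
  have H: "0 < H" using L L_le_H by simp
  define \<rho> where "\<rho> = H\<^sup>2 / L\<^sup>2"
  have \<rho>: "1 \<le> \<rho>" unfolding \<rho>_def using L L_le_H by (simp add: power_mono)
  have m: "(min (L\<^sup>2) (wt a * H\<^sup>2))\<^sup>2 = (L\<^sup>2)\<^sup>2 * min 1 ((wt a * \<rho>)\<^sup>2)" for a :: "int ^ 'd"
  proof -
    have eq: "wt a * H\<^sup>2 = L\<^sup>2 * (wt a * \<rho>)" using L by (simp add: \<rho>_def)
    have "min (L\<^sup>2) (wt a * H\<^sup>2) = L\<^sup>2 * min 1 (wt a * \<rho>)"
      unfolding eq using L by (simp add: min_mult_distrib_left)
    moreover have "(min 1 (wt a * \<rho>))\<^sup>2 = min 1 ((wt a * \<rho>)\<^sup>2)"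
    proof (cases "wt a * \<rho> \<le> 1")
      case True
      then have "(wt a * \<rho>)\<^sup>2 \<le> 1" using \<rho> by (intro power_le_one) auto
      then show ?thesis using True by (simp add: min_def)
    next
      case False
      then have "1 \<le> (wt a * \<rho>)\<^sup>2" by (intro one_le_power) simp
      then show ?thesis using False by (simp add: min_def)
    qed
    ultimately show ?thesis by (simp add: power_mult_distrib)
  qed
  have "(\<Sum>a\<in>(ball_N N :: (int ^ 'd) set). (min (L\<^sup>2) (wt a * H\<^sup>2))\<^sup>2) = (L\<^sup>2)\<^sup>2 * (\<Sum>a\<in>(ball_N N :: (int ^ 'd) set). min 1 ((wt a * \<rho>)\<^sup>2))"
    by (simp add: m sum_distrib_left)
  also have "\<dots> \<le> (L\<^sup>2)\<^sup>2 * (12 ^ CARD('d) * \<rho>)"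
    by (intro mult_left_mono sum_min_wt_le \<rho>) auto
  also have "\<dots> = 12 ^ CARD('d) * (L * H)\<^sup>2"
    using L by (simp add: \<rho>_def power2_eq_square)
  finally have "sqrt (\<Sum>a\<in>(ball_N N :: (int ^ 'd) set). (min (L\<^sup>2) (wt a * H\<^sup>2))\<^sup>2) \<le> sqrt (12 ^ CARD('d) * (L * H)\<^sup>2)"
    by (rule real_sqrt_le_mono)
  also have "\<dots> = sqrt (12 ^ CARD('d)) * (L * H)"
    using L H by (simp add: real_sqrt_mult)
  finally have "L * sqrt (\<Sum>a\<in>(ball_N N :: (int ^ 'd) set). (min (L\<^sup>2) (wt a * H\<^sup>2))\<^sup>2) \<le> L * (sqrt (12 ^ CARD('d)) * (L * H))"
    by (rule mult_left_mono) (rule L_nonneg)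
  moreover have "(\<Sum>a\<in>ball_N N. t a * min (L\<^sup>2) (wt a * H\<^sup>2)) \<le> L * sqrt (\<Sum>a\<in>(ball_N N :: (int ^ 'd) set). (min (L\<^sup>2) (wt a * H\<^sup>2))\<^sup>2)"
    using sum_mult_le_sqrt[of t "\<lambda>a. min (L\<^sup>2) (wt a * H\<^sup>2)" "ball_N N"] by (simp only: L_def)
  moreover have "L * (sqrt (12 ^ CARD('d)) * (L * H)) = sqrt (12 ^ CARD('d)) * (L\<^sup>2 * H)"
    by (simp add: power2_eq_square)
  ultimately show ?thesis by linarith
qed

text \<open>
  A Fourier-side proof of the critical Gagliardo--Nirenberg inequality
  \<open>\<integral> \<Theta>\<^sup>3 \<le> C \<parallel>\<Theta>\<parallel>\<^sup>2 \<parallel>\<Theta>\<parallel>\<^sub>H\<close> with \<open>H\<close> the Sobolev space of order \<open>d / 2\<close>: the sum over frequencies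
  \<open>a + b = c\<close> is split according to which of the three has the smallest norm.
\<close>

lemma cubic_sum_le:
  assumes even: "\<And>n. t (- n) = t n"
  shows "(\<Sum>a\<in>ball_N N. \<Sum>b\<in>ball_N N. t a * t b * t (a + b)) \<le> 3 * (sqrt (12 ^ CARD('d)) * (L\<^sup>2 * H))"
proof -
  define lo where "lo a b = (of_bool (lat_norm a \<le> lat_norm b \<and> lat_norm a \<le> lat_norm (a + b)) :: real)" for a b :: "int ^ 'd"
  define \<psi> where "\<psi> a b = (of_bool (lat_norm (a + b) \<le> lat_norm a \<and> lat_norm (a + b) \<le> lat_norm b) :: real)" for a b :: "int ^ 'd"
  let ?W = "\<Sum>a\<in>ball_N N. t a * min (L\<^sup>2) (wt a * H\<^sup>2)"
  have inner: "(\<Sum>b\<in>ball_N N. lo a b * (t b * t (a + b))) \<le> min (L\<^sup>2) (wt a * H\<^sup>2)" for a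
    unfolding lo_def by (rule high_correlation_le)
  have P1: "(\<Sum>a\<in>ball_N N. \<Sum>b\<in>ball_N N. lo a b * (t a * t b * t (a + b))) \<le> ?W"
  proof (intro sum_mono)
    fix a
    have "(\<Sum>b\<in>ball_N N. lo a b * (t a * t b * t (a + b))) = t a * (\<Sum>b\<in>ball_N N. lo a b * (t b * t (a + b)))"
      by (simp add: sum_distrib_left mult_ac)
    also have "\<dots> \<le> t a * min (L\<^sup>2) (wt a * H\<^sup>2)" by (intro mult_left_mono inner nonneg)
    finally show "(\<Sum>b\<in>ball_N N. lo a b * (t a * t b * t (a + b))) \<le> t a * min (L\<^sup>2) (wt a * H\<^sup>2)" .
  qed
  have P2: "(\<Sum>a\<in>ball_N N. \<Sum>b\<in>ball_N N. lo b a * (t a * t b * t (a + b))) \<le> ?W"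
    by (subst sum.swap) (use P1 in \<open>simp add: add.commute mult_ac\<close>)
  have P3: "(\<Sum>a\<in>ball_N N. \<Sum>b\<in>ball_N N. \<psi> a b * (t a * t b * t (a + b))) \<le> ?W"
  proof -
    \<comment> \<open>Where \<open>a + b\<close> is shortest, \<open>c = a + b\<close> becomes the
      outer variable. Evenness of \<open>t\<close> replaces \<open>c - a\<close> by
      \<open>- c + a\<close>, which gives a correlation whose shortest frequency is
      \<open>- c\<close>.\<close>
    have "(\<Sum>b\<in>ball_N N. \<psi> a b * (t a * t b * t (a + b))) \<le> (\<Sum>c\<in>ball_N N. \<psi> a (c - a) * (t a * t (c - a) * t c))" for a
      using sum_translate_le[of "ball_N N" "\<lambda>c. \<psi> a (c - a) * (t a * t (c - a) * t c)" a]
      by (auto simp: nonneg supp \<psi>_def)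
    then have "(\<Sum>a\<in>ball_N N. \<Sum>b\<in>ball_N N. \<psi> a b * (t a * t b * t (a + b)))
      \<le> (\<Sum>a\<in>ball_N N. \<Sum>c\<in>ball_N N. \<psi> a (c - a) * (t a * t (c - a) * t c))"
      by (rule sum_mono)
    also have "\<dots> = (\<Sum>c\<in>ball_N N. t c * (\<Sum>a\<in>ball_N N. lo (- c) a * (t a * t (- c + a))))"
    proof (subst sum.swap, rule sum.cong[OF refl])
      fix c
      have eq: "\<psi> a (c - a) = lo (- c) a" "t (c - a) = t (- c + a)" for a
        using lat_norm_minus[of "c - a"] even[of "c - a"] unfolding \<psi>_def lo_def by auto
      show "(\<Sum>a\<in>ball_N N. \<psi> a (c - a) * (t a * t (c - a) * t c)) = t c * (\<Sum>a\<in>ball_N N. lo (- c) a * (t a * t (- c + a)))"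
        unfolding eq sum_distrib_left by (intro sum.cong refl) (simp add: mult_ac)
    qed
    also have "\<dots> \<le> (\<Sum>c\<in>ball_N N. t c * min (L\<^sup>2) (wt (- c) * H\<^sup>2))"
      by (intro sum_mono mult_left_mono inner nonneg)
    finally show ?thesis by simp
  qed
  have "(\<Sum>a\<in>ball_N N. \<Sum>b\<in>ball_N N. t a * t b * t (a + b))
     \<le> (\<Sum>a\<in>ball_N N. \<Sum>b\<in>ball_N N. lo a b * (t a * t b * t (a + b)) + lo b a * (t a * t b * t (a + b)) + \<psi> a b * (t a * t b * t (a + b)))"
  proof (intro sum_mono)
    fix a b :: "int ^ 'd"
    have "1 \<le> lo a b + lo b a + \<psi> a b"
      unfolding lo_def \<psi>_def add.commute[of b a] by (auto simp: of_bool_def)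
    then have "1 * (t a * t b * t (a + b)) \<le> (lo a b + lo b a + \<psi> a b) * (t a * t b * t (a + b))"
      by (intro mult_right_mono) (auto simp: nonneg)
    then show "t a * t b * t (a + b) \<le> lo a b * (t a * t b * t (a + b)) + lo b a * (t a * t b * t (a + b)) + \<psi> a b * (t a * t b * t (a + b))"
      by (simp add: algebra_simps)
  qed
  also have "\<dots> \<le> 3 * ?W" using P1 P2 P3 by (simp add: sum.distrib)
  also have "\<dots> \<le> 3 * (sqrt (12 ^ CARD('d)) * (L\<^sup>2 * H))" using sum_min_le by simp
  finally show ?thesis .
qed

text \<open>Interpolation: the sum is the squared norm of order d / 4, halfway between
  \<open>L\<close> and \<open>H\<close>.\<close>

lemma half_norm_sq_le: "(\<Sum>n\<in>ball_N N. (t n)\<^sup>2 / sqrt (wt n)) \<le> L * H"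
proof -
  have "(\<Sum>n\<in>ball_N N. (t n)\<^sup>2 / sqrt (wt n)) = (\<Sum>n\<in>ball_N N. t n * (t n / sqrt (wt n)))"
    by (simp add: power2_eq_square)
  also have "\<dots> \<le> L * H" unfolding L_def H_eq by (rule sum_mult_le_sqrt)
  finally show ?thesis .
qed

text \<open>Duality between the orders -d / 8 and d / 8. The norm of order d / 8 is dominated by the
  one of order d / 4, which interpolation controls.\<close>

lemma linear_sum_le:
  fixes y :: "int ^ 'd \<Rightarrow> real"
  shows "(\<Sum>n\<in>ball_N N. y n * t n) \<le> sqrt (\<Sum>n\<in>ball_N N. wt n powr (1/4) * (y n)\<^sup>2) * sqrt (L * H)"
proof -
  have p: "(wt n powr (1/8))\<^sup>2 = wt n powr (1/4)" for n :: "int ^ 'd"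
    by (simp add: powr_power)
  have "(\<Sum>n\<in>ball_N N. y n * t n) = (\<Sum>n\<in>ball_N N. (wt n powr (1/8) * y n) * (t n / wt n powr (1/8)))" by simp
  also have "\<dots> \<le> sqrt (\<Sum>n\<in>ball_N N. (wt n powr (1/8) * y n)\<^sup>2) * sqrt (\<Sum>n\<in>ball_N N. (t n / wt n powr (1/8))\<^sup>2)"
    by (rule sum_mult_le_sqrt)
  also have "\<dots> = sqrt (\<Sum>n\<in>ball_N N. wt n powr (1/4) * (y n)\<^sup>2) * sqrt (\<Sum>n\<in>ball_N N. (t n)\<^sup>2 / wt n powr (1/4))"
    by (simp add: power_mult_distrib power_divide p)
  also have "\<dots> \<le> sqrt (\<Sum>n\<in>ball_N N. wt n powr (1/4) * (y n)\<^sup>2) * sqrt (L * H)"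
  proof (intro mult_left_mono real_sqrt_le_mono order_trans[OF sum_mono half_norm_sq_le])
    fix n :: "int ^ 'd"
    have "sqrt (wt n) \<le> wt n powr (1/4)"
      using powr_mono'[of "1/4" "1/2" "wt n"] by (simp add: powr_half_sqrt)
    then show "(t n)\<^sup>2 / wt n powr (1/4) \<le> (t n)\<^sup>2 / sqrt (wt n)"
      by (intro divide_left_mono) auto
  qed (auto intro!: sum_nonneg)
  finally show ?thesis .
qed

text \<open>The rough factor \<open>y\<close> is only controlled in order -d / 8. Where
  \<open>b\<close> is no longer than \<open>a\<close>, the regularity of \<open>t a\<close> pays for
  \<open>y\<close> and still leaves a gain for the sum over \<open>b\<close>; the other half follows
  by symmetry.\<close>

lemma quadratic_sum_le:
  fixes y :: "int ^ 'd \<Rightarrow> real"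
  assumes y: "\<And>n. 0 \<le> y n" "\<And>n. n \<notin> ball_N N \<Longrightarrow> y n = 0"
    and S: "(\<Sum>n\<in>(ball_N N :: (int ^ 'd) set). wt n powr (5/4)) \<le> S"
  shows "(\<Sum>a\<in>ball_N N. \<Sum>b\<in>ball_N N. t a * t b * y (a + b))
     \<le> 2 * (2 ^ CARD('d) * (sqrt (\<Sum>n\<in>ball_N N. wt n powr (1/4) * (y n)\<^sup>2) * sqrt (L * H)) * (H * sqrt S))"
proof -
  define K where "K = sqrt (\<Sum>n\<in>ball_N N. wt n powr (1/4) * (y n)\<^sup>2)"
  have K0: "0 \<le> K" unfolding K_def by (auto intro!: sum_nonneg)
  define lo where "lo a b = (of_bool (lat_norm b \<le> lat_norm a) :: real)" for a b :: "int ^ 'd"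
  have p: "(wt n powr (1/8))\<^sup>2 = wt n powr (1/4)" "(wt n powr (1/4))\<^sup>2 = sqrt (wt n)" "(wt n powr (5/8))\<^sup>2 = wt n powr (5/4)" for n :: "int ^ 'd"
    by (simp_all add: powr_power powr_half_sqrt[symmetric])
  \<comment> \<open>Of the two equal factors of \<open>wt a powr (1/4)\<close>, one moves to
    \<open>a + b\<close> by \<open>wt_add\<close> and the other to \<open>b\<close> by monotonicity.
    Then \<open>t a\<close> is measured in order d / 4 and \<open>y\<close> in order -d / 8.\<close>
  have pt: "lo a b * (t a * y (a + b)) \<le> 2 ^ CARD('d) * wt b powr (1/8) * ((t a / wt a powr (1/4)) * (wt (b + a) powr (1/8) * y (b + a)))" for a b
  proof (cases "lat_norm b \<le> lat_norm a")
    case True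
    have "wt a powr (1/4) = wt a powr (1/8) * wt a powr (1/8)" by (simp add: powr_add[symmetric])
    also have "\<dots> \<le> (2 ^ CARD('d) * wt (a + b)) powr (1/8) * wt b powr (1/8)"
      using wt_add[OF True] wt_antimono[OF True] by (intro mult_mono powr_mono2) auto
    also have "\<dots> = (2 ^ CARD('d)) powr (1/8) * wt (a + b) powr (1/8) * wt b powr (1/8)"
      by (subst powr_mult) auto
    also have "\<dots> \<le> 2 ^ CARD('d) * wt (a + b) powr (1/8) * wt b powr (1/8)"
      using powr_mono[of "1/8" 1 "2 ^ CARD('d) :: real"] by (intro mult_right_mono) (auto simp: one_le_power)
    finally have "1 \<le> 2 ^ CARD('d) * wt (a + b) powr (1/8) * wt b powr (1/8) / wt a powr (1/4)"
      by (simp add: pos_le_divide_eq)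
    then have "1 * (t a * y (a + b)) \<le> (2 ^ CARD('d) * wt (a + b) powr (1/8) * wt b powr (1/8) / wt a powr (1/4)) * (t a * y (a + b))"
      by (intro mult_right_mono) (auto simp: nonneg y)
    then show ?thesis using True by (simp add: lo_def mult_ac add.commute)
  next
    case False
    then show ?thesis by (auto simp: lo_def nonneg y)
  qed
  have inner: "(\<Sum>a\<in>ball_N N. lo a b * (t a * y (a + b))) \<le> 2 ^ CARD('d) * wt b powr (1/8) * (sqrt (L * H) * K)" for b
  proof -
    have "(\<Sum>a\<in>ball_N N. lo a b * (t a * y (a + b)))
       \<le> 2 ^ CARD('d) * wt b powr (1/8) * (\<Sum>a\<in>ball_N N. (t a / wt a powr (1/4)) * (wt (b + a) powr (1/8) * y (b + a)))"
      unfolding sum_distrib_left by (intro sum_mono pt)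
    also have "\<dots> \<le> 2 ^ CARD('d) * wt b powr (1/8) * (sqrt (\<Sum>n\<in>ball_N N. (t n / wt n powr (1/4))\<^sup>2) * sqrt (\<Sum>n\<in>ball_N N. (wt n powr (1/8) * y n)\<^sup>2))"
      by (intro mult_left_mono correlation_le_sqrt[where v="\<lambda>n. wt n powr (1/8) * y n"]) (auto simp: nonneg y)
    also have "\<dots> \<le> 2 ^ CARD('d) * wt b powr (1/8) * (sqrt (L * H) * K)"
      using half_norm_sq_le K0 unfolding K_def power_mult_distrib power_divide p
      by (intro mult_left_mono mult_right_mono real_sqrt_le_mono) auto
    finally show ?thesis .
  qed
  have P1: "(\<Sum>a\<in>ball_N N. \<Sum>b\<in>ball_N N. lo a b * (t a * t b * y (a + b))) \<le> 2 ^ CARD('d) * (K * sqrt (L * H)) * (H * sqrt S)"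
  proof -
    have "(\<Sum>a\<in>ball_N N. \<Sum>b\<in>ball_N N. lo a b * (t a * t b * y (a + b)))
       = (\<Sum>b\<in>ball_N N. t b * (\<Sum>a\<in>ball_N N. lo a b * (t a * y (a + b))))"
      unfolding sum_distrib_left by (subst sum.swap) (simp add: mult_ac)
    also have "\<dots> \<le> (\<Sum>b\<in>ball_N N. t b * (2 ^ CARD('d) * wt b powr (1/8) * (sqrt (L * H) * K)))"
      by (intro sum_mono mult_left_mono inner nonneg)
    also have "\<dots> = 2 ^ CARD('d) * (K * sqrt (L * H)) * (\<Sum>b\<in>ball_N N. (t b / sqrt (wt b)) * wt b powr (5/8))"
    proof -
      \<comment> \<open>Writing 1/8 as 5/8 - 1/2 extracts the norm \<open>H\<close> of
        \<open>t\<close>; Cauchy--Schwarz then leaves the summable weights with exponent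
        5/4.\<close>
      have eq: "(t b / sqrt (wt b)) * wt b powr (5/8) = t b * wt b powr (1/8)" for b
      proof -
        have "wt b powr (5/8) = wt b powr (1/2) * wt b powr (1/8)" by (simp add: powr_add[symmetric])
        then show ?thesis by (simp add: powr_half_sqrt)
      qed
      show ?thesis unfolding eq sum_distrib_left by (simp add: mult_ac)
    qed
    also have "\<dots> \<le> 2 ^ CARD('d) * (K * sqrt (L * H)) * (H * sqrt S)"
    proof (intro mult_left_mono)
      have "(\<Sum>b\<in>ball_N N. (t b / sqrt (wt b)) * wt b powr (5/8)) \<le> H * sqrt (\<Sum>n\<in>(ball_N N :: (int ^ 'd) set). (wt n powr (5/8))\<^sup>2)"
        unfolding H_eq by (rule sum_mult_le_sqrt)
      also have "\<dots> \<le> H * sqrt S" unfolding p using S H_nonneg by (intro mult_left_mono) auto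
      finally show "(\<Sum>b\<in>ball_N N. (t b / sqrt (wt b)) * wt b powr (5/8)) \<le> H * sqrt S" .
    qed (use K0 L_nonneg H_nonneg in auto)
    finally show ?thesis .
  qed
  have P2: "(\<Sum>a\<in>ball_N N. \<Sum>b\<in>ball_N N. lo b a * (t a * t b * y (a + b))) \<le> 2 ^ CARD('d) * (K * sqrt (L * H)) * (H * sqrt S)"
    by (subst sum.swap) (use P1 in \<open>simp add: add.commute mult_ac\<close>)
  have "(\<Sum>a\<in>ball_N N. \<Sum>b\<in>ball_N N. t a * t b * y (a + b))
     \<le> (\<Sum>a\<in>ball_N N. \<Sum>b\<in>ball_N N. lo a b * (t a * t b * y (a + b)) + lo b a * (t a * t b * y (a + b)))"
  proof (intro sum_mono)
    fix a b :: "int ^ 'd"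
    have "1 \<le> lo a b + lo b a" unfolding lo_def by (auto simp: of_bool_def)
    then have "1 * (t a * t b * y (a + b)) \<le> (lo a b + lo b a) * (t a * t b * y (a + b))"
      by (intro mult_right_mono) (auto simp: nonneg y)
    then show "t a * t b * y (a + b) \<le> lo a b * (t a * t b * y (a + b)) + lo b a * (t a * t b * y (a + b))"
      by (simp only: distrib_right mult_1)
  qed
  also have "\<dots> \<le> 2 * (2 ^ CARD('d) * (K * sqrt (L * H)) * (H * sqrt S))" unfolding sum.distrib using P1 P2 by linarith
  finally show ?thesis unfolding K_def .
qed

end

text \<open>The smallest factor \<open>c\<close> satisfies
  \<open>c ^ 4 \<le> c\<^sup>2 \<le> a * b\<close> and can be traded for
  \<open>(a * b) powr (1/4)\<close>. A sum over three linked frequencies thus splits into double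
  sums with a summable exponent.\<close>

lemma mult3_le_pairs:
  fixes x y z :: real
  assumes "0 < x" "x \<le> 1" "0 < y" "y \<le> 1" "0 < z" "z \<le> 1"
  shows "x * y * z \<le> x powr (5/4) * y powr (5/4) + y powr (5/4) * z powr (5/4) + x powr (5/4) * z powr (5/4)"
proof -
  have key: "a * b * c \<le> a powr (5/4) * b powr (5/4)"
    if "0 < a" "0 < b" "0 < c" "c \<le> 1" "c \<le> a" "c \<le> b" for a b c :: real
  proof -
    have "c = (c ^ 4) powr (1/4)" using that powr_powr[of c 4 "1/4"] by (simp add: powr_numeral)
    also have "c ^ 4 \<le> c ^ 2" using that by (intro power_decreasing) auto
    then have "(c ^ 4) powr (1/4) \<le> (a * b) powr (1/4)"
      using that mult_mono[of c a c b] by (intro powr_mono2) (auto simp: power2_eq_square)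
    finally have "a * b * c \<le> a * b * (a * b) powr (1/4)" using that by simp
    also have "\<dots> = (a * b) powr (5/4)" using that powr_add[of "a * b" 1 "1/4"] by simp
    finally show ?thesis using that by (simp add: powr_mult)
  qed
  consider "z \<le> x \<and> z \<le> y" | "x \<le> y \<and> x \<le> z" | "y \<le> x \<and> y \<le> z" by linarith
  then show ?thesis
  proof cases
    case 1 then show ?thesis using key[of x y z] assms by (simp add: add_increasing2)
  next
    case 2 
    have "y * z * x \<le> y powr (5/4) * z powr (5/4)" using key[of y z x] assms 2 by simp
    moreover have "0 \<le> x powr (5/4) * y powr (5/4)" "0 \<le> x powr (5/4) * z powr (5/4)" by auto
    moreover have "x * y * z = y * z * x" by simp
    ultimately show ?thesis by linarith
  next
    case 3
    have "x * z * y \<le> x powr (5/4) * z powr (5/4)" using key[of x z y] assms 3 by simp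
    moreover have "0 \<le> x powr (5/4) * y powr (5/4)" "0 \<le> y powr (5/4) * z powr (5/4)" by auto
    moreover have "x * y * z = x * z * y" by simp
    ultimately show ?thesis by linarith
  qed
qed

lemma sum_wt_cubic_le:
  assumes S: "(\<Sum>n\<in>(ball_N N :: (int ^ 'd) set). wt n powr (5/4)) \<le> S"
  shows "(\<Sum>a\<in>(ball_N N :: (int ^ 'd) set). \<Sum>b\<in>ball_N N. of_bool (a + b \<in> ball_N N) * (wt a * wt b * wt (a + b))) \<le> 3 * S\<^sup>2"
proof -
  let ?B = "ball_N N :: (int ^ 'd) set"
  define w where "w n = (if n \<in> ?B then wt n powr (5/4) else 0)" for n
  define s where "s = (\<Sum>n\<in>?B. w n)"
  have w0: "0 \<le> w n" for n by (simp add: w_def)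
  have s: "0 \<le> s" "s \<le> S" using S by (auto simp: s_def w_def intro!: sum_nonneg)
  have tr: "(\<Sum>b\<in>?B. w (a + b)) \<le> s" for a
    unfolding s_def by (rule sum_translate_le) (auto simp: w_def)
  have "(\<Sum>a\<in>?B. \<Sum>b\<in>?B. of_bool (a + b \<in> ?B) * (wt a * wt b * wt (a + b)))
     \<le> (\<Sum>a\<in>?B. \<Sum>b\<in>?B. w a * w b + w b * w (a + b) + w a * w (a + b))"
  proof (intro sum_mono)
    fix a b assume "a \<in> ?B" "b \<in> ?B"
    then show "of_bool (a + b \<in> ?B) * (wt a * wt b * wt (a + b)) \<le> w a * w b + w b * w (a + b) + w a * w (a + b)"
      using mult3_le_pairs[of "wt a" "wt b" "wt (a + b)"] by (auto simp: w_def)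
  qed
  also have "\<dots> = (\<Sum>a\<in>?B. \<Sum>b\<in>?B. w a * w b) + (\<Sum>b\<in>?B. \<Sum>a\<in>?B. w b * w (b + a)) + (\<Sum>a\<in>?B. \<Sum>b\<in>?B. w a * w (a + b))"
    by (subst (2) sum.swap) (simp add: sum.distrib add.commute)
  also have "\<dots> \<le> s * s + s * s + s * s"
  proof (intro add_mono)
    show "(\<Sum>a\<in>?B. \<Sum>b\<in>?B. w a * w b) \<le> s * s" by (simp add: s_def sum_product)
    have "(\<Sum>b\<in>?B. \<Sum>a\<in>?B. w b * w (b + a)) \<le> (\<Sum>b\<in>?B. w b * s)"
      unfolding sum_distrib_left[symmetric] by (intro sum_mono mult_left_mono tr w0)
    then show "(\<Sum>b\<in>?B. \<Sum>a\<in>?B. w b * w (b + a)) \<le> s * s" by (simp add: s_def sum_distrib_right)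
    then show "(\<Sum>a\<in>?B. \<Sum>b\<in>?B. w a * w (a + b)) \<le> s * s" .
  qed
  also have "\<dots> \<le> 3 * S\<^sup>2" using s mult_mono[OF s(2) s(2)] by (simp add: power2_eq_square)
  finally show ?thesis .
qed

section \<open>The covariance of the field\<close>

lemma integral_pair_mult:
  fixes f g :: "'a \<Rightarrow> real"
  assumes T: "prob_space T" and f: "integrable T f" and g: "integrable T g"
  shows "integrable (T \<Otimes>\<^sub>M T) (\<lambda>z. f (fst z) * g (snd z))"
    and "(\<integral>z. f (fst z) * g (snd z) \<partial>(T \<Otimes>\<^sub>M T)) = (\<integral>x. f x \<partial>T) * (\<integral>x. g x \<partial>T)"
proof -
  interpret prob_space T by fact
  interpret P: pair_sigma_finite T T ..
  have [measurable]: "f \<in> borel_measurable T" "g \<in> borel_measurable T" using f g by auto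
  show int: "integrable (T \<Otimes>\<^sub>M T) (\<lambda>z. f (fst z) * g (snd z))"
  proof (rule P.Fubini_integrable)
    show "integrable T (\<lambda>x. \<integral>y. norm (f (fst (x, y)) * g (snd (x, y))) \<partial>T)"
      using f g by (simp add: abs_mult)
    show "AE x in T. integrable T (\<lambda>y. f (fst (x, y)) * g (snd (x, y)))"
      using g by simp
  qed measurable
  have "(\<integral>z. f (fst z) * g (snd z) \<partial>(T \<Otimes>\<^sub>M T)) = (\<integral>x. (\<integral>y. f x * g y \<partial>T) \<partial>T)"
    using P.integral_fst'[OF int] by simp
  then show "(\<integral>z. f (fst z) * g (snd z) \<partial>(T \<Otimes>\<^sub>M T)) = (\<integral>x. f x \<partial>T) * (\<integral>x. g x \<partial>T)" by simp
qed

text \<open>A product of two integrals is one double integral, into which Fubini moves the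
  expectation. Absolute integrability follows from the bound of a product by half the sum of
  squares, whose expectations are bounded uniformly in the space variable.\<close>

lemma second_moment_exchange:
  fixes \<Phi> \<Psi> :: "'a \<Rightarrow> 'b \<Rightarrow> real"
  assumes M: "prob_space M" and T: "prob_space T"
    and m1: "(\<lambda>z. \<Phi> (fst z) (snd z)) \<in> borel_measurable (M \<Otimes>\<^sub>M T)"
    and m2: "(\<lambda>z. \<Psi> (fst z) (snd z)) \<in> borel_measurable (M \<Otimes>\<^sub>M T)"
    and iT: "\<And>\<omega>. integrable T (\<Phi> \<omega>)" "\<And>\<omega>. integrable T (\<Psi> \<omega>)"
    and i1: "\<And>x. integrable M (\<lambda>\<omega>. (\<Phi> \<omega> x)\<^sup>2)" "\<And>x. (\<integral>\<omega>. (\<Phi> \<omega> x)\<^sup>2 \<partial>M) \<le> c"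
    and i2: "\<And>x. integrable M (\<lambda>\<omega>. (\<Psi> \<omega> x)\<^sup>2)" "\<And>x. (\<integral>\<omega>. (\<Psi> \<omega> x)\<^sup>2 \<partial>M) \<le> c"
  shows "integrable M (\<lambda>\<omega>. (\<integral>x. \<Phi> \<omega> x \<partial>T) * (\<integral>x. \<Psi> \<omega> x \<partial>T))" (is ?int)
    and "(\<integral>\<omega>. (\<integral>x. \<Phi> \<omega> x \<partial>T) * (\<integral>x. \<Psi> \<omega> x \<partial>T) \<partial>M)
       = (\<integral>z. (\<integral>\<omega>. \<Phi> \<omega> (fst z) * \<Psi> \<omega> (snd z) \<partial>M) \<partial>(T \<Otimes>\<^sub>M T))" (is ?eq)
proof -
  interpret M: prob_space M by fact
  interpret T: prob_space T by fact
  interpret TT: pair_prob_space T T ..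
  interpret P: pair_prob_space M "T \<Otimes>\<^sub>M T" ..
  define f where "f \<omega> z = \<Phi> \<omega> (fst z) * \<Psi> \<omega> (snd z)" for \<omega> z
  have mf[measurable]: "case_prod f \<in> borel_measurable (M \<Otimes>\<^sub>M (T \<Otimes>\<^sub>M T))"
  proof -
    have "(\<lambda>p. \<Phi> (fst p) (fst (snd p))) \<in> borel_measurable (M \<Otimes>\<^sub>M (T \<Otimes>\<^sub>M T))"
      using measurable_compose[OF _ m1, of "\<lambda>p. (fst p, fst (snd p))" "M \<Otimes>\<^sub>M (T \<Otimes>\<^sub>M T)"] by simp
    moreover have "(\<lambda>p. \<Psi> (fst p) (snd (snd p))) \<in> borel_measurable (M \<Otimes>\<^sub>M (T \<Otimes>\<^sub>M T))"
      using measurable_compose[OF _ m2, of "\<lambda>p. (fst p, snd (snd p))" "M \<Otimes>\<^sub>M (T \<Otimes>\<^sub>M T)"] by simp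
    ultimately show ?thesis unfolding f_def split_beta' by measurable
  qed
  have bd: "(\<integral>\<^sup>+\<omega>. ennreal (norm (f \<omega> z)) \<partial>M) \<le> ennreal c" for z
  proof -
    have "(\<integral>\<^sup>+\<omega>. ennreal (norm (f \<omega> z)) \<partial>M) \<le> (\<integral>\<^sup>+\<omega>. ennreal (((\<Phi> \<omega> (fst z))\<^sup>2 + (\<Psi> \<omega> (snd z))\<^sup>2) / 2) \<partial>M)"
    proof (intro nn_integral_mono ennreal_leI)
      fix \<omega>
      have "2 * (\<bar>\<Phi> \<omega> (fst z)\<bar> * \<bar>\<Psi> \<omega> (snd z)\<bar>) \<le> \<bar>\<Phi> \<omega> (fst z)\<bar>\<^sup>2 + \<bar>\<Psi> \<omega> (snd z)\<bar>\<^sup>2"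
        using sum_squares_bound[of "\<bar>\<Phi> \<omega> (fst z)\<bar>" "\<bar>\<Psi> \<omega> (snd z)\<bar>"] by (simp add: mult.assoc)
      then show "norm (f \<omega> z) \<le> ((\<Phi> \<omega> (fst z))\<^sup>2 + (\<Psi> \<omega> (snd z))\<^sup>2) / 2"
        by (simp add: f_def abs_mult)
    qed
    also have "\<dots> = ennreal (\<integral>\<omega>. ((\<Phi> \<omega> (fst z))\<^sup>2 + (\<Psi> \<omega> (snd z))\<^sup>2) / 2 \<partial>M)"
      using i1(1)[of "fst z"] i2(1)[of "snd z"] by (intro nn_integral_eq_integral) auto
    also have "\<dots> \<le> ennreal c"
      using i1[of "fst z"] i2[of "snd z"] by (intro ennreal_leI) simp
    finally show ?thesis .
  qed
  have int: "integrable (M \<Otimes>\<^sub>M (T \<Otimes>\<^sub>M T)) (case_prod f)"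
  proof (rule integrableI_bounded[OF mf])
    have "(\<integral>\<^sup>+p. ennreal (norm (case_prod f p)) \<partial>(M \<Otimes>\<^sub>M (T \<Otimes>\<^sub>M T)))
       = (\<integral>\<^sup>+z. (\<integral>\<^sup>+\<omega>. ennreal (norm (case_prod f (\<omega>, z))) \<partial>M) \<partial>(T \<Otimes>\<^sub>M T))"
      by (rule P.nn_integral_snd[symmetric]) measurable
    also have "\<dots> \<le> (\<integral>\<^sup>+z. ennreal c \<partial>(T \<Otimes>\<^sub>M T))"
      using bd by (intro nn_integral_mono) (simp del: real_norm_def)
    also have "\<dots> = ennreal c" by (simp add: TT.emeasure_space_1)
    finally show "(\<integral>\<^sup>+p. ennreal (norm (case_prod f p)) \<partial>(M \<Otimes>\<^sub>M (T \<Otimes>\<^sub>M T))) < \<infinity>"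
      by (simp add: le_less_trans)
  qed
  have fz: "(\<integral>z. f \<omega> z \<partial>(T \<Otimes>\<^sub>M T)) = (\<integral>x. \<Phi> \<omega> x \<partial>T) * (\<integral>x. \<Psi> \<omega> x \<partial>T)" for \<omega>
    unfolding f_def by (rule integral_pair_mult(2)[OF T iT])
  show ?int
    using P.integrable_fst'[OF int] by (simp add: fz)
  show ?eq
    using P.Fubini_integral[OF int] unfolding fz by (simp add: f_def)
qed

definition fld :: "nat \<Rightarrow> (int ^ 'd \<Rightarrow> real) \<Rightarrow> real ^ 'd \<Rightarrow> real" where
  "fld N \<omega> x = (\<Sum>n\<in>ball_N N. sqrt (wt n) * \<omega> n * cas n x)"

lemma sum_ball_N_uminus: "(\<Sum>n\<in>ball_N N. h (- n)) = (\<Sum>n\<in>ball_N N. h n)"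
  by (rule sum.reindex_bij_witness[where i=uminus and j=uminus]) auto

lemma japan_powr_half: "japan n powr (- real CARD('d) / 2) = sqrt (wt n)" for n :: "int ^ 'd"
  using japan_ge_1[of n] by (simp add: wt_def powr_half_sqrt[symmetric] powr_powr)

text \<open>The real part of mode \<open>n\<close> is a term in \<open>\<omega> n\<close> plus its
  mirror image under negation of \<open>n\<close>. The ball is symmetric, so the summation doubles
  the half terms.\<close>

lemma uN_eq_fld: "uN N \<omega> x = fld N \<omega> x" for x :: "real ^ 'd"
proof -
  define h where "h n = sqrt (wt n) * \<omega> n * cas n x / 2" for n
  have h': "h (- n) = sqrt (wt n) * \<omega> (- n) * (cos (lat_dot n x) + sin (lat_dot n x)) / 2" for n
    by (simp add: h_def cas_def lat_dot_minus)
  have "uN N \<omega> x = (\<Sum>n\<in>ball_N N. h n + h (- n))"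
    unfolding uN_def Re_sum
  proof (intro sum.cong refl)
    fix n :: "int ^ 'd"
    have r: "Re (complex_of_real a * Complex b c * cis t) = a * (b * cos t - c * sin t)" for a b c t
      by (simp add: algebra_simps)
    show "Re (complex_of_real (japan n powr (- real CARD('d) / 2)) * gcoef \<omega> n * e_n n x) = h n + h (- n)"
      unfolding japan_powr_half gcoef_def e_n_def r h' unfolding h_def cas_def by (simp add: field_simps)
  qed
  also have "\<dots> = 2 * (\<Sum>n\<in>ball_N N. h n)"
    by (simp add: sum.distrib sum_ball_N_uminus)
  also have "\<dots> = fld N \<omega> x" by (simp add: fld_def h_def sum_distrib_left)
  finally show ?thesis .
qed

lemma sigmaN_eq: "sigmaN TYPE('d) N = (\<Sum>n\<in>(ball_N N :: (int ^ 'd) set). wt n)"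
  by (simp add: sigmaN_def wt_def)

text \<open>Pairing \<open>n\<close> with \<open>- n\<close> uses
  \<open>(cos t - sin t)\<^sup>2 + (cos t + sin t)\<^sup>2 = 2\<close>. The pointwise variance is
  therefore constant and equal to the renormalisation constant, so that the Hermite covariance
  formula applies to the Wick powers.\<close>

lemma sum_wt_cas_sq: "(\<Sum>n\<in>ball_N N. (sqrt (wt n) * cas n x)\<^sup>2) = sigmaN TYPE('d) N" for x :: "real ^ 'd"
proof -
  define h where "h n = (sqrt (wt n) * cas n x)\<^sup>2" for n
  have "h n + h (- n) = 2 * wt n" for n
  proof -
    have "(cos t - sin t)\<^sup>2 + (cos t + sin t)\<^sup>2 = 2" for t :: real
      using sin_cos_squared_add[of t] by (simp add: power2_eq_square algebra_simps)
    moreover have "h n = wt n * (cos (lat_dot n x) - sin (lat_dot n x))\<^sup>2" "h (- n) = wt n * (cos (lat_dot n x) + sin (lat_dot n x))\<^sup>2"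
      by (simp_all add: h_def cas_def lat_dot_minus power_mult_distrib)
    ultimately show ?thesis by (simp only: distrib_left[symmetric] mult.commute)
  qed
  then have "(\<Sum>n\<in>ball_N N. h n + h (- n)) = 2 * sigmaN TYPE('d) N"
    by (simp add: sigmaN_eq sum_distrib_left)
  then have "2 * (\<Sum>n\<in>ball_N N. h n) = 2 * sigmaN TYPE('d) N"
    by (simp add: sum.distrib sum_ball_N_uminus)
  then show ?thesis by (simp add: h_def)
qed

definition covK :: "nat \<Rightarrow> real ^ 'd \<Rightarrow> real ^ 'd \<Rightarrow> real" where
  "covK N x y = (\<Sum>n\<in>ball_N N. wt n * (cas n x * cas n y))"

text \<open>Extending the shorter linear form by zeros puts both over the same index set. Only the
  common frequencies are correlated, hence \<open>covK M\<close> with the smaller index; this later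
  makes the increments orthogonal.\<close>

lemma hermite_fld_covariance:
  fixes x y :: "real ^ 'd"
  assumes k: "k \<le> 3" and MN: "M \<le> N"
  shows "integrable gauss_prod (\<lambda>\<omega>. hermite k (sigmaN TYPE('d) N) (fld N \<omega> x) * hermite k (sigmaN TYPE('d) M) (fld M \<omega> y))"
    and "(\<integral>\<omega>. hermite k (sigmaN TYPE('d) N) (fld N \<omega> x) * hermite k (sigmaN TYPE('d) M) (fld M \<omega> y) \<partial>gauss_prod)
       = fact k * covK M x y ^ k"
proof -
  let ?B = "ball_N N :: (int ^ 'd) set"
  define \<alpha> where "\<alpha> n = sqrt (wt n) * cas n x" for n
  define \<beta> where "\<beta> n = (if n \<in> ball_N M then sqrt (wt n) * cas n y else 0)" for n
  have red: "(\<Sum>n\<in>?B. if n \<in> ball_N M then h n else 0) = (\<Sum>n\<in>ball_N M. h n)" for h :: "int ^ 'd \<Rightarrow> real"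
    using ball_N_mono[OF MN, where 'a='d] by (simp add: sum.inter_restrict[symmetric] Int_absorb1)
  have 1: "(\<Sum>n\<in>?B. (\<alpha> n)\<^sup>2) = sigmaN TYPE('d) N" unfolding \<alpha>_def by (rule sum_wt_cas_sq)
  have 2: "(\<Sum>n\<in>?B. (\<beta> n)\<^sup>2) = sigmaN TYPE('d) M"
    using red[of "\<lambda>n. (sqrt (wt n) * cas n y)\<^sup>2"] unfolding \<beta>_def sum_wt_cas_sq
    by (simp add: if_distrib[of "\<lambda>r. r\<^sup>2"] cong: if_cong)
  have 3: "(\<Sum>n\<in>?B. \<alpha> n * \<omega> n) = fld N \<omega> x" for \<omega>
    by (simp add: \<alpha>_def fld_def mult_ac)
  have 4: "(\<Sum>n\<in>?B. \<beta> n * \<omega> n) = fld M \<omega> y" for \<omega>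
  proof -
    have "(\<Sum>n\<in>?B. \<beta> n * \<omega> n) = (\<Sum>n\<in>?B. if n \<in> ball_N M then sqrt (wt n) * \<omega> n * cas n y else 0)"
      by (intro sum.cong refl) (auto simp: \<beta>_def)
    then show ?thesis unfolding red fld_def .
  qed
  have 5: "(\<Sum>n\<in>?B. \<alpha> n * \<beta> n) = covK M x y"
  proof -
    have "(\<Sum>n\<in>?B. \<alpha> n * \<beta> n) = (\<Sum>n\<in>?B. if n \<in> ball_N M then wt n * (cas n x * cas n y) else 0)"
      by (intro sum.cong refl) (auto simp: \<alpha>_def \<beta>_def)
    then show ?thesis unfolding red covK_def .
  qed
  from hermite_covariance[of ?B k k \<alpha> \<beta>] k
  show "integrable gauss_prod (\<lambda>\<omega>. hermite k (sigmaN TYPE('d) N) (fld N \<omega> x) * hermite k (sigmaN TYPE('d) M) (fld M \<omega> y))"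
    and "(\<integral>\<omega>. hermite k (sigmaN TYPE('d) N) (fld N \<omega> x) * hermite k (sigmaN TYPE('d) M) (fld M \<omega> y) \<partial>gauss_prod)
       = fact k * covK M x y ^ k"
    unfolding 5 unfolding 1 2 3 4 by auto
qed

text \<open>This bound diverges with \<open>N\<close>. It serves to justify integrability when
  expectations and space integrals are exchanged.\<close>

lemma covK_bound: "\<bar>covK N x y\<bar> \<le> 4 * sigmaN TYPE('d) N" for x y :: "real ^ 'd"
proof -
  have "\<bar>covK N x y\<bar> \<le> (\<Sum>n\<in>(ball_N N :: (int ^ 'd) set). \<bar>wt n * (cas n x * cas n y)\<bar>)" unfolding covK_def by (rule sum_abs)
  also have "\<dots> \<le> (\<Sum>n\<in>(ball_N N :: (int ^ 'd) set). wt n * 4)"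
  proof (intro sum_mono)
    fix n :: "int ^ 'd"
    have "\<bar>cas n x\<bar> * \<bar>cas n y\<bar> \<le> 2 * 2" by (intro mult_mono abs_cas_le) auto
    then show "\<bar>wt n * (cas n x * cas n y)\<bar> \<le> wt n * 4" by (simp add: abs_mult)
  qed
  also have "\<dots> = 4 * sigmaN TYPE('d) N" by (simp add: sigmaN_eq sum_distrib_right[symmetric])
  finally show ?thesis .
qed

lemma continuous_fld[continuous_intros]: "continuous_on S (fld N \<omega>)"
  unfolding fld_def by (intro continuous_intros)

lemma continuous_hermite_fld[continuous_intros]: "k \<le> 3 \<Longrightarrow> continuous_on S (\<lambda>x. hermite k v (fld N \<omega> x))"
  by (erule le3_cases) (simp_all add: hermite_numeral, (intro continuous_intros)+)

lemma borel_measurable_cas[measurable]: "cas n \<in> borel_measurable borel"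
  by (intro borel_measurable_continuous_onI continuous_intros)

lemma measurable_fld[measurable]:
  "(\<lambda>z. fld N (fst z) (snd z)) \<in> borel_measurable (gauss_prod \<Otimes>\<^sub>M torus)"
  unfolding fld_def by measurable

lemma measurable_hermite[measurable]:
  "k \<le> 3 \<Longrightarrow> f \<in> borel_measurable M \<Longrightarrow> (\<lambda>z. hermite k v (f z)) \<in> borel_measurable M"
  by (erule le3_cases) (simp_all add: hermite_numeral)

section \<open>Second moments of the Wick integrals\<close>

text \<open>
  \<open>cubN\<close> and \<open>sqN\<close> are the integrals of the Wick powers of \<open>u\<^sub>N\<close>; \<open>dualN\<close> is the squared norm of the Wick
  square in the Sobolev space of order \<open>- d / 2\<close>, and \<open>lowN\<close> that of \<open>u\<^sub>N\<close> in order \<open>- d / 8\<close>.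
\<close>

definition cubN :: "nat \<Rightarrow> (int ^ 'd \<Rightarrow> real) \<Rightarrow> real" where
  "cubN N \<omega> = (\<integral>x. hermite 3 (sigmaN TYPE('d) N) (fld N \<omega> x) \<partial>torus)"

definition sqN :: "nat \<Rightarrow> (int ^ 'd \<Rightarrow> real) \<Rightarrow> real" where
  "sqN N \<omega> = (\<integral>x. hermite 2 (sigmaN TYPE('d) N) (fld N \<omega> x) \<partial>torus)"

definition dualN :: "nat \<Rightarrow> (int ^ 'd \<Rightarrow> real) \<Rightarrow> real" where
  "dualN N \<omega> = (\<Sum>n\<in>ball_N N. wt n * (\<integral>x. hermite 2 (sigmaN TYPE('d) N) (fld N \<omega> x) * cas n x \<partial>torus)\<^sup>2)"

definition lowN :: "nat \<Rightarrow> (int ^ 'd \<Rightarrow> real) \<Rightarrow> real" where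
  "lowN N \<omega> = (\<Sum>n\<in>ball_N N. wt n powr (1/4) * (sqrt (wt n) * \<omega> n)\<^sup>2)"

lemma RN_eq: "RN \<sigma> A N \<omega> = \<sigma> / 3 * cubN N \<omega> - A * (sqN N \<omega>)\<^sup>2"
proof -
  have 3: "wick3 N \<omega> = (\<lambda>x. hermite 3 (sigmaN TYPE('a) N) (fld N \<omega> x))"
    by (simp add: wick3_def hermite_numeral uN_eq_fld fun_eq_iff)
  have 2: "wick2 N \<omega> = (\<lambda>x. hermite 2 (sigmaN TYPE('a) N) (fld N \<omega> x))"
    by (simp add: wick2_def hermite_numeral uN_eq_fld fun_eq_iff)
  show ?thesis
    unfolding RN_def 2 3 cubN_def sqN_def
    by (subst torus_int_eq_integral_torus, simp add: continuous_intros)+ simp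
qed

text \<open>
  With \<open>K = covK N\<close> the covariance function of \<open>u\<^sub>N\<close>, these are the double integrals of \<open>K\<^sup>2\<close> and \<open>K\<^sup>3\<close>;
  all terms are nonnegative, which makes both monotone in \<open>N\<close>.
\<close>

definition kap2 :: "'d::finite itself \<Rightarrow> nat \<Rightarrow> real" where
  "kap2 _ N = (\<Sum>a\<in>(ball_N N :: (int ^ 'd) set). (wt a)\<^sup>2)"

definition kap3 :: "'d::finite itself \<Rightarrow> nat \<Rightarrow> real" where
  "kap3 _ N = (\<Sum>a\<in>(ball_N N :: (int ^ 'd) set). \<Sum>b\<in>ball_N N. \<Sum>c\<in>ball_N N. wt a * wt b * wt c * (cas3 a b c)\<^sup>2)"

lemma integral_torus_pair_mult:
  fixes f g :: "real ^ 'd \<Rightarrow> real"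
  assumes "continuous_on UNIV f" "continuous_on UNIV g"
  shows "has_bochner_integral (torus \<Otimes>\<^sub>M torus) (\<lambda>z. f (fst z) * g (snd z)) ((\<integral>x. f x \<partial>torus) * (\<integral>x. g x \<partial>torus))"
  using integral_pair_mult[OF prob_space_torus integrable_torus[OF assms(1)] integrable_torus[OF assms(2)]]
  by (simp add: has_bochner_integral_iff)

lemma integral_covK_sq:
  "(\<integral>z. (covK N (fst z) (snd z))\<^sup>2 \<partial>((torus :: (real ^ 'd) measure) \<Otimes>\<^sub>M torus)) = kap2 TYPE('d) N"
proof -
  have "has_bochner_integral (torus \<Otimes>\<^sub>M torus)
      (\<lambda>z. \<Sum>a\<in>(ball_N N :: (int ^ 'd) set). \<Sum>b\<in>ball_N N. wt a * wt b * ((cas a (fst z) * cas b (fst z)) * (cas a (snd z) * cas b (snd z))))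
      (\<Sum>a\<in>(ball_N N :: (int ^ 'd) set). \<Sum>b\<in>ball_N N. wt a * wt b * (of_bool (b = a) * of_bool (b = a)))"
    unfolding integral_cas_mult[symmetric]
    by (intro has_bochner_integral_sum has_bochner_integral_mult_right integral_torus_pair_mult continuous_intros)
  moreover have "(\<Sum>a\<in>(ball_N N :: (int ^ 'd) set). \<Sum>b\<in>ball_N N. wt a * wt b * ((cas a (fst z) * cas b (fst z)) * (cas a (snd z) * cas b (snd z)))) = (covK N (fst z) (snd z))\<^sup>2" for z
    unfolding covK_def power2_eq_square sum_product by (intro sum.cong refl) (simp add: mult_ac)
  moreover have "(\<Sum>a\<in>(ball_N N :: (int ^ 'd) set). \<Sum>b\<in>ball_N N. wt a * wt b * (of_bool (b = a) * of_bool (b = a))) = kap2 TYPE('d) N"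
    unfolding kap2_def by (intro sum.cong refl) (simp add: of_bool_def if_distrib sum.delta power2_eq_square cong: if_cong)
  ultimately show ?thesis by (simp add: has_bochner_integral_iff)
qed

lemma integral_covK_sq_cas:
  fixes n :: "int ^ 'd"
  shows "(\<integral>z. (covK N (fst z) (snd z))\<^sup>2 * (cas n (fst z) * cas n (snd z)) \<partial>(torus \<Otimes>\<^sub>M torus))
      = (\<Sum>a\<in>ball_N N. \<Sum>b\<in>ball_N N. wt a * wt b * (cas3 a b n)\<^sup>2)"
    and "integrable (torus \<Otimes>\<^sub>M torus) (\<lambda>z. (covK N (fst z) (snd z))\<^sup>2 * (cas n (fst z) * cas n (snd z)))"
proof -
  have "has_bochner_integral (torus \<Otimes>\<^sub>M torus)
      (\<lambda>z. \<Sum>a\<in>(ball_N N :: (int ^ 'd) set). \<Sum>b\<in>ball_N N. wt a * wt b * ((cas a (fst z) * cas b (fst z) * cas n (fst z)) * (cas a (snd z) * cas b (snd z) * cas n (snd z))))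
      (\<Sum>a\<in>(ball_N N :: (int ^ 'd) set). \<Sum>b\<in>ball_N N. wt a * wt b * (cas3 a b n * cas3 a b n))"
    unfolding cas3_def
    by (intro has_bochner_integral_sum has_bochner_integral_mult_right integral_torus_pair_mult continuous_intros)
  moreover have "(\<Sum>a\<in>(ball_N N :: (int ^ 'd) set). \<Sum>b\<in>ball_N N. wt a * wt b * ((cas a (fst z) * cas b (fst z) * cas n (fst z)) * (cas a (snd z) * cas b (snd z) * cas n (snd z))))
     = (covK N (fst z) (snd z))\<^sup>2 * (cas n (fst z) * cas n (snd z))" for z
    unfolding covK_def power2_eq_square sum_product unfolding sum_distrib_right by (intro sum.cong refl) (simp add: mult_ac)
  ultimately show "(\<integral>z. (covK N (fst z) (snd z))\<^sup>2 * (cas n (fst z) * cas n (snd z)) \<partial>(torus \<Otimes>\<^sub>M torus))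
      = (\<Sum>a\<in>ball_N N. \<Sum>b\<in>ball_N N. wt a * wt b * (cas3 a b n)\<^sup>2)"
    and "integrable (torus \<Otimes>\<^sub>M torus) (\<lambda>z. (covK N (fst z) (snd z))\<^sup>2 * (cas n (fst z) * cas n (snd z)))"
    by (simp_all add: has_bochner_integral_iff power2_eq_square)
qed

lemma kap3_alt: "kap3 TYPE('d) N = (\<Sum>n\<in>(ball_N N :: (int ^ 'd) set). wt n * (\<Sum>a\<in>ball_N N. \<Sum>b\<in>ball_N N. wt a * wt b * (cas3 a b n)\<^sup>2))"
proof -
  have "kap3 TYPE('d) N = (\<Sum>a\<in>(ball_N N :: (int ^ 'd) set). \<Sum>c\<in>ball_N N. \<Sum>b\<in>ball_N N. wt a * wt b * wt c * (cas3 a b c)\<^sup>2)"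
    unfolding kap3_def by (intro sum.cong refl sum.swap)
  also have "\<dots> = (\<Sum>c\<in>(ball_N N :: (int ^ 'd) set). \<Sum>a\<in>ball_N N. \<Sum>b\<in>ball_N N. wt a * wt b * wt c * (cas3 a b c)\<^sup>2)"
    by (rule sum.swap)
  finally show ?thesis by (simp add: sum_distrib_left mult_ac)
qed

lemma integral_covK_cube:
  "(\<integral>z. (covK N (fst z) (snd z)) ^ 3 \<partial>((torus :: (real ^ 'd) measure) \<Otimes>\<^sub>M torus)) = kap3 TYPE('d) N"
proof -
  have "(covK N x y) ^ 3 = (\<Sum>n\<in>(ball_N N :: (int ^ 'd) set). wt n * ((covK N x y)\<^sup>2 * (cas n x * cas n y)))" for x y
  proof -
    have "(covK N x y) ^ 3 = (covK N x y)\<^sup>2 * (\<Sum>n\<in>(ball_N N :: (int ^ 'd) set). wt n * (cas n x * cas n y))"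
      by (simp add: covK_def power3_eq_cube power2_eq_square)
    then show ?thesis by (simp add: sum_distrib_left mult_ac)
  qed
  then have "(\<integral>z. (covK N (fst z) (snd z)) ^ 3 \<partial>((torus :: (real ^ 'd) measure) \<Otimes>\<^sub>M torus))
     = (\<integral>z. (\<Sum>n\<in>(ball_N N :: (int ^ 'd) set). wt n * ((covK N (fst z) (snd z))\<^sup>2 * (cas n (fst z) * cas n (snd z)))) \<partial>(torus \<Otimes>\<^sub>M torus))"
    by simp
  also have "\<dots> = (\<Sum>n\<in>(ball_N N :: (int ^ 'd) set). wt n * (\<integral>z. (covK N (fst z) (snd z))\<^sup>2 * (cas n (fst z) * cas n (snd z)) \<partial>(torus \<Otimes>\<^sub>M torus)))"
    by (subst Bochner_Integration.integral_sum) (auto intro!: integrable_mult_right integral_covK_sq_cas(2))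
  also have "\<dots> = kap3 TYPE('d) N"
    unfolding integral_covK_sq_cas(1) kap3_alt ..
  finally show ?thesis .
qed

lemma covK_power_le:
  fixes x y :: "real ^ 'd"
  shows "fact k * covK N x y ^ k \<le> fact k * (4 * sigmaN TYPE('d) N) ^ k"
proof (intro mult_left_mono)
  have "covK N x y ^ k \<le> \<bar>covK N x y\<bar> ^ k" by (metis abs_ge_self power_abs)
  also have "\<dots> \<le> (4 * sigmaN TYPE('d) N) ^ k" by (intro power_mono covK_bound) auto
  finally show "covK N x y ^ k \<le> (4 * sigmaN TYPE('d) N) ^ k" .
qed simp

text \<open>The factor \<open>cas n\<close> treats two cases at once: \<open>n = 0\<close> gives the
  Wick integrals, general \<open>n\<close> the coefficients that enter \<open>dualN\<close>.\<close>

lemma hermite_integral_moment: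
  fixes n :: "int ^ 'd"
  assumes k: "k \<le> 3" and MN: "M \<le> N"
  shows "integrable gauss_prod (\<lambda>\<omega>::int ^ 'd \<Rightarrow> real.
       (\<integral>x. hermite k (sigmaN TYPE('d) N) (fld N \<omega> x) * cas n x \<partial>torus) * (\<integral>x. hermite k (sigmaN TYPE('d) M) (fld M \<omega> x) * cas n x \<partial>torus))"
    and "(\<integral>\<omega>. (\<integral>x. hermite k (sigmaN TYPE('d) N) (fld N \<omega> x) * cas n x \<partial>torus) * (\<integral>x. hermite k (sigmaN TYPE('d) M) (fld M \<omega> x) * cas n x \<partial>torus) \<partial>gauss_prod)
      = fact k * (\<integral>z. covK M (fst z) (snd z) ^ k * (cas n (fst z) * cas n (snd z)) \<partial>(torus \<Otimes>\<^sub>M torus))"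
proof -
  define \<Phi> where "\<Phi> N \<omega> x = hermite k (sigmaN TYPE('d) N) (fld N \<omega> x) * cas n x" for N \<omega> x
  have meas: "(\<lambda>z. \<Phi> N (fst z) (snd z)) \<in> borel_measurable (gauss_prod \<Otimes>\<^sub>M torus)" for N
    unfolding \<Phi>_def using k by measurable
  have iT: "integrable torus (\<Phi> N \<omega>)" for N \<omega>
    unfolding \<Phi>_def using k by (intro integrable_torus continuous_intros)
  have sq: "(\<Phi> N \<omega> x)\<^sup>2 = (cas n x)\<^sup>2 * (hermite k (sigmaN TYPE('d) N) (fld N \<omega> x) * hermite k (sigmaN TYPE('d) N) (fld N \<omega> x))" for N \<omega> x
    by (simp add: \<Phi>_def power2_eq_square mult_ac)
  have i1: "integrable gauss_prod (\<lambda>\<omega>. (\<Phi> N \<omega> x)\<^sup>2)" for N x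
    unfolding sq using hermite_fld_covariance(1)[OF k order_refl, of N x x] by (rule integrable_mult_right)
  have b1: "(\<integral>\<omega>. (\<Phi> N \<omega> x)\<^sup>2 \<partial>gauss_prod) \<le> 4 * (fact k * (4 * sigmaN TYPE('d) N) ^ k)" for N x
  proof -
    have s0: "0 \<le> sigmaN TYPE('d) N" by (simp add: sigmaN_eq sum_nonneg)
    have "(cas n x)\<^sup>2 \<le> 4" using abs_cas_le[of n x] power_mono[of "\<bar>cas n x\<bar>" 2 2] by simp
    have "(\<integral>\<omega>. (\<Phi> N \<omega> x)\<^sup>2 \<partial>gauss_prod) = (cas n x)\<^sup>2 * (fact k * covK N x x ^ k)"
      unfolding sq by (simp add: hermite_fld_covariance(2)[OF k order_refl])
    also have "\<dots> \<le> (cas n x)\<^sup>2 * (fact k * (4 * sigmaN TYPE('d) N) ^ k)"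
      by (intro mult_left_mono covK_power_le) auto
    also have "\<dots> \<le> 4 * (fact k * (4 * sigmaN TYPE('d) N) ^ k)"
      using \<open>(cas n x)\<^sup>2 \<le> 4\<close> s0 by (intro mult_right_mono) auto
    finally show ?thesis .
  qed
  define c where "c = max (4 * (fact k * (4 * sigmaN TYPE('d) N) ^ k)) (4 * (fact k * (4 * sigmaN TYPE('d) M) ^ k))"
  have bN: "(\<integral>\<omega>. (\<Phi> N \<omega> x)\<^sup>2 \<partial>gauss_prod) \<le> c" and bM: "(\<integral>\<omega>. (\<Phi> M \<omega> x)\<^sup>2 \<partial>gauss_prod) \<le> c" for x
    using b1[of N x] b1[of M x] by (auto simp: c_def)
  show "integrable gauss_prod (\<lambda>\<omega>::int ^ 'd \<Rightarrow> real.
       (\<integral>x. hermite k (sigmaN TYPE('d) N) (fld N \<omega> x) * cas n x \<partial>torus) * (\<integral>x. hermite k (sigmaN TYPE('d) M) (fld M \<omega> x) * cas n x \<partial>torus))"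
    using second_moment_exchange(1)[OF prob_space_gauss_prod prob_space_torus meas[of N] meas[of M] iT iT i1 bN i1 bM] unfolding \<Phi>_def .
  have "(\<integral>\<omega>. (\<integral>x. \<Phi> N \<omega> x \<partial>torus) * (\<integral>x. \<Phi> M \<omega> x \<partial>torus) \<partial>gauss_prod)
     = (\<integral>z. (\<integral>\<omega>. \<Phi> N \<omega> (fst z) * \<Phi> M \<omega> (snd z) \<partial>gauss_prod) \<partial>(torus \<Otimes>\<^sub>M torus))"
    by (rule second_moment_exchange(2)[OF prob_space_gauss_prod prob_space_torus meas[of N] meas[of M] iT iT i1 bN i1 bM])
  also have "\<dots> = (\<integral>z. fact k * (covK M (fst z) (snd z) ^ k * (cas n (fst z) * cas n (snd z))) \<partial>(torus \<Otimes>\<^sub>M torus))"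
  proof (intro Bochner_Integration.integral_cong refl)
    fix z :: "(real ^ 'd) \<times> (real ^ 'd)"
    have "(\<integral>\<omega>. \<Phi> N \<omega> (fst z) * \<Phi> M \<omega> (snd z) \<partial>gauss_prod)
      = (\<integral>\<omega>. (cas n (fst z) * cas n (snd z)) * (hermite k (sigmaN TYPE('d) N) (fld N \<omega> (fst z)) * hermite k (sigmaN TYPE('d) M) (fld M \<omega> (snd z))) \<partial>gauss_prod)"
      by (intro Bochner_Integration.integral_cong refl) (simp add: \<Phi>_def mult_ac)
    also have "\<dots> = (cas n (fst z) * cas n (snd z)) * (fact k * covK M (fst z) (snd z) ^ k)"
      by (simp add: hermite_fld_covariance(2)[OF k MN])
    finally show "(\<integral>\<omega>. \<Phi> N \<omega> (fst z) * \<Phi> M \<omega> (snd z) \<partial>gauss_prod) = fact k * (covK M (fst z) (snd z) ^ k * (cas n (fst z) * cas n (snd z)))"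
      by (simp add: mult_ac)
  qed
  finally show "(\<integral>\<omega>. (\<integral>x. hermite k (sigmaN TYPE('d) N) (fld N \<omega> x) * cas n x \<partial>torus) * (\<integral>x. hermite k (sigmaN TYPE('d) M) (fld M \<omega> x) * cas n x \<partial>torus) \<partial>gauss_prod)
      = fact k * (\<integral>z. covK M (fst z) (snd z) ^ k * (cas n (fst z) * cas n (snd z)) \<partial>(torus \<Otimes>\<^sub>M torus))"
    unfolding \<Phi>_def by simp
qed

lemma cas_0[simp]: "cas 0 x = 1"
  by (simp add: cas_def lat_dot_0)

lemma cubN_moment:
  assumes "M \<le> N"
  shows "integrable gauss_prod (\<lambda>\<omega>::int ^ 'd \<Rightarrow> real. cubN N \<omega> * cubN M \<omega>)"
    and "(\<integral>\<omega>. cubN N \<omega> * cubN M \<omega> \<partial>(gauss_prod :: (int ^ 'd \<Rightarrow> real) measure)) = 6 * kap3 TYPE('d) M"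
  using hermite_integral_moment[OF _ assms, of 3 "0 :: int ^ 'd"]
  by (simp_all add: cubN_def integral_covK_cube fact_numeral)

lemma sqN_moment:
  assumes "M \<le> N"
  shows "integrable gauss_prod (\<lambda>\<omega>::int ^ 'd \<Rightarrow> real. sqN N \<omega> * sqN M \<omega>)"
    and "(\<integral>\<omega>. sqN N \<omega> * sqN M \<omega> \<partial>(gauss_prod :: (int ^ 'd \<Rightarrow> real) measure)) = 2 * kap2 TYPE('d) M"
  using hermite_integral_moment[OF _ assms, of 2 "0 :: int ^ 'd"]
  by (simp_all add: sqN_def integral_covK_sq)

text \<open>Summing the second moments of the coefficients against \<open>wt n\<close> completes the
  square of the covariance to its cube, so the dual norm is controlled by \<open>kap3\<close> as
  well.\<close>

lemma dualN_moment:
  "integrable gauss_prod (\<lambda>\<omega>::int ^ 'd \<Rightarrow> real. dualN N \<omega>)"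
  "(\<integral>\<omega>. dualN N \<omega> \<partial>(gauss_prod :: (int ^ 'd \<Rightarrow> real) measure)) = 2 * kap3 TYPE('d) N"
proof -
  note h = hermite_integral_moment[of 2 N N, simplified]
  show "integrable gauss_prod (\<lambda>\<omega>::int ^ 'd \<Rightarrow> real. dualN N \<omega>)"
    unfolding dualN_def power2_eq_square by (intro Bochner_Integration.integrable_sum integrable_mult_right h(1))
  show "(\<integral>\<omega>. dualN N \<omega> \<partial>(gauss_prod :: (int ^ 'd \<Rightarrow> real) measure)) = 2 * kap3 TYPE('d) N"
    unfolding dualN_def power2_eq_square
    by (subst Bochner_Integration.integral_sum)
       (auto intro!: integrable_mult_right h(1) simp: h(2) integral_covK_sq_cas(1) kap3_alt sum_distrib_left mult.left_commute[of _ 2])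
qed

lemma lowN_moment:
  "integrable gauss_prod (\<lambda>\<omega>::int ^ 'd \<Rightarrow> real. lowN N \<omega>)"
  "(\<integral>\<omega>. lowN N \<omega> \<partial>(gauss_prod :: (int ^ 'd \<Rightarrow> real) measure)) = (\<Sum>n\<in>(ball_N N :: (int ^ 'd) set). wt n powr (5/4))"
proof -
  have c: "integrable gauss_prod (\<lambda>\<omega>. (\<omega> n)\<^sup>2) \<and> (\<integral>\<omega>. (\<omega> n)\<^sup>2 \<partial>gauss_prod) = 1" for n :: "int ^ 'd"
    using hermite_covariance[of "{n}" 1 1 "\<lambda>_. 1" "\<lambda>_. 1"] by (simp add: power2_eq_square)
  have eq: "wt n powr (1/4) * (sqrt (wt n) * r)\<^sup>2 = wt n powr (5/4) * r\<^sup>2" for n :: "int ^ 'd" and r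
    using powr_add[of "wt n" "1/4" 1] by (simp add: power_mult_distrib)
  show "integrable gauss_prod (\<lambda>\<omega>::int ^ 'd \<Rightarrow> real. lowN N \<omega>)"
    unfolding lowN_def eq using c by (intro Bochner_Integration.integrable_sum integrable_mult_right) auto
  show "(\<integral>\<omega>. lowN N \<omega> \<partial>(gauss_prod :: (int ^ 'd \<Rightarrow> real) measure)) = (\<Sum>n\<in>(ball_N N :: (int ^ 'd) set). wt n powr (5/4))"
    unfolding lowN_def eq using c by (subst Bochner_Integration.integral_sum) auto
qed

lemma abs_cas3_le:
  "\<bar>cas3 a b c\<bar> \<le> (of_bool (c = a + b) + of_bool (c = a - b) + of_bool (c = b - a) + of_bool (c = - a - b)) / 2"
  unfolding cas3_eq by (auto simp: of_bool_def)

text \<open>The four frequency relations give two sums over \<open>a + b\<close> and two over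
  \<open>a - b\<close>, because the weights are even. Replacing \<open>b\<close> by
  \<open>- b\<close> identifies them, and four copies of \<open>3 * S\<^sup>2\<close> make
  12.\<close>

lemma kap3_le:
  assumes S: "(\<Sum>n\<in>(ball_N N :: (int ^ 'd) set). wt n powr (5/4)) \<le> S"
  shows "kap3 TYPE('d) N \<le> 12 * S\<^sup>2"
proof -
  let ?B = "ball_N N :: (int ^ 'd) set"
  define w where "w n = (if n \<in> ?B then wt n else 0)" for n
  \<comment> \<open>\<open>\<bar>cas3 a b c\<bar>\<close> is at most half the number of matching
    relations and at most 2, so its square is at most that number.\<close>
  have sq: "(cas3 a b c)\<^sup>2 \<le> of_bool (c = a + b) + of_bool (c = a - b) + of_bool (c = b - a) + of_bool (c = - a - b)" for a b c :: "int ^ 'd"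
  proof -
    have "\<bar>cas3 a b c\<bar> \<le> 2" using abs_cas3_le[of a b c] by (auto simp: of_bool_def split: if_splits)
    then have "\<bar>cas3 a b c\<bar> * \<bar>cas3 a b c\<bar> \<le> 2 * \<bar>cas3 a b c\<bar>" by (intro mult_right_mono) auto
    then show ?thesis using abs_cas3_le[of a b c] by (simp add: power2_eq_square)
  qed
  have "(\<Sum>c\<in>?B. wt a * wt b * wt c * (cas3 a b c)\<^sup>2) \<le> wt a * wt b * (2 * w (a + b) + 2 * w (a - b))" for a b
  proof -
    have "(\<Sum>c\<in>?B. wt a * wt b * wt c * (cas3 a b c)\<^sup>2)
      \<le> (\<Sum>c\<in>?B. wt a * wt b * (of_bool (c = a + b) * wt c + of_bool (c = a - b) * wt c + of_bool (c = b - a) * wt c + of_bool (c = - a - b) * wt c))"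
    proof (intro sum_mono)
      fix c
      have "wt a * wt b * wt c * (cas3 a b c)\<^sup>2 \<le> wt a * wt b * wt c * (of_bool (c = a + b) + of_bool (c = a - b) + of_bool (c = b - a) + of_bool (c = - a - b))"
        by (intro mult_left_mono sq) auto
      then show "wt a * wt b * wt c * (cas3 a b c)\<^sup>2 \<le> wt a * wt b * (of_bool (c = a + b) * wt c + of_bool (c = a - b) * wt c + of_bool (c = b - a) * wt c + of_bool (c = - a - b) * wt c)"
        by (simp add: algebra_simps)
    qed
    also have "\<dots> = wt a * wt b * (w (a + b) + w (a - b) + w (b - a) + w (- a - b))"
    proof -
      have "(\<Sum>c\<in>?B. of_bool (c = m) * wt c) = w m" for m
        by (simp add: w_def of_bool_def if_distrib[of "\<lambda>r. r * _"] sum.delta cong: if_cong)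
      then show ?thesis unfolding sum_distrib_left[symmetric] sum.distrib by simp
    qed
    also have "w (b - a) = w (a - b)" using uminus_mem_ball_N[of "a - b" N] wt_minus[of "a - b"] by (simp add: w_def)
    also have "w (- a - b) = w (a + b)" using uminus_mem_ball_N[of "a + b" N] wt_minus[of "a + b"] by (simp add: w_def)
    finally show ?thesis by (simp add: algebra_simps)
  qed
  then have "kap3 TYPE('d) N \<le> (\<Sum>a\<in>?B. \<Sum>b\<in>?B. wt a * wt b * (2 * w (a + b) + 2 * w (a - b)))"
    unfolding kap3_def by (intro sum_mono)
  also have "\<dots> = 2 * (\<Sum>a\<in>?B. \<Sum>b\<in>?B. wt a * wt b * w (a + b)) + 2 * (\<Sum>a\<in>?B. \<Sum>b\<in>?B. wt a * wt b * w (a - b))"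
    by (simp add: sum.distrib sum_distrib_left distrib_left mult_ac)
  also have "(\<Sum>a\<in>?B. \<Sum>b\<in>?B. wt a * wt b * w (a - b)) = (\<Sum>a\<in>?B. \<Sum>b\<in>?B. wt a * wt b * w (a + b))"
    using sum_ball_N_uminus[of "\<lambda>b. wt a * wt b * w (a - b)" N for a] by simp
  also have "(\<Sum>a\<in>?B. \<Sum>b\<in>?B. wt a * wt b * w (a + b)) = (\<Sum>a\<in>?B. \<Sum>b\<in>?B. of_bool (a + b \<in> ?B) * (wt a * wt b * wt (a + b)))"
    by (intro sum.cong refl) (simp add: w_def)
  also have "2 * \<dots> + 2 * \<dots> \<le> 12 * S\<^sup>2" using sum_wt_cubic_le[OF S] by simp
  finally show ?thesis .
qed

lemma kap2_le:
  assumes S: "(\<Sum>n\<in>(ball_N N :: (int ^ 'd) set). wt n powr (5/4)) \<le> S"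
  shows "kap2 TYPE('d) N \<le> S"
proof -
  have "kap2 TYPE('d) N \<le> (\<Sum>n\<in>(ball_N N :: (int ^ 'd) set). wt n powr (5/4))"
    unfolding kap2_def
  proof (intro sum_mono)
    fix n :: "int ^ 'd"
    show "(wt n)\<^sup>2 \<le> wt n powr (5/4)"
      using powr_mono'[of "5/4" 2 "wt n"] by (simp add: powr_numeral)
  qed
  then show ?thesis using S by linarith
qed

lemma kap_mono:
  assumes "M \<le> N"
  shows "kap2 TYPE('d::finite) M \<le> kap2 TYPE('d) N" "kap3 TYPE('d) M \<le> kap3 TYPE('d) N"
proof -
  have sub: "(ball_N M :: (int ^ 'd) set) \<subseteq> ball_N N" by (rule ball_N_mono[OF assms])
  show "kap2 TYPE('d) M \<le> kap2 TYPE('d) N"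
    unfolding kap2_def by (intro sum_mono2 sub) auto
  have "kap3 TYPE('d) M \<le> (\<Sum>a\<in>(ball_N M :: (int ^ 'd) set). \<Sum>b\<in>ball_N N. \<Sum>c\<in>ball_N N. wt a * wt b * wt c * (cas3 a b c)\<^sup>2)"
    unfolding kap3_def
    by (intro sum_mono order_trans[OF sum_mono2[OF _ sub] sum_mono] sum_mono2 sub) (auto intro!: sum_nonneg mult_nonneg_nonneg)
  also have "\<dots> \<le> kap3 TYPE('d) N"
    unfolding kap3_def by (intro sum_mono2 sub) (auto intro!: sum_nonneg mult_nonneg_nonneg)
  finally show "kap3 TYPE('d) M \<le> kap3 TYPE('d) N" .
qed

section \<open>Cameron--Martin shifts\<close>

text \<open>Adding the mirror image collapses the four sign patterns of \<open>cas3\<close> into the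
  single relation \<open>c = a + b\<close>, and it supplies the evenness that the cubic estimate
  uses.\<close>

definition sym_abs :: "nat \<Rightarrow> (int ^ 'd \<Rightarrow> real) \<Rightarrow> int ^ 'd \<Rightarrow> real" where
  "sym_abs N u n = (if n \<in> ball_N N then \<bar>u n\<bar> + \<bar>u (- n)\<bar> else 0)"

lemma sym_abs_minus: "sym_abs N u (- n) = sym_abs N u n"
  by (simp add: sym_abs_def)

lemma sobolev_seq_sym_abs: "sobolev_seq N (sym_abs N u)"
  by standard (auto simp: sym_abs_def)

lemma sum_sym_abs_sq_le:
  fixes u g :: "int ^ 'd \<Rightarrow> real"
  assumes "\<And>n. 0 \<le> g n" "\<And>n. g (- n) = g n"
  shows "(\<Sum>n\<in>ball_N N. g n * (sym_abs N u n)\<^sup>2) \<le> 4 * (\<Sum>n\<in>ball_N N. g n * (u n)\<^sup>2)"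
proof -
  have "(\<Sum>n\<in>ball_N N. g n * (sym_abs N u n)\<^sup>2) \<le> (\<Sum>n\<in>ball_N N. 2 * (g n * (u n)\<^sup>2) + 2 * (g (- n) * (u (- n))\<^sup>2))"
  proof (intro sum_mono)
    fix n :: "int ^ 'd" assume n: "n \<in> ball_N N"
    have "(\<bar>u n\<bar> + \<bar>u (- n)\<bar>)\<^sup>2 \<le> 2 * (u n)\<^sup>2 + 2 * (u (- n))\<^sup>2"
      using sum_squares_bound[of "\<bar>u n\<bar>" "\<bar>u (- n)\<bar>"] by (simp add: power2_sum)
    then have "g n * (\<bar>u n\<bar> + \<bar>u (- n)\<bar>)\<^sup>2 \<le> g n * (2 * (u n)\<^sup>2 + 2 * (u (- n))\<^sup>2)"
      by (intro mult_left_mono assms)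
    then show "g n * (sym_abs N u n)\<^sup>2 \<le> 2 * (g n * (u n)\<^sup>2) + 2 * (g (- n) * (u (- n))\<^sup>2)"
      using n by (simp add: sym_abs_def assms algebra_simps)
  qed
  also have "\<dots> = 4 * (\<Sum>n\<in>ball_N N. g n * (u n)\<^sup>2)"
    using sum_ball_N_uminus[of "\<lambda>n. g n * (u n)\<^sup>2" N] by (simp add: sum.distrib sum_distrib_left[symmetric])
  finally show ?thesis .
qed

lemma lowN_nonneg: "0 \<le> lowN N y" and dualN_nonneg: "0 \<le> dualN N y"
  unfolding dualN_def lowN_def by (auto intro!: sum_nonneg)

definition trig :: "nat \<Rightarrow> (int ^ 'd \<Rightarrow> real) \<Rightarrow> real ^ 'd \<Rightarrow> real" where
  "trig N u x = (\<Sum>n\<in>ball_N N. u n * cas n x)"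

lemma fld_eq_trig: "fld N \<omega> = trig N (\<lambda>n. sqrt (wt n) * \<omega> n)"
  by (simp add: fld_def trig_def fun_eq_iff)

lemma integral_trig_mult: "(\<integral>x. trig N u x * trig N v x \<partial>torus) = (\<Sum>n\<in>ball_N N. u n * v n)"
proof -
  have "(\<integral>x. trig N u x * trig N v x \<partial>torus) = (\<integral>x. (\<Sum>a\<in>ball_N N. \<Sum>b\<in>ball_N N. u a * v b * (cas a x * cas b x)) \<partial>torus)"
    unfolding trig_def sum_product by (intro Bochner_Integration.integral_cong sum.cong refl) (simp add: mult_ac)
  also have "\<dots> = (\<Sum>a\<in>ball_N N. \<Sum>b\<in>ball_N N. u a * v b * of_bool (b = a))"
    unfolding integral_cas_mult[symmetric]
    by (intro has_bochner_integral_integral_eq has_bochner_integral_sum has_bochner_integral_mult_right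
         has_bochner_integral_integrable integrable_torus continuous_intros)
  also have "\<dots> = (\<Sum>n\<in>ball_N N. u n * v n)"
    by (intro sum.cong refl) (simp add: of_bool_def if_distrib sum.delta cong: if_cong)
  finally show ?thesis .
qed

lemma sum_triple_product:
  fixes f g h :: "'a \<Rightarrow> real"
  shows "(\<Sum>a\<in>A. f a) * (\<Sum>b\<in>A. g b) * (\<Sum>c\<in>A. h c) = (\<Sum>a\<in>A. \<Sum>b\<in>A. \<Sum>c\<in>A. f a * g b * h c)"
  by (simp add: sum_distrib_left[symmetric] sum_distrib_right[symmetric] mult.assoc)

text \<open>Opposite frequencies of \<open>w\<close> pair up to \<open>sym_abs N w\<close>, leaving
  \<open>a + b\<close> and \<open>a - b\<close>; negating \<open>b\<close> in the second sum pairs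
  the values of \<open>v\<close> in the same way. The factor 1/2 is that of
  \<open>cas3\<close>.\<close>

lemma trilinear_le:
  fixes u v w :: "int ^ 'd \<Rightarrow> real"
  shows "\<bar>\<integral>x. trig N u x * trig N v x * trig N w x \<partial>torus\<bar>
    \<le> (\<Sum>a\<in>ball_N N. \<Sum>b\<in>ball_N N. sym_abs N u a * sym_abs N v b * sym_abs N w (a + b)) / 2"
proof -
  let ?B = "ball_N N :: (int ^ 'd) set"
  define wz where "wz n = (if n \<in> ?B then \<bar>w n\<bar> else 0)" for n
  have ws: "wz n + wz (- n) = sym_abs N w n" for n by (simp add: wz_def sym_abs_def)
  have s0: "0 \<le> sym_abs N h n" for h :: "int ^ 'd \<Rightarrow> real" and n by (simp add: sym_abs_def)
  have "(\<integral>x. trig N u x * trig N v x * trig N w x \<partial>torus)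
     = (\<integral>x. (\<Sum>a\<in>?B. \<Sum>b\<in>?B. \<Sum>c\<in>?B. u a * v b * w c * (cas a x * cas b x * cas c x)) \<partial>torus)"
    unfolding trig_def sum_triple_product
    by (intro Bochner_Integration.integral_cong sum.cong refl) (simp add: mult_ac)
  also have "\<dots> = (\<Sum>a\<in>?B. \<Sum>b\<in>?B. \<Sum>c\<in>?B. u a * v b * w c * cas3 a b c)"
    unfolding cas3_def
    by (intro has_bochner_integral_integral_eq has_bochner_integral_sum has_bochner_integral_mult_right
         has_bochner_integral_integrable integrable_torus continuous_intros)
  finally have "\<bar>\<integral>x. trig N u x * trig N v x * trig N w x \<partial>torus\<bar> \<le> (\<Sum>a\<in>?B. \<Sum>b\<in>?B. \<Sum>c\<in>?B. \<bar>u a * v b * w c * cas3 a b c\<bar>)"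
    by (auto intro!: order_trans[OF sum_abs] sum_mono)
  also have "\<dots> \<le> (\<Sum>a\<in>?B. \<Sum>b\<in>?B. \<bar>u a\<bar> * (\<bar>v b\<bar> * sym_abs N w (a + b) + \<bar>v b\<bar> * sym_abs N w (a - b)) / 2)"
  proof (intro sum_mono)
    fix a b
    have "(\<Sum>c\<in>?B. \<bar>u a * v b * w c * cas3 a b c\<bar>) \<le> (\<Sum>c\<in>?B. \<bar>u a\<bar> * \<bar>v b\<bar> / 2 *
        (of_bool (c = a + b) * \<bar>w c\<bar> + of_bool (c = a - b) * \<bar>w c\<bar> + of_bool (c = b - a) * \<bar>w c\<bar> + of_bool (c = - a - b) * \<bar>w c\<bar>))"
    proof (intro sum_mono)
      fix c
      have "\<bar>u a * v b * w c * cas3 a b c\<bar> = \<bar>u a\<bar> * \<bar>v b\<bar> * \<bar>w c\<bar> * \<bar>cas3 a b c\<bar>" by (simp add: abs_mult)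
      also have "\<dots> \<le> \<bar>u a\<bar> * \<bar>v b\<bar> * \<bar>w c\<bar> * ((of_bool (c = a + b) + of_bool (c = a - b) + of_bool (c = b - a) + of_bool (c = - a - b)) / 2)"
        by (intro mult_left_mono abs_cas3_le) auto
      finally show "\<bar>u a * v b * w c * cas3 a b c\<bar> \<le> \<bar>u a\<bar> * \<bar>v b\<bar> / 2 *
        (of_bool (c = a + b) * \<bar>w c\<bar> + of_bool (c = a - b) * \<bar>w c\<bar> + of_bool (c = b - a) * \<bar>w c\<bar> + of_bool (c = - a - b) * \<bar>w c\<bar>)"
        by (simp add: algebra_simps)
    qed
    also have "\<dots> = \<bar>u a\<bar> * \<bar>v b\<bar> / 2 * (wz (a + b) + wz (a - b) + wz (b - a) + wz (- a - b))"
    proof -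
      have "(\<Sum>c\<in>?B. of_bool (c = m) * \<bar>w c\<bar>) = wz m" for m
        by (simp add: wz_def of_bool_def if_distrib[of "\<lambda>r. r * _"] sum.delta cong: if_cong)
      then show ?thesis unfolding sum_distrib_left[symmetric] sum.distrib by simp
    qed
    also have "\<dots> = \<bar>u a\<bar> * (\<bar>v b\<bar> * sym_abs N w (a + b) + \<bar>v b\<bar> * sym_abs N w (a - b)) / 2"
      using ws[of "a + b"] ws[of "a - b"] by (simp add: algebra_simps flip: ws)
    finally show "(\<Sum>c\<in>?B. \<bar>u a * v b * w c * cas3 a b c\<bar>) \<le> \<bar>u a\<bar> * (\<bar>v b\<bar> * sym_abs N w (a + b) + \<bar>v b\<bar> * sym_abs N w (a - b)) / 2" .
  qed
  also have "\<dots> = (\<Sum>a\<in>?B. \<bar>u a\<bar> * ((\<Sum>b\<in>?B. \<bar>v b\<bar> * sym_abs N w (a + b)) + (\<Sum>b\<in>?B. \<bar>v b\<bar> * sym_abs N w (a - b)))) / 2"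
    by (simp add: sum_distrib_left sum_divide_distrib sum.distrib[symmetric] distrib_left add_divide_distrib)
  also have "\<dots> = (\<Sum>a\<in>?B. \<bar>u a\<bar> * (\<Sum>b\<in>?B. sym_abs N v b * sym_abs N w (a + b))) / 2"
  proof -
    have "(\<Sum>b\<in>?B. \<bar>v b\<bar> * sym_abs N w (a + b)) + (\<Sum>b\<in>?B. \<bar>v b\<bar> * sym_abs N w (a - b)) = (\<Sum>b\<in>?B. sym_abs N v b * sym_abs N w (a + b))" for a
    proof -
      have "(\<Sum>b\<in>?B. \<bar>v b\<bar> * sym_abs N w (a - b)) = (\<Sum>b\<in>?B. \<bar>v (- b)\<bar> * sym_abs N w (a + b))"
        using sum_ball_N_uminus[of "\<lambda>b. \<bar>v b\<bar> * sym_abs N w (a - b)" N] by simp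
      then have "(\<Sum>b\<in>?B. \<bar>v b\<bar> * sym_abs N w (a + b)) + (\<Sum>b\<in>?B. \<bar>v b\<bar> * sym_abs N w (a - b))
        = (\<Sum>b\<in>?B. \<bar>v b\<bar> * sym_abs N w (a + b) + \<bar>v (- b)\<bar> * sym_abs N w (a + b))" by (simp add: sum.distrib)
      also have "\<dots> = (\<Sum>b\<in>?B. sym_abs N v b * sym_abs N w (a + b))"
        by (intro sum.cong refl) (simp add: sym_abs_def[of N v] distrib_right)
      finally show ?thesis .
    qed
    then show ?thesis by simp
  qed
  also have "\<dots> \<le> (\<Sum>a\<in>?B. sym_abs N u a * (\<Sum>b\<in>?B. sym_abs N v b * sym_abs N w (a + b))) / 2"
    by (intro divide_right_mono sum_mono mult_right_mono sum_nonneg) (auto simp: s0, simp add: sym_abs_def)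
  finally show ?thesis by (simp add: sum_distrib_left mult_ac)
qed

text \<open>A shift \<open>\<theta>\<close> of the Gaussian coordinates moves the field by
  \<open>fld N \<theta>\<close>, with coefficients \<open>sqrt (wt n) * \<theta> n\<close>.
  \<open>Lnorm\<close> is its norm in \<open>L^2\<close>; its norm of order d / 2 is the Euclidean
  norm \<open>Hnorm\<close> of \<open>\<theta>\<close> on the ball.\<close>

definition Lnorm :: "nat \<Rightarrow> (int ^ 'd \<Rightarrow> real) \<Rightarrow> real" where
  "Lnorm N \<theta> = sqrt (\<Sum>n\<in>ball_N N. wt n * (\<theta> n)\<^sup>2)"

definition Hnorm :: "nat \<Rightarrow> (int ^ 'd \<Rightarrow> real) \<Rightarrow> real" where
  "Hnorm N \<theta> = sqrt (\<Sum>n\<in>ball_N N. (\<theta> n)\<^sup>2)"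

lemma Lnorm_nonneg: "0 \<le> Lnorm N \<theta>" and Hnorm_nonneg: "0 \<le> Hnorm N \<theta>"
  unfolding Lnorm_def Hnorm_def by (auto intro!: sum_nonneg)

lemma Lnorm_le_Hnorm: "Lnorm N \<theta> \<le> Hnorm N \<theta>"
  unfolding Lnorm_def Hnorm_def by (intro real_sqrt_le_mono sum_mono) (simp add: mult_left_le_one_le)

lemma sym_abs_norms:
  fixes \<theta> :: "int ^ 'd \<Rightarrow> real" and N :: nat
  defines "t \<equiv> sym_abs N (\<lambda>n. sqrt (wt n) * \<theta> n)"
  shows "sobolev_seq.L N t \<le> 2 * Lnorm N \<theta>" "sobolev_seq.H N t \<le> 2 * Hnorm N \<theta>"
proof -
  interpret sobolev_seq N t unfolding t_def by (rule sobolev_seq_sym_abs)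
  have "L \<le> sqrt (4 * (\<Sum>n\<in>ball_N N. 1 * (sqrt (wt n) * \<theta> n)\<^sup>2))"
    unfolding L_def unfolding t_def
    using sum_sym_abs_sq_le[of "\<lambda>_. 1" N "\<lambda>n. sqrt (wt n) * \<theta> n"] by (intro real_sqrt_le_mono) simp
  then show "L \<le> 2 * Lnorm N \<theta>" by (simp add: Lnorm_def real_sqrt_mult power_mult_distrib)
  have "H \<le> sqrt (4 * (\<Sum>n\<in>ball_N N. (1 / wt n) * (sqrt (wt n) * \<theta> n)\<^sup>2))"
    unfolding H_def unfolding t_def
    using sum_sym_abs_sq_le[of "\<lambda>n. 1 / wt n" N "\<lambda>n. sqrt (wt n) * \<theta> n"] by (intro real_sqrt_le_mono) simp
  then show "H \<le> 2 * Hnorm N \<theta>" by (simp add: Hnorm_def real_sqrt_mult power_mult_distrib)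
qed

lemma integral_fld_cube_le:
  fixes \<theta> :: "int ^ 'd \<Rightarrow> real"
  shows "\<bar>\<integral>x. fld N \<theta> x * fld N \<theta> x * fld N \<theta> x \<partial>torus\<bar> \<le> 12 * sqrt (12 ^ CARD('d)) * ((Lnorm N \<theta>)\<^sup>2 * Hnorm N \<theta>)"
proof -
  let ?u = "\<lambda>n. sqrt (wt n) * \<theta> n"
  interpret sobolev_seq N "sym_abs N ?u" by (rule sobolev_seq_sym_abs)
  have "\<bar>\<integral>x. fld N \<theta> x * fld N \<theta> x * fld N \<theta> x \<partial>torus\<bar> \<le> 3 * (sqrt (12 ^ CARD('d)) * (L\<^sup>2 * H)) / 2"
    using trilinear_le[of N ?u ?u ?u] cubic_sum_le[OF sym_abs_minus] unfolding fld_eq_trig by linarith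
  also have "\<dots> \<le> 3 * (sqrt (12 ^ CARD('d)) * ((2 * Lnorm N \<theta>)\<^sup>2 * (2 * Hnorm N \<theta>))) / 2"
    using sym_abs_norms[of N \<theta>] L_nonneg H_nonneg
    by (intro divide_right_mono mult_left_mono mult_mono power_mono) auto
  finally show ?thesis by (simp add: power_mult_distrib mult_ac)
qed

lemma integral_fld_quadratic_le:
  fixes \<theta> y :: "int ^ 'd \<Rightarrow> real"
  assumes S: "(\<Sum>n\<in>(ball_N N :: (int ^ 'd) set). wt n powr (5/4)) \<le> S"
  shows "\<bar>\<integral>x. fld N \<theta> x * fld N \<theta> x * fld N y x \<partial>torus\<bar>
    \<le> 8 * 2 ^ CARD('d) * sqrt S * (sqrt (lowN N y) * (sqrt (Lnorm N \<theta> * Hnorm N \<theta>) * Hnorm N \<theta>))"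
proof -
  let ?u = "\<lambda>n. sqrt (wt n) * \<theta> n" and ?y = "\<lambda>n. sqrt (wt n) * y n"
  interpret sobolev_seq N "sym_abs N ?u" by (rule sobolev_seq_sym_abs)
  define K where "K = sqrt (\<Sum>n\<in>ball_N N. wt n powr (1/4) * (sym_abs N ?y n)\<^sup>2)"
  have S0: "0 \<le> S" using S by (rule order_trans[rotated]) (auto intro!: sum_nonneg)
  have K: "0 \<le> K" "K \<le> 2 * sqrt (lowN N y)"
  proof -
    have "K \<le> sqrt (4 * lowN N y)"
      unfolding K_def lowN_def using sum_sym_abs_sq_le[of "\<lambda>n. wt n powr (1/4)" N ?y] by (intro real_sqrt_le_mono) simp
    then show "K \<le> 2 * sqrt (lowN N y)" by (simp add: real_sqrt_mult)
    show "0 \<le> K" unfolding K_def by (auto intro!: sum_nonneg)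
  qed
  have "sqrt (L * H) \<le> sqrt ((2 * Lnorm N \<theta>) * (2 * Hnorm N \<theta>))"
    using sym_abs_norms[of N \<theta>] L_nonneg H_nonneg by (intro real_sqrt_le_mono mult_mono) auto
  also have "\<dots> = sqrt (2\<^sup>2 * (Lnorm N \<theta> * Hnorm N \<theta>))" by (simp add: mult_ac)
  also have "\<dots> = 2 * sqrt (Lnorm N \<theta> * Hnorm N \<theta>)" by (simp add: real_sqrt_mult)
  finally have LH: "sqrt (L * H) \<le> 2 * sqrt (Lnorm N \<theta> * Hnorm N \<theta>)" .
  have "\<bar>\<integral>x. fld N \<theta> x * fld N \<theta> x * fld N y x \<partial>torus\<bar> \<le> 2 * (2 ^ CARD('d) * (K * sqrt (L * H)) * (H * sqrt S)) / 2"
    using trilinear_le[of N ?u ?u ?y] quadratic_sum_le[of "sym_abs N ?y", OF _ _ S]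
    unfolding fld_eq_trig K_def by (force simp: sym_abs_def)
  also have "\<dots> \<le> 2 * (2 ^ CARD('d) * ((2 * sqrt (lowN N y)) * (2 * sqrt (Lnorm N \<theta> * Hnorm N \<theta>))) * ((2 * Hnorm N \<theta>) * sqrt S)) / 2"
    using sym_abs_norms[of N \<theta>] L_nonneg H_nonneg LH K S0 lowN_nonneg[of N y]
    by (intro divide_right_mono mult_left_mono mult_mono mult_right_mono mult_nonneg_nonneg) auto
  finally show ?thesis by (simp add: mult_ac)
qed

lemma integral_fld_bilinear_le:
  fixes \<theta> y :: "int ^ 'd \<Rightarrow> real"
  shows "\<bar>\<integral>x. fld N y x * fld N \<theta> x \<partial>torus\<bar> \<le> sqrt (lowN N y) * sqrt (Lnorm N \<theta> * Hnorm N \<theta>)"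
proof -
  define t where "t n = (if n \<in> ball_N N then \<bar>sqrt (wt n) * \<theta> n\<bar> else 0)" for n
  interpret sobolev_seq N t by standard (auto simp: t_def)
  have L: "L = Lnorm N \<theta>" unfolding L_def Lnorm_def t_def
    by (intro arg_cong[where f=sqrt] sum.cong refl) (simp add: power_mult_distrib)
  have H: "H = Hnorm N \<theta>" unfolding H_def Hnorm_def t_def
    by (intro arg_cong[where f=sqrt] sum.cong refl) (simp add: power_mult_distrib)
  have "\<bar>\<integral>x. fld N y x * fld N \<theta> x \<partial>torus\<bar> \<le> (\<Sum>n\<in>ball_N N. \<bar>sqrt (wt n) * y n\<bar> * t n)"
    unfolding fld_eq_trig integral_trig_mult
    by (rule order_trans[OF sum_abs], intro sum_mono) (simp add: t_def abs_mult)
  also have "\<dots> \<le> sqrt (\<Sum>n\<in>ball_N N. wt n powr (1/4) * \<bar>sqrt (wt n) * y n\<bar>\<^sup>2) * sqrt (L * H)"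
    by (rule linear_sum_le)
  also have "(\<Sum>n\<in>ball_N N. wt n powr (1/4) * \<bar>sqrt (wt n) * y n\<bar>\<^sup>2) = lowN N y"
    by (simp add: lowN_def)
  finally show ?thesis unfolding L H .
qed

lemma integral_fld_square: "(\<integral>x. fld N \<theta> x * fld N \<theta> x \<partial>torus) = (Lnorm N \<theta>)\<^sup>2"
  unfolding fld_eq_trig integral_trig_mult Lnorm_def
  by (subst real_sqrt_pow2) (auto intro!: sum_nonneg simp: power2_eq_square[symmetric] power_mult_distrib)

text \<open>Duality between the Sobolev orders -d / 2 and d / 2, applied to the Wick square and the
  shift.\<close>

lemma integral_wick_fld_le:
  fixes \<theta> y :: "int ^ 'd \<Rightarrow> real"
  shows "\<bar>\<integral>x. hermite 2 (sigmaN TYPE('d) N) (fld N y x) * fld N \<theta> x \<partial>torus\<bar> \<le> sqrt (dualN N y) * Hnorm N \<theta>"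
proof -
  define h where "h n = (\<integral>x. hermite 2 (sigmaN TYPE('d) N) (fld N y x) * cas n x \<partial>torus)" for n
  have "(\<integral>x. hermite 2 (sigmaN TYPE('d) N) (fld N y x) * fld N \<theta> x \<partial>torus)
     = (\<integral>x. (\<Sum>n\<in>ball_N N. sqrt (wt n) * \<theta> n * (hermite 2 (sigmaN TYPE('d) N) (fld N y x) * cas n x)) \<partial>torus)"
    unfolding fld_def[of N \<theta>] sum_distrib_left by (intro Bochner_Integration.integral_cong sum.cong refl) (simp add: mult_ac)
  also have "\<dots> = (\<Sum>n\<in>ball_N N. sqrt (wt n) * \<theta> n * h n)"
    unfolding h_def
    by (intro has_bochner_integral_integral_eq has_bochner_integral_sum has_bochner_integral_mult_right
         has_bochner_integral_integrable integrable_torus continuous_intros) simp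
  finally have "\<bar>\<integral>x. hermite 2 (sigmaN TYPE('d) N) (fld N y x) * fld N \<theta> x \<partial>torus\<bar> \<le> (\<Sum>n\<in>ball_N N. \<bar>sqrt (wt n) * h n\<bar> * \<bar>\<theta> n\<bar>)"
    by (auto intro!: order_trans[OF sum_abs] sum_mono simp: abs_mult)
  also have "\<dots> \<le> sqrt (\<Sum>n\<in>ball_N N. \<bar>sqrt (wt n) * h n\<bar>\<^sup>2) * sqrt (\<Sum>n\<in>ball_N N. \<bar>\<theta> n\<bar>\<^sup>2)"
    by (rule sum_mult_le_sqrt)
  also have "\<dots> = sqrt (dualN N y) * Hnorm N \<theta>"
    by (simp add: dualN_def h_def Hnorm_def power_mult_distrib)
  finally show ?thesis .
qed

lemma fld_add: "fld N (\<lambda>n. y n + \<theta> n) x = fld N y x + fld N \<theta> x"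
  by (simp add: fld_def sum.distrib[symmetric] algebra_simps)

lemma cubN_shift:
  fixes \<theta> y :: "int ^ 'd \<Rightarrow> real"
  shows "cubN N (\<lambda>n. y n + \<theta> n) = cubN N y + 3 * (\<integral>x. hermite 2 (sigmaN TYPE('d) N) (fld N y x) * fld N \<theta> x \<partial>torus)
     + 3 * (\<integral>x. fld N \<theta> x * fld N \<theta> x * fld N y x \<partial>torus) + (\<integral>x. fld N \<theta> x * fld N \<theta> x * fld N \<theta> x \<partial>torus)"
proof -
  have eq: "hermite 3 (sigmaN TYPE('d) N) (fld N (\<lambda>n. y n + \<theta> n) x) =
     hermite 3 (sigmaN TYPE('d) N) (fld N y x) + 3 * (hermite 2 (sigmaN TYPE('d) N) (fld N y x) * fld N \<theta> x)
     + 3 * (fld N \<theta> x * fld N \<theta> x * fld N y x) + fld N \<theta> x * fld N \<theta> x * fld N \<theta> x" for x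
    unfolding fld_add hermite_numeral by (simp add: algebra_simps power2_eq_square power3_eq_cube)
  have i: "integrable torus (\<lambda>x. hermite 3 (sigmaN TYPE('d) N) (fld N y x))"
     "integrable torus (\<lambda>x. hermite 2 (sigmaN TYPE('d) N) (fld N y x) * fld N \<theta> x)"
     "integrable torus (\<lambda>x. fld N \<theta> x * fld N \<theta> x * fld N y x)" "integrable torus (\<lambda>x. fld N \<theta> x * fld N \<theta> x * fld N \<theta> x)"
    by (intro integrable_torus continuous_intros; simp)+
  show ?thesis unfolding cubN_def eq using i by simp
qed

lemma sqN_shift:
  fixes \<theta> y :: "int ^ 'd \<Rightarrow> real"
  shows "sqN N (\<lambda>n. y n + \<theta> n) = sqN N y + 2 * (\<integral>x. fld N y x * fld N \<theta> x \<partial>torus) + (Lnorm N \<theta>)\<^sup>2"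
proof -
  have eq: "hermite 2 (sigmaN TYPE('d) N) (fld N (\<lambda>n. y n + \<theta> n) x) =
     hermite 2 (sigmaN TYPE('d) N) (fld N y x) + 2 * (fld N y x * fld N \<theta> x) + fld N \<theta> x * fld N \<theta> x" for x
    unfolding fld_add hermite_numeral by (simp add: algebra_simps power2_eq_square)
  have i: "integrable torus (\<lambda>x. hermite 2 (sigmaN TYPE('d) N) (fld N y x))"
     "integrable torus (\<lambda>x. fld N y x * fld N \<theta> x)" "integrable torus (\<lambda>x. fld N \<theta> x * fld N \<theta> x)"
    by (intro integrable_torus continuous_intros; simp)+
  show ?thesis unfolding sqN_def eq integral_fld_square[symmetric] using i by simp
qed

text \<open>All four summands are squares of norms, so \<open>sizeN N y \<le> k\<^sup>2\<close>
  bounds each norm by \<open>k\<close>; each summand also has an exactly known expectation.\<close>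

definition sizeN :: "nat \<Rightarrow> (int ^ 'd \<Rightarrow> real) \<Rightarrow> real" where
  "sizeN N y = (cubN N y)\<^sup>2 + (sqN N y)\<^sup>2 + dualN N y + lowN N y"

text \<open>
  The values \<open>X\<close>, \<open>Q\<close> which the two Wick integrals can take after a shift \<open>\<theta>\<close> with \<open>Lnorm\<close> equal to \<open>l\<close> and
  Cameron--Martin norm \<open>h\<close> of a point whose norms in \<open>sizeN\<close> are at most \<open>k\<close>.
\<close>

definition shift_region :: "real \<Rightarrow> real \<Rightarrow> real \<Rightarrow> real \<Rightarrow> real \<Rightarrow> real \<Rightarrow> real \<Rightarrow> bool" where
  "shift_region k C1 C2 l h X Q \<longleftrightarrow> 0 \<le> l \<and> l \<le> h
     \<and> \<bar>X\<bar> \<le> k + 3 * (k * h) + 3 * (C2 * (k * (sqrt (l * h) * h))) + C1 * (l\<^sup>2 * h)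
     \<and> \<bar>Q - l\<^sup>2\<bar> \<le> k + 2 * (k * sqrt (l * h))"

lemma shift_region_sizeN:
  fixes \<theta> y :: "int ^ 'd \<Rightarrow> real"
  assumes S: "(\<Sum>n\<in>(ball_N N :: (int ^ 'd) set). wt n powr (5/4)) \<le> S"
    and k: "sizeN N y \<le> k\<^sup>2" "0 \<le> k"
  shows "shift_region k (12 * sqrt (12 ^ CARD('d))) (8 * 2 ^ CARD('d) * sqrt S) (Lnorm N \<theta>) (Hnorm N \<theta>)
    (cubN N (\<lambda>n. y n + \<theta> n)) (sqN N (\<lambda>n. y n + \<theta> n))"
proof -
  define l h where "l = Lnorm N \<theta>" and "h = Hnorm N \<theta>"
  have d0: "0 \<le> dualN N y" "0 \<le> lowN N y" by (rule dualN_nonneg lowN_nonneg)+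
  have S0: "0 \<le> S" using S by (rule order_trans[rotated]) (auto intro!: sum_nonneg)
  have lh: "0 \<le> l" "0 \<le> h" unfolding l_def h_def by (simp_all add: Lnorm_nonneg Hnorm_nonneg)
  have sq: "(cubN N y)\<^sup>2 \<le> k\<^sup>2" "(sqN N y)\<^sup>2 \<le> k\<^sup>2" "dualN N y \<le> k\<^sup>2" "lowN N y \<le> k\<^sup>2"
    using k d0 zero_le_power2[of "cubN N y"] zero_le_power2[of "sqN N y"] unfolding sizeN_def by linarith+
  have c: "\<bar>cubN N y\<bar> \<le> k" "\<bar>sqN N y\<bar> \<le> k" using sq k by (simp_all add: abs_le_square_iff[symmetric])
  have "sqrt (dualN N y) \<le> sqrt (k\<^sup>2)" "sqrt (lowN N y) \<le> sqrt (k\<^sup>2)" using sq by (intro real_sqrt_le_mono; simp)+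
  then have r: "sqrt (dualN N y) \<le> k" "sqrt (lowN N y) \<le> k" using k by simp_all
  have b1: "\<bar>\<integral>x. hermite 2 (sigmaN TYPE('d) N) (fld N y x) * fld N \<theta> x \<partial>torus\<bar> \<le> k * h"
    using integral_wick_fld_le[of N y \<theta>] mult_right_mono[OF r(1) lh(2)] unfolding h_def by linarith
  have b2: "\<bar>\<integral>x. fld N \<theta> x * fld N \<theta> x * fld N y x \<partial>torus\<bar> \<le> 8 * 2 ^ CARD('d) * sqrt S * (k * (sqrt (l * h) * h))"
  proof -
    have "8 * 2 ^ CARD('d) * sqrt S * (sqrt (lowN N y) * (sqrt (l * h) * h)) \<le> 8 * 2 ^ CARD('d) * sqrt S * (k * (sqrt (l * h) * h))"
      using r lh S0 by (intro mult_left_mono mult_right_mono) auto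
    then show ?thesis using integral_fld_quadratic_le[OF S, of \<theta> y] unfolding l_def h_def by linarith
  qed
  have b3: "\<bar>\<integral>x. fld N \<theta> x * fld N \<theta> x * fld N \<theta> x \<partial>torus\<bar> \<le> 12 * sqrt (12 ^ CARD('d)) * (l\<^sup>2 * h)"
    unfolding l_def h_def by (rule integral_fld_cube_le)
  have b5: "\<bar>cubN N (\<lambda>n. y n + \<theta> n)\<bar> \<le> k + 3 * (k * h) + 3 * (8 * 2 ^ CARD('d) * sqrt S * (k * (sqrt (l * h) * h)))
       + 12 * sqrt (12 ^ CARD('d)) * (l\<^sup>2 * h)"
    unfolding cubN_shift using c b1 b2 b3 by (auto simp: abs_le_iff)
  have b4: "\<bar>\<integral>x. fld N y x * fld N \<theta> x \<partial>torus\<bar> \<le> k * sqrt (l * h)"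
    using integral_fld_bilinear_le[of N y \<theta>] mult_right_mono[OF r(2), of "sqrt (l * h)"] lh unfolding l_def h_def by force
  have "\<bar>sqN N (\<lambda>n. y n + \<theta> n) - l\<^sup>2\<bar> \<le> k + 2 * (k * sqrt (l * h))"
    unfolding sqN_shift l_def[symmetric] using c b4 by (auto simp: abs_le_iff)
  then show ?thesis
    using b5 lh(1) Lnorm_le_Hnorm[of N \<theta>] by (simp add: shift_region_def l_def[symmetric] h_def[symmetric])
qed

section \<open>Uniform integrability\<close>

text \<open>Every mixed term is reduced to \<open>h\<^sup>2 / 32\<close>, a multiple of
  \<open>l ^ 4\<close> or a constant. The threshold for \<open>A\<close> comes from the cubic term
  alone and depends on \<open>P\<close>, \<open>\<sigma>\<close> and \<open>C1\<close>; the size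
  \<open>k\<close> of the random data enters \<open>D\<close>.\<close>

lemma tamed_cubic_bound:
  fixes P \<sigma> k C1 C2 :: real
  assumes P: "0 < P" and nn: "0 < \<sigma>" "0 \<le> k" "0 \<le> C1" "0 \<le> C2"
  shows "\<exists>A0>0. \<forall>A\<ge>A0. \<exists>D. \<forall>l h X Q. shift_region k C1 C2 l h X Q \<longrightarrow> P * (\<sigma> / 3 * X - A * Q\<^sup>2) \<le> D + h\<^sup>2 / 4"
proof -
  define a1 a2 a3 where "a1 = P * \<sigma> * k" and "a2 = P * \<sigma> * C2 * k" and "a3 = P * \<sigma> / 3 * C1"
  \<comment> \<open>Half of \<open>P * A * l ^ 4\<close> has to cover
    \<open>8 * a3\<^sup>2 * l ^ 4\<close> from the cubic term and one further \<open>l ^ 4\<close>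
    from absorbing \<open>b * s\<^sup>2\<close>.\<close>
  have A0: "0 < (16 * a3\<^sup>2 + 2) / P" using P by (intro divide_pos_pos) (auto simp: add_nonneg_pos)
  have "\<exists>D. \<forall>l h X Q. shift_region k C1 C2 l h X Q \<longrightarrow> P * (\<sigma> / 3 * X - A * Q\<^sup>2) \<le> D + h\<^sup>2 / 4"
    if A: "(16 * a3\<^sup>2 + 2) / P \<le> A" for A
  proof -
    from A have PA: "16 * a3\<^sup>2 + 2 \<le> P * A" using P by (simp add: field_simps)
    \<comment> \<open>The total coefficient of \<open>s\<^sup>2 = l * h\<close>: the first part
      comes from the term quadratic in the shift, the second from the deviation of \<open>Q\<close>
      from \<open>l\<^sup>2\<close>.\<close>
    define b where "b = 8 * a2\<^sup>2 + 8 * (P * A) * k\<^sup>2"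
    define D where "D = P * \<sigma> / 3 * k + 2 * (P * A) * k\<^sup>2 + 8 * a1\<^sup>2 + 16 * b ^ 4"
    have key: "P * (\<sigma> / 3 * X - A * Q\<^sup>2) \<le> D + h\<^sup>2 / 4"
      if lh: "0 \<le> l" "l \<le> h"
        and X: "\<bar>X\<bar> \<le> k + 3 * (k * h) + 3 * (C2 * (k * (sqrt (l * h) * h))) + C1 * (l\<^sup>2 * h)"
        and Q: "\<bar>Q - l\<^sup>2\<bar> \<le> k + 2 * (k * sqrt (l * h))" for l h X Q
    proof -
      define s where "s = sqrt (l * h)"
      have s: "0 \<le> s" "s\<^sup>2 = l * h" unfolding s_def using lh by auto
      have amgm: "x * y \<le> y\<^sup>2 / 32 + 8 * x\<^sup>2" for x y :: real
        using zero_le_power2[of "y - 16 * x"] by (simp add: power2_eq_square algebra_simps)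
      \<comment> \<open>Nonnegativity of \<open>(l\<^sup>2 + 2 * e)\<^sup>2\<close> keeps half of
        \<open>l ^ 4\<close> whatever the sign of the deviation \<open>e\<close>.\<close>
      have Q2: "l ^ 4 / 2 - 2 * k\<^sup>2 - 8 * (k\<^sup>2 * s\<^sup>2) \<le> Q\<^sup>2"
      proof -
        define e where "e = Q - l\<^sup>2"
        have "0 \<le> (l\<^sup>2 + 2 * e)\<^sup>2" by simp
        then have "l ^ 4 / 2 - e\<^sup>2 \<le> Q\<^sup>2" by (simp add: e_def power2_eq_square algebra_simps power4_eq_xxxx)
        moreover have "e\<^sup>2 \<le> (k + 2 * (k * s))\<^sup>2"
          using Q unfolding e_def[symmetric] s_def[symmetric] by (metis abs_ge_zero power2_abs power_mono)
        moreover have "(k + 2 * (k * s))\<^sup>2 \<le> 2 * k\<^sup>2 + 8 * (k\<^sup>2 * s\<^sup>2)"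
          using zero_le_power2[of "k - 2 * (k * s)"] by (simp add: power2_eq_square algebra_simps)
        ultimately show ?thesis by linarith
      qed
      have "P * (\<sigma> / 3 * X) \<le> P * (\<sigma> / 3 * (k + 3 * (k * h) + 3 * (C2 * (k * (s * h))) + C1 * (l\<^sup>2 * h)))"
        using X P nn unfolding s_def by (intro mult_left_mono) auto
      also have "\<dots> = P * \<sigma> / 3 * k + a1 * h + (a2 * s) * h + (a3 * l\<^sup>2) * h"
        by (simp add: a1_def a2_def a3_def algebra_simps)
      also have "\<dots> \<le> P * \<sigma> / 3 * k + (h\<^sup>2 / 32 + 8 * a1\<^sup>2) + (h\<^sup>2 / 32 + 8 * (a2 * s)\<^sup>2) + (h\<^sup>2 / 32 + 8 * (a3 * l\<^sup>2)\<^sup>2)"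
        by (intro add_mono amgm order_refl)
      finally have 1: "P * (\<sigma> / 3 * X) \<le> P * \<sigma> / 3 * k + 3 * (h\<^sup>2 / 32) + 8 * a1\<^sup>2 + 8 * a2\<^sup>2 * s\<^sup>2 + 8 * a3\<^sup>2 * l ^ 4"
        by (simp add: power_mult_distrib)
      have "0 \<le> P * A" using PA zero_le_power2[of a3] by linarith
      then have 2: "P * A * (l ^ 4 / 2 - 2 * k\<^sup>2 - 8 * (k\<^sup>2 * s\<^sup>2)) \<le> P * A * Q\<^sup>2"
        by (intro mult_left_mono Q2)
      have 3: "b * s\<^sup>2 \<le> h\<^sup>2 / 32 + l ^ 4 + 16 * b ^ 4"
      proof -
        have "b * s\<^sup>2 = (b * l) * h" using s by simp
        also have "\<dots> \<le> h\<^sup>2 / 32 + 8 * (b * l)\<^sup>2" by (rule amgm)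
        also have "8 * (b * l)\<^sup>2 \<le> l ^ 4 + 16 * b ^ 4"
          using zero_le_power2[of "l\<^sup>2 - 4 * b\<^sup>2"] by (simp add: power2_eq_square algebra_simps power4_eq_xxxx)
        finally show ?thesis by simp
      qed
      have 4: "(16 * a3\<^sup>2 + 2) * l ^ 4 \<le> P * A * l ^ 4" using PA by (intro mult_right_mono) auto
      have 5: "b * s\<^sup>2 = 8 * a2\<^sup>2 * s\<^sup>2 + 8 * (P * A) * k\<^sup>2 * s\<^sup>2" by (simp add: b_def distrib_right)
      have "P * (\<sigma> / 3 * X - A * Q\<^sup>2) = P * (\<sigma> / 3 * X) - P * A * Q\<^sup>2" by (simp add: right_diff_distrib)
      also have "\<dots> \<le> (P * \<sigma> / 3 * k + 3 * (h\<^sup>2 / 32) + 8 * a1\<^sup>2 + 8 * a2\<^sup>2 * s\<^sup>2 + 8 * a3\<^sup>2 * l ^ 4)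
          - P * A * (l ^ 4 / 2 - 2 * k\<^sup>2 - 8 * (k\<^sup>2 * s\<^sup>2))"
        using 1 2 by linarith
      also have "\<dots> = P * \<sigma> / 3 * k + 3 * (h\<^sup>2 / 32) + 8 * a1\<^sup>2 + 8 * a3\<^sup>2 * l ^ 4 - P * A * l ^ 4 / 2 + 2 * (P * A) * k\<^sup>2 + b * s\<^sup>2"
        unfolding 5 by (simp add: algebra_simps)
      \<comment> \<open>Four terms \<open>h\<^sup>2 / 32\<close> have been spent, three in
        \<open>1\<close> and one in \<open>3\<close>, which stays within the budget.\<close>
      also have "\<dots> \<le> D + h\<^sup>2 / 4"
        using 3 4[unfolded distrib_right] zero_le_power2[of h] unfolding D_def by linarith
      finally show ?thesis .
    qed
    show ?thesis using key unfolding shift_region_def by blast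
  qed
  then show ?thesis using A0 by blast
qed

text \<open>A single term of the exponential series gives the power, and
  \<open>(h / 2 - 1)\<^sup>2 \<ge> 0\<close> gives
  \<open>1 + h \<le> 2 + h\<^sup>2 / 4\<close>.\<close>

lemma power_le_exp_square:
  fixes h :: real assumes "0 \<le> h"
  shows "(1 + h) ^ m \<le> fact m * exp 2 * exp (h\<^sup>2 / 4)"
proof -
  have "(\<Sum>n\<in>{m}. (1 + h) ^ n /\<^sub>R fact n) \<le> (\<Sum>n. (1 + h) ^ n /\<^sub>R fact n)"
    using assms by (intro sum_le_suminf summable_exp_generic) auto
  then have "(1 + h) ^ m / fact m \<le> exp (1 + h)"
    by (simp add: exp_def divide_inverse mult.commute)
  also have "\<dots> \<le> exp (2 + h\<^sup>2 / 4)"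
    using zero_le_power2[of "h / 2 - 1"] by (simp add: power2_eq_square algebra_simps)
  also have "\<dots> = exp 2 * exp (h\<^sup>2 / 4)" by (rule exp_add)
  finally show ?thesis by (simp add: pos_divide_le_eq mult_ac)
qed

text \<open>The cubic functional grows at most like \<open>h ^ 3\<close> and the squared quadratic
  one like \<open>h ^ 4\<close>. Polynomial growth in the shift yields moments of every order from
  the same concentration inequality.\<close>

lemma polynomial_growth_bound:
  fixes \<sigma> A k C1 C2 :: real
  assumes nn: "0 \<le> k" "0 \<le> C1" "0 \<le> C2"
  shows "\<exists>C>0. \<forall>l h X Q. shift_region k C1 C2 l h X Q \<longrightarrow> \<bar>\<sigma> / 3 * X - A * Q\<^sup>2\<bar> \<le> C * (1 + h) ^ 4"
proof -
  define c1 c2 where "c1 = k + 3 * k + 3 * (C2 * k) + C1" and "c2 = k + 2 * k + 1"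
  have C: "0 < \<bar>\<sigma>\<bar> / 3 * c1 + \<bar>A\<bar> * c2\<^sup>2 + 1"
    unfolding c1_def c2_def using nn by (intro add_nonneg_pos add_nonneg_nonneg mult_nonneg_nonneg) auto
  have "\<bar>\<sigma> / 3 * X - A * Q\<^sup>2\<bar> \<le> (\<bar>\<sigma>\<bar> / 3 * c1 + \<bar>A\<bar> * c2\<^sup>2 + 1) * (1 + h) ^ 4"
    if "shift_region k C1 C2 l h X Q" for l h X Q
  proof -
    have lh: "0 \<le> l" "l \<le> h"
      and X: "\<bar>X\<bar> \<le> k + 3 * (k * h) + 3 * (C2 * (k * (sqrt (l * h) * h))) + C1 * (l\<^sup>2 * h)"
      and Q: "\<bar>Q - l\<^sup>2\<bar> \<le> k + 2 * (k * sqrt (l * h))"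
      using that by (auto simp: shift_region_def)
    have h: "0 \<le> h" using lh by linarith
    have s: "sqrt (l * h) \<le> h"
      using lh h by (intro real_le_lsqrt) (auto simp: power2_eq_square mult_right_mono)
    have s0: "0 \<le> sqrt (l * h)" using lh by simp
    have p: "h ^ j \<le> (1 + h) ^ m" if "j \<le> m" for j m
      using h that by (metis add_increasing le_add_same_cancel2 less_eq_real_def one_le_power order_trans power_increasing power_mono zero_le_one le_add_same_cancel1)
    have l2: "l\<^sup>2 \<le> h\<^sup>2" using lh by (intro power_mono) auto
    have "\<bar>X\<bar> \<le> k * 1 + 3 * (k * h) + 3 * (C2 * (k * (h * h))) + C1 * (h\<^sup>2 * h)"
      using X mult_left_mono[OF mult_left_mono[OF mult_right_mono[OF s h] nn(1)] nn(3)] mult_left_mono[OF mult_right_mono[OF l2 h] nn(2)] by linarith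
    also have "\<dots> \<le> k * (1 + h) ^ 4 + 3 * (k * (1 + h) ^ 4) + 3 * (C2 * (k * (1 + h) ^ 4)) + C1 * (1 + h) ^ 4"
      using p[of 0 4] p[of 1 4] p[of 2 4] p[of 3 4] nn
      by (intro add_mono mult_left_mono) (auto simp: power2_eq_square power3_eq_cube)
    also have "\<dots> = c1 * (1 + h) ^ 4" by (simp add: c1_def algebra_simps)
    finally have X': "\<bar>X\<bar> \<le> c1 * (1 + h) ^ 4" .
    have "\<bar>Q\<bar> \<le> k * 1 + 2 * (k * h) + h\<^sup>2"
      using Q l2 mult_left_mono[OF s nn(1)] zero_le_power2[of l] by linarith
    also have "\<dots> \<le> k * (1 + h) ^ 2 + 2 * (k * (1 + h) ^ 2) + (1 + h) ^ 2"
      using p[of 0 2] p[of 1 2] p[of 2 2] nn by (intro add_mono mult_left_mono) auto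
    also have "\<dots> = c2 * (1 + h) ^ 2" by (simp add: c2_def algebra_simps)
    finally have "\<bar>Q\<bar>\<^sup>2 \<le> (c2 * (1 + h) ^ 2)\<^sup>2" by (intro power_mono) auto
    then have Q': "Q\<^sup>2 \<le> c2\<^sup>2 * (1 + h) ^ 4" by (simp add: power_mult_distrib flip: power_mult)
    have "\<bar>\<sigma> / 3 * X - A * Q\<^sup>2\<bar> \<le> \<bar>\<sigma>\<bar> / 3 * \<bar>X\<bar> + \<bar>A\<bar> * Q\<^sup>2"
      by (rule order_trans[OF abs_triangle_ineq4]) (simp add: abs_mult)
    also have "\<dots> \<le> \<bar>\<sigma>\<bar> / 3 * (c1 * (1 + h) ^ 4) + \<bar>A\<bar> * (c2\<^sup>2 * (1 + h) ^ 4)"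
      by (intro add_mono mult_left_mono X' Q') auto
    also have "\<dots> \<le> (\<bar>\<sigma>\<bar> / 3 * c1 + \<bar>A\<bar> * c2\<^sup>2 + 1) * (1 + h) ^ 4"
      using h by (simp add: algebra_simps)
    finally show ?thesis .
  qed
  then show ?thesis using C by blast
qed

section \<open>Locality and measurability of the functionals, and bounds uniform in the
  truncation\<close>

lemma fld_cong: "(\<And>n. n \<in> ball_N N \<Longrightarrow> x n = y n) \<Longrightarrow> fld N x = fld N y"
  by (auto simp: fld_def fun_eq_iff intro!: sum.cong)

lemma functionals_cong:
  assumes "\<And>n. n \<in> ball_N N \<Longrightarrow> x n = y n"
  shows "cubN N x = cubN N y" "sqN N x = sqN N y" "sizeN N x = sizeN N y" "RN \<sigma> A N x = RN \<sigma> A N y"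
proof -
  show c: "cubN N x = cubN N y" and s: "sqN N x = sqN N y" by (simp_all add: cubN_def sqN_def fld_cong[OF assms])
  have "dualN N x = dualN N y" by (simp add: dualN_def fld_cong[OF assms])
  moreover have "lowN N x = lowN N y" unfolding lowN_def using assms by (intro sum.cong) auto
  ultimately show "sizeN N x = sizeN N y" unfolding sizeN_def c s by simp
  show "RN \<sigma> A N x = RN \<sigma> A N y" unfolding RN_eq c s ..
qed

lemma measurable_integral_torus:
  fixes f :: "('i \<Rightarrow> real) \<Rightarrow> real ^ 'd \<Rightarrow> real"
  assumes "(\<lambda>z. f (fst z) (snd z)) \<in> borel_measurable (gauss_prod \<Otimes>\<^sub>M torus)"
  shows "(\<lambda>\<omega>. \<integral>x. f \<omega> x \<partial>torus) \<in> borel_measurable gauss_prod"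
proof -
  interpret prob_space "torus :: (real ^ 'd) measure" by (rule prob_space_torus)
  show ?thesis using assms by (intro borel_measurable_lebesgue_integral) (simp add: split_beta')
qed

lemma measurable_functionals[measurable]:
  shows "cubN N \<in> borel_measurable gauss_prod" "sqN N \<in> borel_measurable gauss_prod"
    "dualN N \<in> borel_measurable gauss_prod" "lowN N \<in> borel_measurable gauss_prod"
proof -
  have [simp]: "(2::nat) \<le> 3" by simp
  note h = measurable_hermite[OF _ measurable_fld]
  show "cubN N \<in> borel_measurable gauss_prod" "sqN N \<in> borel_measurable gauss_prod"
    unfolding cubN_def sqN_def by (intro measurable_integral_torus h; simp)+
  show "dualN N \<in> borel_measurable gauss_prod"
    unfolding dualN_def
    by (intro borel_measurable_sum borel_measurable_times borel_measurable_power borel_measurable_const measurable_integral_torus h) auto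
  show "lowN N \<in> borel_measurable gauss_prod" unfolding lowN_def by measurable
qed

lemma measurable_sizeN[measurable]: "sizeN N \<in> borel_measurable gauss_prod"
  and measurable_RN[measurable]: "RN \<sigma> A N \<in> borel_measurable gauss_prod"
proof -
  show "sizeN N \<in> borel_measurable gauss_prod" unfolding sizeN_def by measurable
  have eq: "RN \<sigma> A N = (\<lambda>\<omega>. \<sigma> / 3 * cubN N \<omega> - A * (sqN N \<omega>)\<^sup>2)" by (simp add: RN_eq fun_eq_iff)
  show "RN \<sigma> A N \<in> borel_measurable gauss_prod" unfolding eq by measurable
qed

text \<open>
  By Markov's inequality half of the probability lies where all the norms in \<open>sizeN\<close> are bounded
  independently of \<open>N\<close>; this is the set from which the Gaussian concentration inequality starts.
\<close>

lemma sizeN_half: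
  fixes S :: real
  assumes S: "\<And>N. (\<Sum>n\<in>(ball_N N :: (int ^ 'd) set). wt n powr (5/4)) \<le> S" "0 < S"
    and K: "K = 2 * (96 * S\<^sup>2 + 3 * S)"
  shows "ennreal (1 / 2) \<le> emeasure gauss_prod {\<omega> :: int ^ 'd \<Rightarrow> real. sizeN N \<omega> \<le> K}"
proof -
  interpret prob_space "gauss_prod :: (int ^ 'd \<Rightarrow> real) measure" by (rule prob_space_gauss_prod)
  have Kpos: "0 < K" unfolding K using S(2) by (simp add: add_nonneg_pos)
  note c = cubN_moment[OF order_refl, of N, where 'd='d] and q = sqN_moment[OF order_refl, of N, where 'd='d]
  have int: "integrable gauss_prod (sizeN N :: (int ^ 'd \<Rightarrow> real) \<Rightarrow> real)"
    unfolding sizeN_def power2_eq_square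
    by (intro Bochner_Integration.integrable_add c q dualN_moment lowN_moment)
  have "expectation (sizeN N) = 6 * kap3 TYPE('d) N + 2 * kap2 TYPE('d) N + 2 * kap3 TYPE('d) N + (\<Sum>n\<in>(ball_N N :: (int ^ 'd) set). wt n powr (5/4))"
    unfolding sizeN_def power2_eq_square
    using c q dualN_moment[of N, where 'd='d] lowN_moment[of N, where 'd='d] by simp
  \<comment> \<open>\<open>kap3\<close>, at most \<open>12 * S\<^sup>2\<close>, occurs eight times,
    \<open>kap2\<close> twice and the sum of the weights once.\<close>
  also have "\<dots> \<le> 96 * S\<^sup>2 + 3 * S"
    using kap3_le[OF S(1)[of N]] kap2_le[OF S(1)[of N]] S(1)[of N] by linarith
  finally have ex: "expectation (sizeN N) \<le> K / 2" unfolding K by simp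
  have nn: "0 \<le> sizeN N \<omega>" for \<omega> :: "int ^ 'd \<Rightarrow> real" unfolding sizeN_def using lowN_nonneg dualN_nonneg by (intro add_nonneg_nonneg) auto
  have "prob {\<omega> \<in> space gauss_prod. K \<le> sizeN N \<omega>} \<le> expectation (sizeN N) / K"
    using int nn Kpos by (intro integral_Markov_inequality_measure[where A="{}"]) auto
  also have "\<dots> \<le> (K / 2) / K" using ex Kpos by (intro divide_right_mono) auto
  finally have le: "prob {\<omega> \<in> space gauss_prod. K \<le> sizeN N \<omega>} \<le> 1 / 2" using Kpos by simp
  have "{\<omega> \<in> space gauss_prod. sizeN N \<omega> \<le> K} \<in> events" by measurable
  then have [measurable]: "{\<omega>. sizeN N \<omega> \<le> K} \<in> events" by (simp add: space_PiM PiE_def)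
  have "1 - prob {\<omega> \<in> space gauss_prod. K \<le> sizeN N \<omega>} = prob (space gauss_prod - {\<omega> \<in> space gauss_prod. K \<le> sizeN N \<omega>})"
    by (subst prob_compl) auto
  also have "\<dots> \<le> prob {\<omega>. sizeN N \<omega> \<le> K}"
    by (intro finite_measure_mono) (auto simp: space_PiM PiE_def)
  finally have "1 / 2 \<le> prob {\<omega>. sizeN N \<omega> \<le> K}" using le by linarith
  then show ?thesis unfolding emeasure_eq_measure by (rule ennreal_leI)
qed

text \<open>Serves both exponentials and powers of the interaction. The shift is the difference
  between an arbitrary point and a point of the good set, so a deterministic bound on
  \<open>shift_region\<close> is all that has to be supplied.\<close>

lemma concentration_uniform:
  fixes S D \<sigma> A :: real
  assumes S: "\<And>N. (\<Sum>n\<in>(ball_N N :: (int ^ 'd) set). wt n powr (5/4)) \<le> S" "0 < S"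
    and f[measurable]: "f \<in> borel_measurable borel" and D: "0 < D"
    and bound: "\<And>l h X Q. shift_region (sqrt (2 * (96 * S\<^sup>2 + 3 * S))) (12 * sqrt (12 ^ CARD('d))) (8 * 2 ^ CARD('d) * sqrt S) l h X Q
       \<Longrightarrow> f (\<sigma> / 3 * X - A * Q\<^sup>2) \<le> D * exp (h\<^sup>2 / 4)"
  shows "(\<integral>\<^sup>+\<omega>. ennreal (f (RN \<sigma> A N \<omega>)) \<partial>(gauss_prod :: (int ^ 'd \<Rightarrow> real) measure)) \<le> ennreal (2 * D)"
proof (rule gaussian_concentration[where I="ball_N N" and E="{\<omega>. sizeN N \<omega> \<le> 2 * (96 * S\<^sup>2 + 3 * S)}"])
  let ?K = "2 * (96 * S\<^sup>2 + 3 * S)"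
  have K0: "0 \<le> ?K" using S(2) by simp
  show "(\<lambda>\<omega>. f (RN \<sigma> A N \<omega>)) \<in> borel_measurable gauss_prod" by measurable
  have "{\<omega> \<in> space gauss_prod. sizeN N \<omega> \<le> ?K} \<in> sets gauss_prod" by measurable
  then show "{\<omega>. sizeN N \<omega> \<le> ?K} \<in> sets gauss_prod" by (simp add: space_PiM PiE_def)
  fix x y :: "int ^ 'd \<Rightarrow> real"
  show "f (RN \<sigma> A N x) = f (RN \<sigma> A N y)" if "\<And>i. i \<in> ball_N N \<Longrightarrow> x i = y i"
    using functionals_cong(4)[of N x y] that by metis
  show "(x \<in> {\<omega>. sizeN N \<omega> \<le> ?K}) = (y \<in> {\<omega>. sizeN N \<omega> \<le> ?K})" if "\<And>i. i \<in> ball_N N \<Longrightarrow> x i = y i"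
    using functionals_cong(3)[of N x y] that by simp
  show "f (RN \<sigma> A N x) \<le> D * exp ((\<Sum>i\<in>ball_N N. (x i - y i)\<^sup>2) / 4)" if "y \<in> {\<omega>. sizeN N \<omega> \<le> ?K}"
  proof -
    define \<theta> where "\<theta> n = x n - y n" for n
    have x: "x = (\<lambda>n. y n + \<theta> n)" by (simp add: \<theta>_def)
    have k: "sizeN N y \<le> (sqrt ?K)\<^sup>2" "0 \<le> sqrt ?K" using that K0 by auto
    have "f (RN \<sigma> A N x) \<le> D * exp ((Hnorm N \<theta>)\<^sup>2 / 4)"
      unfolding RN_eq x by (rule bound[OF shift_region_sizeN[OF S(1) k]])
    also have "(Hnorm N \<theta>)\<^sup>2 = (\<Sum>i\<in>ball_N N. (x i - y i)\<^sup>2)"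
      unfolding Hnorm_def by (subst real_sqrt_pow2) (auto intro!: sum_nonneg simp: \<theta>_def)
    finally show ?thesis .
  qed
  show "ennreal (1 / 2) \<le> emeasure gauss_prod {\<omega> :: int ^ 'd \<Rightarrow> real. sizeN N \<omega> \<le> ?K}"
    by (rule sizeN_half[OF S refl])
qed (use D in auto)

lemma exp_RN_uniformly_bounded:
  fixes P \<sigma> :: real
  assumes P: "0 < P" and \<sigma>: "0 < \<sigma>"
  shows "\<exists>A0>0. \<forall>A\<ge>A0. \<exists>C>0. \<forall>N.
     (\<integral>\<^sup>+\<omega>. ennreal (exp (P * RN \<sigma> A N \<omega>)) \<partial>(gauss_prod :: (int ^ 'd \<Rightarrow> real) measure)) \<le> ennreal C"
proof -
  obtain S where S: "0 < S" "\<And>N. (\<Sum>n\<in>(ball_N N :: (int ^ 'd) set). wt n powr (5/4)) \<le> S"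
    using sum_wt_powr_bounded[where 'd='d] by blast
  let ?k = "sqrt (2 * (96 * S\<^sup>2 + 3 * S))"
  have k0: "0 \<le> ?k" using S by simp
  have "\<exists>A0>0. \<forall>A\<ge>A0. \<exists>D. \<forall>l h X Q. shift_region ?k (12 * sqrt (12 ^ CARD('d))) (8 * 2 ^ CARD('d) * sqrt S) l h X Q \<longrightarrow> P * (\<sigma> / 3 * X - A * Q\<^sup>2) \<le> D + h\<^sup>2 / 4"
    using S by (intro tamed_cubic_bound P \<sigma> k0) auto
  then obtain A0 where A0: "0 < A0" and
    tame: "\<And>A. A0 \<le> A \<Longrightarrow> \<exists>D. \<forall>l h X Q. shift_region ?k (12 * sqrt (12 ^ CARD('d))) (8 * 2 ^ CARD('d) * sqrt S) l h X Q \<longrightarrow> P * (\<sigma> / 3 * X - A * Q\<^sup>2) \<le> D + h\<^sup>2 / 4"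
    by blast
  have "\<exists>C>0. \<forall>N. (\<integral>\<^sup>+\<omega>. ennreal (exp (P * RN \<sigma> A N \<omega>)) \<partial>(gauss_prod :: (int ^ 'd \<Rightarrow> real) measure)) \<le> ennreal C"
    if A: "A0 \<le> A" for A
  proof -
    obtain D where D: "\<And>l h X Q. shift_region ?k (12 * sqrt (12 ^ CARD('d))) (8 * 2 ^ CARD('d) * sqrt S) l h X Q \<Longrightarrow> P * (\<sigma> / 3 * X - A * Q\<^sup>2) \<le> D + h\<^sup>2 / 4"
      using tame[OF A] by blast
    have "(\<integral>\<^sup>+\<omega>. ennreal (exp (P * RN \<sigma> A N \<omega>)) \<partial>(gauss_prod :: (int ^ 'd \<Rightarrow> real) measure)) \<le> ennreal (2 * exp D)" for N
    proof (rule concentration_uniform[OF S(2,1), where f="\<lambda>r. exp (P * r)"])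
      fix l h X Q :: real
      assume "shift_region ?k (12 * sqrt (12 ^ CARD('d))) (8 * 2 ^ CARD('d) * sqrt S) l h X Q"
      from D[OF this] show "exp (P * (\<sigma> / 3 * X - A * Q\<^sup>2)) \<le> exp D * exp (h\<^sup>2 / 4)" by (simp add: mult_exp_exp)
    qed auto
    then show ?thesis by (intro exI[of _ "2 * exp D"]) auto
  qed
  then show ?thesis using A0 by blast
qed

lemma moments_RN_uniformly_bounded:
  fixes \<sigma> A :: real and m :: nat
  shows "\<exists>C>0. \<forall>N. (\<integral>\<^sup>+\<omega>. ennreal (\<bar>RN \<sigma> A N \<omega>\<bar> ^ m) \<partial>(gauss_prod :: (int ^ 'd \<Rightarrow> real) measure)) \<le> ennreal C"
proof -
  obtain S where S: "0 < S" "\<And>N. (\<Sum>n\<in>(ball_N N :: (int ^ 'd) set). wt n powr (5/4)) \<le> S"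
    using sum_wt_powr_bounded[where 'd='d] by blast
  let ?k = "sqrt (2 * (96 * S\<^sup>2 + 3 * S))"
  have k0: "0 \<le> ?k" using S by simp
  have "\<exists>C>0. \<forall>l h X Q. shift_region ?k (12 * sqrt (12 ^ CARD('d))) (8 * 2 ^ CARD('d) * sqrt S) l h X Q \<longrightarrow> \<bar>\<sigma> / 3 * X - A * Q\<^sup>2\<bar> \<le> C * (1 + h) ^ 4"
    using S by (intro polynomial_growth_bound k0) auto
  then obtain C where C: "0 < C" and
    poly: "\<And>l h X Q. shift_region ?k (12 * sqrt (12 ^ CARD('d))) (8 * 2 ^ CARD('d) * sqrt S) l h X Q \<Longrightarrow> \<bar>\<sigma> / 3 * X - A * Q\<^sup>2\<bar> \<le> C * (1 + h) ^ 4"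
    by blast
  define D where "D = C ^ m * (fact (4 * m) * exp 2)"
  have D: "0 < D" unfolding D_def using C by simp
  have "(\<integral>\<^sup>+\<omega>. ennreal (\<bar>RN \<sigma> A N \<omega>\<bar> ^ m) \<partial>(gauss_prod :: (int ^ 'd \<Rightarrow> real) measure)) \<le> ennreal (2 * D)" for N
  proof (rule concentration_uniform[OF S(2,1), where f="\<lambda>r. \<bar>r\<bar> ^ m"])
    fix l h X Q :: real
    assume as: "shift_region ?k (12 * sqrt (12 ^ CARD('d))) (8 * 2 ^ CARD('d) * sqrt S) l h X Q"
    have h: "0 \<le> h" using as by (auto simp: shift_region_def)
    have "\<bar>\<sigma> / 3 * X - A * Q\<^sup>2\<bar> ^ m \<le> (C * (1 + h) ^ 4) ^ m" by (intro power_mono poly[OF as]) auto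
    also have "\<dots> = C ^ m * (1 + h) ^ (4 * m)" by (simp add: power_mult_distrib power_mult)
    also have "\<dots> \<le> C ^ m * (fact (4 * m) * exp 2 * exp (h\<^sup>2 / 4))"
      using C by (intro mult_left_mono power_le_exp_square h) auto
    finally show "\<bar>\<sigma> / 3 * X - A * Q\<^sup>2\<bar> ^ m \<le> D * exp (h\<^sup>2 / 4)" by (simp add: D_def mult_ac)
  qed (use D in auto)
  then show ?thesis using D by (intro exI[of _ "2 * D"]) auto
qed

section \<open>Convergence of Gibbs densities\<close>

text \<open>Real bounds that hold eventually carry finiteness with them. This matters for norms
  defined through \<open>enn2real\<close>, which sends infinity to 0.\<close>

definition small :: "(nat \<Rightarrow> ennreal) \<Rightarrow> bool" where
  "small a \<longleftrightarrow> (\<forall>e>0. \<exists>N0. \<forall>N\<ge>N0. a N \<le> ennreal e)"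

lemma smallD: "small a \<Longrightarrow> 0 < e \<Longrightarrow> \<exists>N0. \<forall>N\<ge>N0. a N \<le> ennreal e"
  by (simp add: small_def)

lemma small_tendsto:
  assumes "small a" shows "(\<lambda>N. enn2real (a N)) \<longlonglongrightarrow> 0"
proof (rule LIMSEQ_I)
  fix r :: real assume r: "0 < r"
  then obtain N0 where N0: "\<And>N. N \<ge> N0 \<Longrightarrow> a N \<le> ennreal (r / 2)" using smallD[OF assms, of "r / 2"] by auto
  have "norm (enn2real (a N) - 0) < r" if "N \<ge> N0" for N
  proof -
    have "enn2real (a N) \<le> r / 2" using N0[OF that] r by (intro enn2real_leI) auto
    then show ?thesis using r enn2real_nonneg[of "a N"] by simp
  qed
  then show "\<exists>no. \<forall>n\<ge>no. norm (enn2real (a n) - 0) < r" by blast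
qed

lemma Lp_norm_tendsto_0:
  assumes "small (\<lambda>N. \<integral>\<^sup>+x. ennreal (\<bar>h N x\<bar> powr p) \<partial>M)" "0 < p"
  shows "(\<lambda>N. Lp_norm M p (h N)) \<longlonglongrightarrow> 0"
  unfolding Lp_norm_def using assms
  by (intro tendsto_zero_powrI[OF small_tendsto[OF assms(1)] tendsto_const]) auto

text \<open>Transfers bounds to an almost sure limit. They are asked for from \<open>i0\<close> on,
  since Cauchy estimates hold for late indices.\<close>

lemma nn_integral_fatou:
  fixes f :: "nat \<Rightarrow> 'a \<Rightarrow> real"
  assumes [measurable]: "\<And>i. f i \<in> borel_measurable M" "g \<in> borel_measurable M"
    and lim: "AE x in M. (\<lambda>i. f i x) \<longlonglongrightarrow> g x"
    and bound: "\<And>i. i \<ge> i0 \<Longrightarrow> (\<integral>\<^sup>+x. ennreal (f i x) \<partial>M) \<le> C"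
  shows "(\<integral>\<^sup>+x. ennreal (g x) \<partial>M) \<le> C"
proof -
  have "(\<integral>\<^sup>+x. ennreal (g x) \<partial>M) = (\<integral>\<^sup>+x. liminf (\<lambda>i. ennreal (f i x)) \<partial>M)"
  proof (intro nn_integral_cong_AE)
    show "AE x in M. ennreal (g x) = liminf (\<lambda>i. ennreal (f i x))"
      using lim
    proof (rule AE_mp, intro AE_I2 impI)
      fix x assume "(\<lambda>i. f i x) \<longlonglongrightarrow> g x"
      then have "(\<lambda>i. ennreal (f i x)) \<longlonglongrightarrow> ennreal (g x)" by (rule tendsto_ennrealI)
      then show "ennreal (g x) = liminf (\<lambda>i. ennreal (f i x))"
        by (rule lim_imp_Liminf[OF sequentially_bot, symmetric])
    qed
  qed
  also have "\<dots> \<le> liminf (\<lambda>i. \<integral>\<^sup>+x. ennreal (f i x) \<partial>M)" by (rule nn_integral_liminf) measurable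
  also have "\<dots> \<le> limsup (\<lambda>i. \<integral>\<^sup>+x. ennreal (f i x) \<partial>M)" by (rule Liminf_le_Limsup) simp
  also have "\<dots> \<le> C" using bound by (intro Limsup_bounded) (auto simp: eventually_sequentially)
  finally show ?thesis .
qed

lemma young_delta:
  fixes x y \<delta> :: real assumes "0 < \<delta>" shows "x * y \<le> \<delta> * y\<^sup>2 + 1 / (4 * \<delta>) * x\<^sup>2"
proof -
  have "0 \<le> (2 * \<delta> * y - x)\<^sup>2 / (4 * \<delta>)" using assms by simp
  also have "\<dots> = \<delta> * y\<^sup>2 + 1 / (4 * \<delta>) * x\<^sup>2 - x * y"
    using assms by (simp add: power2_eq_square field_simps)
  finally show ?thesis by simp
qed

lemma divide_double_mult: "0 < c \<Longrightarrow> e / (2 * c) * c = e / 2" for c e :: real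
  by simp

text \<open>Write \<open>x powr p\<close> as \<open>x powr (1/2)\<close> times
  \<open>x powr (p - 1/2)\<close> and apply Young's inequality with parameter; the second square,
  \<open>x powr (2 * p - 1)\<close>, is at most \<open>1 + x powr (2 * p)\<close>. Smallness in
  \<open>L^1\<close> thus passes to \<open>L^p\<close> under a bound in \<open>L^2p\<close>.\<close>

lemma powr_interpolation:
  fixes x p \<delta> :: real
  assumes "0 \<le> x" "1 \<le> p" "0 < \<delta>"
  shows "x powr p \<le> \<delta> * (1 + x powr (2 * p)) + 1 / (4 * \<delta>) * x"
proof (cases "x = 0")
  case True then show ?thesis using assms by simp
next
  case False
  then have x: "0 < x" using assms by simp
  define u v where "u = x powr (1/2)" and "v = x powr (p - 1/2)"
  have uv: "x powr p = u * v" "u\<^sup>2 = x" "v\<^sup>2 = x powr (2 * p - 1)"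
    using x powr_add[of x "1/2" "p - 1/2"] by (simp_all add: u_def v_def powr_power right_diff_distrib)
  have "v\<^sup>2 \<le> 1 + x powr (2 * p)"
  proof (cases "x \<le> 1")
    case True
    have "x powr (2 * p - 1) \<le> 1" using True x assms by (intro powr_le1) auto
    then show ?thesis unfolding uv using powr_ge_zero[of x "2 * p"] by linarith
  next
    case False
    have "x powr (2 * p - 1) \<le> x powr (2 * p)" using False by (intro powr_mono) auto
    then show ?thesis unfolding uv by linarith
  qed
  then have "\<delta> * v\<^sup>2 \<le> \<delta> * (1 + x powr (2 * p))" using assms by (intro mult_left_mono) auto
  moreover have "u * v \<le> \<delta> * v\<^sup>2 + 1 / (4 * \<delta>) * x"
    using young_delta[OF assms(3), of u v] unfolding uv(2) .
  ultimately show ?thesis unfolding uv(1) by linarith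
qed

lemma small_interpolation:
  fixes h :: "nat \<Rightarrow> 'a \<Rightarrow> real"
  assumes "prob_space M" and [measurable]: "\<And>N. h N \<in> borel_measurable M"
    and sm: "small (\<lambda>N. \<integral>\<^sup>+x. ennreal \<bar>h N x\<bar> \<partial>M)"
    and bd: "\<And>N. (\<integral>\<^sup>+x. ennreal (\<bar>h N x\<bar> powr (2 * p)) \<partial>M) \<le> ennreal C" and p: "1 \<le> p" and C: "0 \<le> C"
  shows "small (\<lambda>N. \<integral>\<^sup>+x. ennreal (\<bar>h N x\<bar> powr p) \<partial>M)"
  unfolding small_def
proof (intro allI impI)
  interpret prob_space M by fact
  fix e :: real assume e: "0 < e"
  \<comment> \<open>The bounded part then contributes \<open>\<delta> * (1 + C) = e / 2\<close>, and
    an \<open>L^1\<close> norm below \<open>2 * \<delta> * e\<close> contributes the other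
    half.\<close>
  define \<delta> where "\<delta> = e / (2 * (1 + C))"
  have \<delta>: "0 < \<delta>" unfolding \<delta>_def using e C by simp
  obtain N0 where N0: "\<And>N. N \<ge> N0 \<Longrightarrow> (\<integral>\<^sup>+x. ennreal \<bar>h N x\<bar> \<partial>M) \<le> ennreal (2 * \<delta> * e)"
    using smallD[OF sm, of "2 * \<delta> * e"] \<delta> e by auto
  have "(\<integral>\<^sup>+x. ennreal (\<bar>h N x\<bar> powr p) \<partial>M) \<le> ennreal e" if N: "N \<ge> N0" for N
  proof -
    have "(\<integral>\<^sup>+x. ennreal (\<bar>h N x\<bar> powr p) \<partial>M)
      \<le> (\<integral>\<^sup>+x. ennreal \<delta> * (1 + ennreal (\<bar>h N x\<bar> powr (2 * p))) + ennreal (1 / (4 * \<delta>)) * ennreal \<bar>h N x\<bar> \<partial>M)"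
    proof (intro nn_integral_mono)
      fix x
      have "ennreal (\<bar>h N x\<bar> powr p) \<le> ennreal (\<delta> * (1 + \<bar>h N x\<bar> powr (2 * p)) + 1 / (4 * \<delta>) * \<bar>h N x\<bar>)"
        using powr_interpolation[of "\<bar>h N x\<bar>" p \<delta>] p \<delta> by (intro ennreal_leI) auto
      also have "\<dots> = ennreal \<delta> * (1 + ennreal (\<bar>h N x\<bar> powr (2 * p))) + ennreal (1 / (4 * \<delta>)) * ennreal \<bar>h N x\<bar>"
        using \<delta> by (simp add: ennreal_plus[symmetric] ennreal_mult'[symmetric] ennreal_1[symmetric] del: ennreal_plus ennreal_1)
      finally show "ennreal (\<bar>h N x\<bar> powr p) \<le> ennreal \<delta> * (1 + ennreal (\<bar>h N x\<bar> powr (2 * p))) + ennreal (1 / (4 * \<delta>)) * ennreal \<bar>h N x\<bar>" .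
    qed
    also have "\<dots> = ennreal \<delta> * (1 + (\<integral>\<^sup>+x. ennreal (\<bar>h N x\<bar> powr (2 * p)) \<partial>M)) + ennreal (1 / (4 * \<delta>)) * (\<integral>\<^sup>+x. ennreal \<bar>h N x\<bar> \<partial>M)"
      by (simp add: nn_integral_add nn_integral_cmult emeasure_space_1)
    also have "\<dots> \<le> ennreal \<delta> * (1 + ennreal C) + ennreal (1 / (4 * \<delta>)) * ennreal (2 * \<delta> * e)"
      by (intro add_mono mult_left_mono bd N0[OF N]) auto
    also have "\<dots> = ennreal (\<delta> * (1 + C) + 1 / (4 * \<delta>) * (2 * \<delta> * e))"
      using \<delta> C e by (simp add: ennreal_plus[symmetric] ennreal_mult'[symmetric] ennreal_1[symmetric] del: ennreal_plus ennreal_1)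
    also have "\<delta> * (1 + C) = e / 2" unfolding \<delta>_def using C by (intro divide_double_mult) auto
    also have "1 / (4 * \<delta>) * (2 * \<delta> * e) = e / 2" using \<delta> by simp
    also have "e / 2 + e / 2 = e" by simp
    finally show ?thesis .
  qed
  then show "\<exists>N0. \<forall>N\<ge>N0. (\<integral>\<^sup>+x. ennreal (\<bar>h N x\<bar> powr p) \<partial>M) \<le> ennreal e" by blast
qed

lemma powr_le_1_add_power:
  fixes x :: real assumes "0 \<le> x" "0 \<le> q" "q \<le> real m" shows "x powr q \<le> 1 + x ^ m"
proof (cases "x \<le> 1")
  case True
  have "x powr q \<le> 1" using True assms by (intro powr_le1) auto
  then show ?thesis using zero_le_power[OF assms(1), of m] by linarith
next
  case False
  have "x powr q \<le> x powr real m" using False assms by (intro powr_mono) auto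
  then show ?thesis using False by (simp add: powr_realpow)
qed

lemma abs_diff_powr_le:
  fixes a b q :: real assumes "0 \<le> q" "q \<le> real m"
  shows "\<bar>a - b\<bar> powr q \<le> 1 + 2 ^ m * (\<bar>a\<bar> ^ m + \<bar>b\<bar> ^ m)"
proof -
  have "\<bar>a - b\<bar> powr q \<le> 1 + \<bar>a - b\<bar> ^ m" using assms by (intro powr_le_1_add_power) auto
  also have "\<bar>a - b\<bar> ^ m \<le> (2 * max \<bar>a\<bar> \<bar>b\<bar>) ^ m" by (intro power_mono) auto
  also have "\<dots> \<le> 2 ^ m * (\<bar>a\<bar> ^ m + \<bar>b\<bar> ^ m)"
    unfolding power_mult_distrib by (intro mult_left_mono) (auto simp: max_def)
  finally show ?thesis by simp
qed

text \<open>The tangent inequality \<open>1 + x \<le> exp x\<close>, used at the larger of the two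
  arguments.\<close>

lemma abs_exp_diff_le: "\<bar>exp a - exp b\<bar> \<le> \<bar>a - b\<bar> * (exp a + exp b)" for a b :: real
proof -
  have *: "exp y - exp x \<le> (y - x) * exp y" for x y :: real
  proof -
    have "1 + (x - y) \<le> exp (x - y)" by (rule exp_ge_add_one_self)
    then have "(1 + (x - y)) * exp y \<le> exp (x - y) * exp y" by (intro mult_right_mono) auto
    also have "exp (x - y) * exp y = exp x" by (simp add: mult_exp_exp)
    finally show ?thesis by (simp add: algebra_simps)
  qed
  show ?thesis
  proof (cases "a \<le> b")
    case True
    have "\<bar>exp a - exp b\<bar> \<le> (b - a) * exp b" using *[of b a] True by simp
    also have "\<dots> \<le> (b - a) * (exp a + exp b)" using True by (intro mult_left_mono) auto
    finally show ?thesis using True by simp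
  next
    case False
    have "\<bar>exp a - exp b\<bar> \<le> (a - b) * exp a" using *[of a b] False by simp
    also have "\<dots> \<le> (a - b) * (exp a + exp b)" using False by (intro mult_left_mono) auto
    finally show ?thesis using False by simp
  qed
qed

lemma abs_exp_diff_powr_le:
  fixes a b q :: real assumes "0 \<le> q" shows "\<bar>exp a - exp b\<bar> powr q \<le> exp (q * a) + exp (q * b)"
proof -
  have "\<bar>exp a - exp b\<bar> \<le> exp (max a b)" by (smt (verit) exp_gt_zero exp_le_cancel_iff max_def)
  then have "\<bar>exp a - exp b\<bar> powr q \<le> exp (max a b) powr q" using assms by (intro powr_mono2) auto
  also have "\<dots> = exp (q * max a b)" by (simp add: powr_def)
  also have "\<dots> \<le> exp (q * a) + exp (q * b)" by (auto simp: max_def add_increasing add_increasing2)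
  finally show ?thesis .
qed

lemma small_of_bound:
  assumes "\<And>N. a N \<le> ennreal (b N)" "b \<longlonglongrightarrow> 0" shows "small a"
  unfolding small_def
proof (intro allI impI)
  fix e :: real assume "0 < e"
  then obtain N0 where N0: "\<And>N. N \<ge> N0 \<Longrightarrow> \<bar>b N\<bar> < e" using LIMSEQ_D[OF assms(2), of e] by auto
  have "a N \<le> ennreal e" if "N \<ge> N0" for N
    using assms(1)[of N] N0[OF that] by (intro order_trans[OF assms(1) ennreal_leI]) auto
  then show "\<exists>N0. \<forall>N\<ge>N0. a N \<le> ennreal e" by blast
qed

lemma nn_integral_affine_bound:
  fixes u v :: "'a \<Rightarrow> real"
  assumes "prob_space M" and [measurable]: "u \<in> borel_measurable M" "v \<in> borel_measurable M"
    and nn: "\<And>x. 0 \<le> u x" "\<And>x. 0 \<le> v x" "0 \<le> a" "0 \<le> b" "0 \<le> c" "0 \<le> U" "0 \<le> V"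
    and U: "(\<integral>\<^sup>+x. ennreal (u x) \<partial>M) \<le> ennreal U" and V: "(\<integral>\<^sup>+x. ennreal (v x) \<partial>M) \<le> ennreal V"
    and le: "\<And>x. f x \<le> a + b * u x + c * v x"
  shows "(\<integral>\<^sup>+x. ennreal (f x) \<partial>M) \<le> ennreal (a + b * U + c * V)"
proof -
  interpret prob_space M by fact
  have "(\<integral>\<^sup>+x. ennreal (f x) \<partial>M) \<le> (\<integral>\<^sup>+x. ennreal a + ennreal b * ennreal (u x) + ennreal c * ennreal (v x) \<partial>M)"
  proof (intro nn_integral_mono)
    fix x
    have "ennreal (f x) \<le> ennreal (a + b * u x + c * v x)" by (intro ennreal_leI le)
    also have "\<dots> = ennreal a + ennreal b * ennreal (u x) + ennreal c * ennreal (v x)"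
      using nn by (simp add: ennreal_plus[symmetric] ennreal_mult'[symmetric] del: ennreal_plus)
    finally show "ennreal (f x) \<le> ennreal a + ennreal b * ennreal (u x) + ennreal c * ennreal (v x)" .
  qed
  also have "\<dots> = ennreal a + ennreal b * (\<integral>\<^sup>+x. ennreal (u x) \<partial>M) + ennreal c * (\<integral>\<^sup>+x. ennreal (v x) \<partial>M)"
    by (simp add: nn_integral_add nn_integral_cmult emeasure_space_1)
  also have "\<dots> \<le> ennreal a + ennreal b * ennreal U + ennreal c * ennreal V"
    by (intro add_mono mult_left_mono U V) auto
  also have "\<dots> = ennreal (a + b * U + c * V)"
    using nn by (simp add: ennreal_plus[symmetric] ennreal_mult'[symmetric] del: ennreal_plus)
  finally show ?thesis .
qed

lemma add_powr_le:
  fixes a b p :: real assumes "0 \<le> a" "0 \<le> b" "0 \<le> p"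
  shows "(a + b) powr p \<le> 2 powr p * (a powr p + b powr p)"
proof -
  have "(a + b) powr p \<le> (2 * max a b) powr p" using assms by (intro powr_mono2) auto
  also have "\<dots> = 2 powr p * (max a b) powr p" using assms by (subst powr_mult) auto
  also have "(max a b) powr p \<le> a powr p + b powr p" by (auto simp: max_def)
  finally show ?thesis by simp
qed

text \<open>Isolates what the passage to the limit uses. The exponent \<open>2 * p\<close> is the
  upper end of the interpolation, and moments of every order upgrade the \<open>L^1\<close>
  convergence of the interactions.\<close>

locale gibbs_sequence = prob_space M for M :: "'a measure" +
  fixes p C :: real and R :: "nat \<Rightarrow> 'a \<Rightarrow> real" and R' :: "'a \<Rightarrow> real"
  assumes R[measurable]: "\<And>N. R N \<in> borel_measurable M" and R'[measurable]: "R' \<in> borel_measurable M"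
    and p: "1 \<le> p" and C: "0 \<le> C"
    and small_R: "small (\<lambda>N. \<integral>\<^sup>+x. ennreal \<bar>R N x - R' x\<bar> \<partial>M)"
    and moments: "\<And>m. \<exists>D\<ge>0. (\<forall>N. (\<integral>\<^sup>+x. ennreal (\<bar>R N x\<bar> ^ m) \<partial>M) \<le> ennreal D) \<and> (\<integral>\<^sup>+x. ennreal (\<bar>R' x\<bar> ^ m) \<partial>M) \<le> ennreal D"
    and exp_R: "\<And>N. (\<integral>\<^sup>+x. ennreal (exp (2 * p * R N x)) \<partial>M) \<le> ennreal C"
    and exp_R': "(\<integral>\<^sup>+x. ennreal (exp (2 * p * R' x)) \<partial>M) \<le> ennreal C"
begin

lemma M: "prob_space M" by (rule prob_space_axioms)

lemma in_Lp_R: "in_Lp M p (R N)" "in_Lp M p R'"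
proof -
  obtain m where m: "p \<le> real m" using real_arch_simple by blast
  obtain D where D: "D \<ge> 0" "\<And>N. (\<integral>\<^sup>+x. ennreal (\<bar>R N x\<bar> ^ m) \<partial>M) \<le> ennreal D" "(\<integral>\<^sup>+x. ennreal (\<bar>R' x\<bar> ^ m) \<partial>M) \<le> ennreal D"
    using moments[of m] by blast
  have "(\<integral>\<^sup>+x. ennreal (\<bar>f x\<bar> powr p) \<partial>M) \<le> ennreal (1 + 1 * D + 0 * D)"
    if [measurable]: "f \<in> borel_measurable M" and "(\<integral>\<^sup>+x. ennreal (\<bar>f x\<bar> ^ m) \<partial>M) \<le> ennreal D" for f
    using powr_le_1_add_power[OF abs_ge_zero _ m] p D(1) that
    by (intro nn_integral_affine_bound[OF M, where u="\<lambda>x. \<bar>f x\<bar> ^ m" and v="\<lambda>x. \<bar>f x\<bar> ^ m"]) auto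
  from this[OF R D(2), of N] this[OF R' D(3)] show "in_Lp M p (R N)" "in_Lp M p R'"
    unfolding in_Lp_def by (auto intro: le_less_trans)
qed

text \<open>General \<open>q\<close> is wanted because the exponentials use \<open>q = 2\<close> and
  the final statement \<open>q = p\<close>.\<close>

lemma small_R_powr: assumes q: "1 \<le> q" shows "small (\<lambda>N. \<integral>\<^sup>+x. ennreal (\<bar>R N x - R' x\<bar> powr q) \<partial>M)"
proof -
  obtain m where m: "2 * q \<le> real m" using real_arch_simple by blast
  obtain D where D: "D \<ge> 0" "\<And>N. (\<integral>\<^sup>+x. ennreal (\<bar>R N x\<bar> ^ m) \<partial>M) \<le> ennreal D" "(\<integral>\<^sup>+x. ennreal (\<bar>R' x\<bar> ^ m) \<partial>M) \<le> ennreal D"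
    using moments[of m] by blast
  have bd: "(\<integral>\<^sup>+x. ennreal (\<bar>R N x - R' x\<bar> powr (2 * q)) \<partial>M) \<le> ennreal (1 + 2 ^ m * D + 2 ^ m * D)" for N
  proof (rule nn_integral_affine_bound[OF M _ _ _ _ _ _ _ _ _ D(2) D(3)])
    show "\<bar>R N x - R' x\<bar> powr (2 * q) \<le> 1 + 2 ^ m * \<bar>R N x\<bar> ^ m + 2 ^ m * \<bar>R' x\<bar> ^ m" for x
      using abs_diff_powr_le[of "2 * q" m "R N x" "R' x"] q m by (simp add: distrib_left)
  qed (use D in auto)
  show ?thesis
    by (rule small_interpolation[OF M _ small_R bd q]) (use D in auto)
qed

lemma exp_p_bound:
  assumes [measurable]: "f \<in> borel_measurable M" and "(\<integral>\<^sup>+x. ennreal (exp (2 * p * f x)) \<partial>M) \<le> ennreal C"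
  shows "0 \<le> s \<Longrightarrow> s \<le> 2 * p \<Longrightarrow> (\<integral>\<^sup>+x. ennreal (exp (s * f x)) \<partial>M) \<le> ennreal (1 + C)"
proof -
  assume s: "0 \<le> s" "s \<le> 2 * p"
  have "exp (s * r) \<le> 1 + exp (2 * p * r)" for r :: real
  proof (cases "0 \<le> r")
    case True
    then have "s * r \<le> 2 * p * r" using s by (intro mult_right_mono) auto
    then show ?thesis by (simp add: add_increasing)
  next
    case False
    then have "s * r \<le> 0" using s by (simp add: mult_nonneg_nonpos)
    then have "exp (s * r) \<le> 1" by simp
    then show ?thesis using exp_gt_zero[of "2 * p * r"] by linarith
  qed
  then have "(\<integral>\<^sup>+x. ennreal (exp (s * f x)) \<partial>M) \<le> ennreal (1 + 1 * C + 0 * C)"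
    using assms C by (intro nn_integral_affine_bound[OF M, where u="\<lambda>x. exp (2 * p * f x)" and v="\<lambda>x. exp (2 * p * f x)"]) auto
  then show ?thesis by simp
qed

lemma exp_Lp_bound:
  assumes "f \<in> borel_measurable M" and "(\<integral>\<^sup>+x. ennreal (exp (2 * p * f x)) \<partial>M) \<le> ennreal C"
  shows "(\<integral>\<^sup>+x. ennreal (\<bar>exp (f x)\<bar> powr p) \<partial>M) \<le> ennreal (1 + C)"
  using exp_p_bound[OF assms, of p] p by (simp add: powr_def)

lemma in_Lp_exp: "in_Lp M p (\<lambda>x. exp (R N x))" "in_Lp M p (\<lambda>x. exp (R' x))"
  unfolding in_Lp_def using exp_Lp_bound[OF R exp_R, of N] exp_Lp_bound[OF R' exp_R']
  by (auto intro: le_less_trans)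

lemma Lp_norm_exp_le: "Lp_norm M p (\<lambda>x. exp (R N x)) \<le> (1 + C) powr (1 / p)"
  unfolding Lp_norm_def using p C
  by (intro powr_mono2 enn2real_leI exp_Lp_bound[OF R exp_R]) auto

text \<open>The difference is at most \<open>\<bar>a - b\<bar> * (exp a + exp b)\<close>. Young's
  inequality separates the small second moment of the first factor from the exponential moments of
  order 2, which are available because \<open>2 \<le> 2 * p\<close>.\<close>

lemma small_exp: "small (\<lambda>N. \<integral>\<^sup>+x. ennreal \<bar>exp (R N x) - exp (R' x)\<bar> \<partial>M)"
  unfolding small_def
proof (intro allI impI)
  fix e :: real assume e: "0 < e"
  define \<delta> where "\<delta> = e / (2 * (4 + 4 * C))"
  have \<delta>: "0 < \<delta>" unfolding \<delta>_def using e C by simp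
  obtain N0 where N0: "\<And>N. N \<ge> N0 \<Longrightarrow> (\<integral>\<^sup>+x. ennreal (\<bar>R N x - R' x\<bar> powr 2) \<partial>M) \<le> ennreal (2 * \<delta> * e)"
    using smallD[OF small_R_powr[of 2], of "2 * \<delta> * e"] \<delta> e by auto
  have "(\<integral>\<^sup>+x. ennreal \<bar>exp (R N x) - exp (R' x)\<bar> \<partial>M) \<le> ennreal e" if N: "N \<ge> N0" for N
  proof -
    have e2: "(\<integral>\<^sup>+x. ennreal (exp (2 * R N x) + exp (2 * R' x)) \<partial>M) \<le> ennreal (0 + 1 * (1 + C) + 1 * (1 + C))"
      using exp_p_bound[OF R exp_R, of 2] exp_p_bound[OF R' exp_R', of 2] p C
      by (intro nn_integral_affine_bound[OF M, where u="\<lambda>x. exp (2 * R N x)" and v="\<lambda>x. exp (2 * R' x)"]) auto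
    have "(\<integral>\<^sup>+x. ennreal \<bar>exp (R N x) - exp (R' x)\<bar> \<partial>M) \<le> ennreal (0 + 1 / (4 * \<delta>) * (2 * \<delta> * e) + (2 * \<delta>) * (0 + 1 * (1 + C) + 1 * (1 + C)))"
    proof (rule nn_integral_affine_bound[OF M _ _ _ _ _ _ _ _ _ N0[OF N] e2])
      fix x
      define a b where "a = R N x" and "b = R' x"
      have "\<bar>exp a - exp b\<bar> \<le> \<bar>a - b\<bar> * (exp a + exp b)" by (rule abs_exp_diff_le)
      also have "\<dots> \<le> 1 / (4 * \<delta>) * \<bar>a - b\<bar>\<^sup>2 + \<delta> * (exp a + exp b)\<^sup>2"
        using young_delta[OF \<delta>, of "\<bar>a - b\<bar>" "exp a + exp b"] by simp
      also have "\<delta> * (exp a + exp b)\<^sup>2 \<le> \<delta> * (2 * (exp (2 * a) + exp (2 * b)))"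
        using sum_squares_bound[of "exp a" "exp b"] \<delta>
        by (intro mult_left_mono) (auto simp: power2_sum exp_double)
      finally show "\<bar>exp (R N x) - exp (R' x)\<bar> \<le> 0 + 1 / (4 * \<delta>) * \<bar>R N x - R' x\<bar> powr 2 + 2 * \<delta> * (exp (2 * R N x) + exp (2 * R' x))"
        by (simp add: a_def b_def powr_numeral mult_ac)
    qed (use \<delta> e C in auto)
    also have "0 + 1 / (4 * \<delta>) * (2 * \<delta> * e) + (2 * \<delta>) * (0 + 1 * (1 + C) + 1 * (1 + C)) = e / 2 + \<delta> * (4 + 4 * C)"
      using \<delta> by (simp add: algebra_simps)
    also have "\<delta> * (4 + 4 * C) = e / 2" unfolding \<delta>_def using C by (intro divide_double_mult) auto
    finally show ?thesis by simp
  qed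
  then show "\<exists>N0. \<forall>N\<ge>N0. (\<integral>\<^sup>+x. ennreal \<bar>exp (R N x) - exp (R' x)\<bar> \<partial>M) \<le> ennreal e" by blast
qed

lemma exp_diff_bound:
  assumes "0 \<le> s" "s \<le> 2 * p"
  shows "(\<integral>\<^sup>+x. ennreal (\<bar>exp (R N x) - exp (R' x)\<bar> powr s) \<partial>M) \<le> ennreal (0 + 1 * (1 + C) + 1 * (1 + C))"
  using abs_exp_diff_powr_le[OF assms(1)] C
  by (intro nn_integral_affine_bound[OF M _ _ _ _ _ _ _ _ _ exp_p_bound[OF R exp_R assms] exp_p_bound[OF R' exp_R' assms]]) auto

lemma small_exp_powr: "small (\<lambda>N. \<integral>\<^sup>+x. ennreal (\<bar>exp (R N x) - exp (R' x)\<bar> powr p) \<partial>M)"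
  using p C by (intro small_interpolation[OF M _ small_exp exp_diff_bound]) auto

lemma integrable_exp: "integrable M (\<lambda>x. exp (R N x))" "integrable M (\<lambda>x. exp (R' x))"
proof -
  show "integrable M (\<lambda>x. exp (R N x))"
    using exp_p_bound[OF R exp_R, of 1 N] p by (intro integrableI_bounded) (auto intro: le_less_trans)
  show "integrable M (\<lambda>x. exp (R' x))"
    using exp_p_bound[OF R' exp_R', of 1] p by (intro integrableI_bounded) (auto intro: le_less_trans)
qed

lemma integral_exp_pos:
  fixes f :: "'a \<Rightarrow> real"
  assumes int: "integrable M (\<lambda>x. exp (f x))" shows "0 < (\<integral>x. exp (f x) \<partial>M)"
proof -
  have "(\<integral>x. exp (f x) \<partial>M) \<noteq> 0"
  proof
    assume "(\<integral>x. exp (f x) \<partial>M) = 0"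
    then have "AE x in M. exp (f x) = 0" using integral_nonneg_eq_0_iff_AE[OF int] by simp
    then show False by simp
  qed
  moreover have "0 \<le> (\<integral>x. exp (f x) \<partial>M)" by simp
  ultimately show ?thesis by linarith
qed

abbreviation "Z \<equiv> \<integral>x. exp (R' x) \<partial>M"
abbreviation "ZN N \<equiv> \<integral>x. exp (R N x) \<partial>M"

lemma Z_pos: "0 < Z" and ZN_pos: "0 < ZN N"
  by (intro integral_exp_pos integrable_exp)+

lemma ZN_tendsto: "(\<lambda>N. ZN N) \<longlonglongrightarrow> Z"
proof -
  have "\<bar>ZN N - Z\<bar> \<le> enn2real (\<integral>\<^sup>+x. ennreal \<bar>exp (R N x) - exp (R' x)\<bar> \<partial>M)" for N
  proof -
    have "\<bar>ZN N - Z\<bar> = \<bar>\<integral>x. exp (R N x) - exp (R' x) \<partial>M\<bar>"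
      using integrable_exp by simp
    also have "\<dots> \<le> (\<integral>x. \<bar>exp (R N x) - exp (R' x)\<bar> \<partial>M)" by (rule integral_abs_bound)
    also have "\<dots> = enn2real (\<integral>\<^sup>+x. ennreal \<bar>exp (R N x) - exp (R' x)\<bar> \<partial>M)"
      using integrable_exp by (intro integral_eq_nn_integral) auto
    finally show ?thesis .
  qed
  then have "(\<lambda>N. ZN N - Z) \<longlonglongrightarrow> 0"
    by (intro Lim_null_comparison[OF _ small_tendsto[OF small_exp]]) auto
  then show ?thesis by (simp add: LIM_zero_iff)
qed

text \<open>Change the numerator first and the normalisation second: one error is the convergence of
  the exponentials divided by \<open>ZN N\<close>, the other a fixed \<open>L^p\<close> function
  times \<open>1 / ZN N - 1 / Z\<close>.\<close>

lemma small_normalised: "small (\<lambda>N. \<integral>\<^sup>+x. ennreal (\<bar>exp (R N x) / ZN N - exp (R' x) / Z\<bar> powr p) \<partial>M)"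
proof (rule small_of_bound)
  define s where "s N = enn2real (\<integral>\<^sup>+x. ennreal (\<bar>exp (R N x) - exp (R' x)\<bar> powr p) \<partial>M)" for N
  define b where "b N = 0 + 2 powr p * (1 / ZN N) powr p * s N + 2 powr p * \<bar>1 / ZN N - 1 / Z\<bar> powr p * (1 + C)" for N
  have s: "(\<integral>\<^sup>+x. ennreal (\<bar>exp (R N x) - exp (R' x)\<bar> powr p) \<partial>M) \<le> ennreal (s N)" for N
    unfolding s_def using exp_diff_bound[of p N] p by (subst ennreal_enn2real) (auto intro: le_less_trans)
  show "(\<integral>\<^sup>+x. ennreal (\<bar>exp (R N x) / ZN N - exp (R' x) / Z\<bar> powr p) \<partial>M) \<le> ennreal (b N)" for N
    unfolding b_def
  proof (rule nn_integral_affine_bound[OF M _ _ _ _ _ _ _ _ _ s exp_Lp_bound[OF R' exp_R']])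
    fix x
    have "exp (R N x) / ZN N - exp (R' x) / Z = (exp (R N x) - exp (R' x)) * (1 / ZN N) + exp (R' x) * (1 / ZN N - 1 / Z)"
      by (simp add: algebra_simps diff_divide_distrib)
    then have "\<bar>exp (R N x) / ZN N - exp (R' x) / Z\<bar> \<le> \<bar>exp (R N x) - exp (R' x)\<bar> * (1 / ZN N) + \<bar>exp (R' x)\<bar> * \<bar>1 / ZN N - 1 / Z\<bar>"
      using abs_triangle_ineq[of "(exp (R N x) - exp (R' x)) * (1 / ZN N)" "exp (R' x) * (1 / ZN N - 1 / Z)"] ZN_pos[of N]
      by (simp add: abs_mult)
    then have "\<bar>exp (R N x) / ZN N - exp (R' x) / Z\<bar> powr p \<le> (\<bar>exp (R N x) - exp (R' x)\<bar> * (1 / ZN N) + \<bar>exp (R' x)\<bar> * \<bar>1 / ZN N - 1 / Z\<bar>) powr p"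
      using p by (intro powr_mono2) auto
    also have "\<dots> \<le> 2 powr p * ((\<bar>exp (R N x) - exp (R' x)\<bar> * (1 / ZN N)) powr p + (\<bar>exp (R' x)\<bar> * \<bar>1 / ZN N - 1 / Z\<bar>) powr p)"
      using p ZN_pos[of N] by (intro add_powr_le) auto
    also have "\<dots> = 0 + 2 powr p * (1 / ZN N) powr p * \<bar>exp (R N x) - exp (R' x)\<bar> powr p + 2 powr p * \<bar>1 / ZN N - 1 / Z\<bar> powr p * \<bar>exp (R' x)\<bar> powr p"
      using ZN_pos[of N] by (simp only: powr_mult abs_ge_zero) (simp add: algebra_simps)
    finally show "\<bar>exp (R N x) / ZN N - exp (R' x) / Z\<bar> powr p \<le> 0 + 2 powr p * (1 / ZN N) powr p * \<bar>exp (R N x) - exp (R' x)\<bar> powr p + 2 powr p * \<bar>1 / ZN N - 1 / Z\<bar> powr p * \<bar>exp (R' x)\<bar> powr p" .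
  qed (use C in \<open>auto simp: s_def\<close>)
  have inv: "(\<lambda>N. 1 / ZN N) \<longlonglongrightarrow> 1 / Z"
    using ZN_tendsto Z_pos by (intro tendsto_divide tendsto_const) auto
  have "(\<lambda>N. \<bar>1 / ZN N - 1 / Z\<bar>) \<longlonglongrightarrow> 0"
    using inv by (intro tendsto_rabs_zero) (simp add: LIM_zero)
  then have "(\<lambda>N. \<bar>1 / ZN N - 1 / Z\<bar> powr p) \<longlonglongrightarrow> 0"
    using p by (intro tendsto_zero_powrI[OF _ tendsto_const]) auto
  moreover have "s \<longlonglongrightarrow> 0" unfolding s_def using small_exp_powr by (rule small_tendsto)
  moreover have "(\<lambda>N. (1 / ZN N) powr p) \<longlonglongrightarrow> (1 / Z) powr p"
    using Z_pos by (intro tendsto_powr[OF inv tendsto_const]) auto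
  ultimately have "b \<longlonglongrightarrow> 0 + 2 powr p * (1 / Z) powr p * 0 + 2 powr p * 0 * (1 + C)"
    unfolding b_def by (intro tendsto_add tendsto_mult tendsto_const)
  then show "b \<longlonglongrightarrow> 0" by simp
qed

lemma prob_space_limit: "prob_space (density M (\<lambda>x. ennreal (exp (R' x) / Z)))"
proof
  have "emeasure (density M (\<lambda>x. ennreal (exp (R' x) / Z))) (space M) = (\<integral>\<^sup>+x. ennreal (exp (R' x) / Z) \<partial>M)"
    by (subst emeasure_density) (auto intro!: nn_integral_cong)
  also have "\<dots> = ennreal (\<integral>x. exp (R' x) / Z \<partial>M)"
    using integrable_exp Z_pos by (intro nn_integral_eq_integral) auto
  also have "(\<integral>x. exp (R' x) / Z \<partial>M) = 1" using Z_pos by simp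
  finally show "emeasure (density M (\<lambda>x. ennreal (exp (R' x) / Z))) (space (density M (\<lambda>x. ennreal (exp (R' x) / Z)))) = 1" by simp
qed

text \<open>The density is strictly positive everywhere because it is an exponential divided by a
  positive constant, so null sets agree in both directions.\<close>

lemma absolutely_continuous_limit:
  "absolutely_continuous M (density M (\<lambda>x. ennreal (exp (R' x) / Z)))"
  "absolutely_continuous (density M (\<lambda>x. ennreal (exp (R' x) / Z))) M"
proof -
  show "absolutely_continuous M (density M (\<lambda>x. ennreal (exp (R' x) / Z)))"
    by (rule absolutely_continuousI_density) measurable
  show "absolutely_continuous (density M (\<lambda>x. ennreal (exp (R' x) / Z))) M"
    unfolding absolutely_continuous_def
  proof
    fix A assume "A \<in> null_sets (density M (\<lambda>x. ennreal (exp (R' x) / Z)))"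
    then have A: "A \<in> sets M" "AE x in M. x \<in> A \<longrightarrow> ennreal (exp (R' x) / Z) = 0"
      by (auto simp: null_sets_density_iff)
    have "AE x in M. x \<notin> A" using A(2)
      by eventually_elim (use Z_pos in \<open>auto simp: ennreal_eq_0_iff divide_le_0_iff not_le\<close>)
    then show "A \<in> null_sets M" using A(1) by (simp add: AE_iff_null_sets)
  qed
qed

end

section \<open>The limit of the truncated interactions\<close>

text \<open>Boundedness and monotonicity replace any quantitative rate for the tails of the lattice
  sums.\<close>

lemma kap_Cauchy: "Cauchy (kap2 TYPE('d::finite))" "Cauchy (kap3 TYPE('d))"
proof -
  obtain S where S: "\<And>N. (\<Sum>n\<in>(ball_N N :: (int ^ 'd) set). wt n powr (5/4)) \<le> S"
    using sum_wt_powr_bounded[where 'd='d] by blast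
  have "incseq (kap2 TYPE('d))" "incseq (kap3 TYPE('d))"
    using kap_mono[where 'd='d] by (auto simp: incseq_def)
  moreover have "\<forall>N. kap2 TYPE('d) N \<le> S" "\<forall>N. kap3 TYPE('d) N \<le> 12 * S\<^sup>2"
    using kap2_le[OF S] kap3_le[OF S] by auto
  ultimately show "Cauchy (kap2 TYPE('d))" "Cauchy (kap3 TYPE('d))"
    by (metis incseq_convergent LIMSEQ_imp_Cauchy)+
qed

text \<open>The cross moment of two truncations equals the second moment of the smaller one, so
  increments are orthogonal and the square norm of a difference is a difference of square
  norms.\<close>

lemma functional_differences:
  assumes MN: "M \<le> N"
  shows "integrable gauss_prod (\<lambda>\<omega> :: int ^ 'd \<Rightarrow> real. (cubN N \<omega> - cubN M \<omega>)\<^sup>2)"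
    and "(\<integral>\<omega>. (cubN N \<omega> - cubN M \<omega>)\<^sup>2 \<partial>(gauss_prod :: (int ^ 'd \<Rightarrow> real) measure)) = 6 * (kap3 TYPE('d) N - kap3 TYPE('d) M)"
    and "integrable gauss_prod (\<lambda>\<omega> :: int ^ 'd \<Rightarrow> real. (sqN N \<omega> - sqN M \<omega>)\<^sup>2)"
    and "(\<integral>\<omega>. (sqN N \<omega> - sqN M \<omega>)\<^sup>2 \<partial>(gauss_prod :: (int ^ 'd \<Rightarrow> real) measure)) = 2 * (kap2 TYPE('d) N - kap2 TYPE('d) M)"
proof -
  have e: "(a - b)\<^sup>2 = a * a - 2 * (a * b) + b * b" for a b :: real by (simp add: power2_eq_square algebra_simps)
  note c = cubN_moment[OF order_refl, where 'd='d] cubN_moment[OF MN, where 'd='d]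
  show "integrable gauss_prod (\<lambda>\<omega> :: int ^ 'd \<Rightarrow> real. (cubN N \<omega> - cubN M \<omega>)\<^sup>2)"
    and "(\<integral>\<omega>. (cubN N \<omega> - cubN M \<omega>)\<^sup>2 \<partial>(gauss_prod :: (int ^ 'd \<Rightarrow> real) measure)) = 6 * (kap3 TYPE('d) N - kap3 TYPE('d) M)"
    unfolding e by (auto simp: c)
  note q = sqN_moment[OF order_refl, where 'd='d] sqN_moment[OF MN, where 'd='d]
  show "integrable gauss_prod (\<lambda>\<omega> :: int ^ 'd \<Rightarrow> real. (sqN N \<omega> - sqN M \<omega>)\<^sup>2)"
    and "(\<integral>\<omega>. (sqN N \<omega> - sqN M \<omega>)\<^sup>2 \<partial>(gauss_prod :: (int ^ 'd \<Rightarrow> real) measure)) = 2 * (kap2 TYPE('d) N - kap2 TYPE('d) M)"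
    unfolding e by (auto simp: q)
qed

lemma integrable_RN: "integrable gauss_prod (RN \<sigma> A N :: (int ^ 'd \<Rightarrow> real) \<Rightarrow> real)"
proof -
  interpret prob_space "gauss_prod :: (int ^ 'd \<Rightarrow> real) measure" by (rule prob_space_gauss_prod)
  have "integrable gauss_prod (\<lambda>\<omega> :: int ^ 'd \<Rightarrow> real. (cubN N \<omega>)\<^sup>2)"
    using cubN_moment(1)[OF order_refl, of N, where 'd='d] by (simp add: power2_eq_square)
  then have "integrable gauss_prod (cubN N :: (int ^ 'd \<Rightarrow> real) \<Rightarrow> real)"
    by (rule square_integrable_imp_integrable[OF measurable_functionals(1)])
  moreover have "integrable gauss_prod (\<lambda>\<omega> :: int ^ 'd \<Rightarrow> real. (sqN N \<omega>)\<^sup>2)"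
    using sqN_moment(1)[OF order_refl, of N, where 'd='d] by (simp add: power2_eq_square)
  moreover have "(RN \<sigma> A N :: (int ^ 'd \<Rightarrow> real) \<Rightarrow> real) = (\<lambda>\<omega>. \<sigma> / 3 * cubN N \<omega> - A * (sqN N \<omega>)\<^sup>2)"
    by (simp add: RN_eq fun_eq_iff)
  ultimately show ?thesis
    by (simp only:) (intro Bochner_Integration.integrable_diff integrable_mult_right)
qed

text \<open>Young's inequality with free \<open>\<delta>\<close> handles both the cubic difference
  and \<open>v\<^sup>2 - w\<^sup>2 = (v - w) * (v + w)\<close>. What multiplies
  \<open>1 / \<delta>\<close> is an increment of \<open>kap2\<close> or \<open>kap3\<close>, so
  \<open>\<delta>\<close> can be fixed first and the truncation chosen afterwards.\<close>

lemma RN_difference_L1: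
  fixes \<sigma> A \<delta> :: real
  assumes S: "\<And>N. (\<Sum>n\<in>(ball_N N :: (int ^ 'd) set). wt n powr (5/4)) \<le> S"
    and MN: "M \<le> N" and \<delta>: "0 < \<delta>"
  shows "(\<integral>\<omega>. \<bar>RN \<sigma> A N \<omega> - RN \<sigma> A M \<omega>\<bar> \<partial>(gauss_prod :: (int ^ 'd \<Rightarrow> real) measure))
    \<le> \<bar>\<sigma>\<bar> / 3 * (\<delta> + 6 * (kap3 TYPE('d) N - kap3 TYPE('d) M) / (4 * \<delta>))
      + \<bar>A\<bar> * (2 * (kap2 TYPE('d) N - kap2 TYPE('d) M) / (4 * \<delta>) + \<delta> * (8 * S))"
proof -
  interpret prob_space "gauss_prod :: (int ^ 'd \<Rightarrow> real) measure" by (rule prob_space_gauss_prod)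
  define b where "b \<omega> = \<bar>\<sigma>\<bar> / 3 * (\<delta> + (cubN N \<omega> - cubN M \<omega>)\<^sup>2 / (4 * \<delta>))
      + \<bar>A\<bar> * ((sqN N \<omega> - sqN M \<omega>)\<^sup>2 / (4 * \<delta>) + \<delta> * (2 * (sqN N \<omega> * sqN N \<omega>) + 2 * (sqN M \<omega> * sqN M \<omega>)))" for \<omega> :: "int ^ 'd \<Rightarrow> real"
  note fd = functional_differences[OF MN, where 'd='d] and q = sqN_moment[OF order_refl, where 'd='d]
  have int: "integrable gauss_prod b"
    unfolding b_def using fd q by auto
  have val: "(\<integral>\<omega>. b \<omega> \<partial>gauss_prod) = \<bar>\<sigma>\<bar> / 3 * (\<delta> + 6 * (kap3 TYPE('d) N - kap3 TYPE('d) M) / (4 * \<delta>))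
      + \<bar>A\<bar> * (2 * (kap2 TYPE('d) N - kap2 TYPE('d) M) / (4 * \<delta>) + \<delta> * (2 * (2 * kap2 TYPE('d) N) + 2 * (2 * kap2 TYPE('d) M)))"
    unfolding b_def using fd q by (simp add: prob_space)
  have le: "\<bar>RN \<sigma> A N \<omega> - RN \<sigma> A M \<omega>\<bar> \<le> b \<omega>" for \<omega> :: "int ^ 'd \<Rightarrow> real"
  proof -
    define x y v w where "x = cubN N \<omega>" and "y = cubN M \<omega>" and "v = sqN N \<omega>" and "w = sqN M \<omega>"
    have "\<bar>x - y\<bar> \<le> \<delta> + (x - y)\<^sup>2 / (4 * \<delta>)"
      using young_delta[OF \<delta>, of "\<bar>x - y\<bar>" 1] by simp
    then have 1: "\<bar>\<sigma>\<bar> / 3 * \<bar>x - y\<bar> \<le> \<bar>\<sigma>\<bar> / 3 * (\<delta> + (x - y)\<^sup>2 / (4 * \<delta>))" by (intro mult_left_mono) auto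
    have "\<bar>v\<^sup>2 - w\<^sup>2\<bar> = \<bar>v - w\<bar> * \<bar>v + w\<bar>" by (simp add: abs_mult[symmetric] power2_eq_square algebra_simps)
    also have "\<dots> \<le> \<delta> * (v + w)\<^sup>2 + (v - w)\<^sup>2 / (4 * \<delta>)"
      using young_delta[OF \<delta>, of "\<bar>v - w\<bar>" "\<bar>v + w\<bar>"] by simp
    also have "\<delta> * (v + w)\<^sup>2 \<le> \<delta> * (2 * (v * v) + 2 * (w * w))"
      using sum_squares_bound[of v w] \<delta> by (intro mult_left_mono) (auto simp: power2_eq_square algebra_simps)
    finally have 2: "\<bar>A\<bar> * \<bar>v\<^sup>2 - w\<^sup>2\<bar> \<le> \<bar>A\<bar> * ((v - w)\<^sup>2 / (4 * \<delta>) + \<delta> * (2 * (v * v) + 2 * (w * w)))"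
      by (intro mult_left_mono) auto
    have "\<bar>\<sigma> / 3 * x - A * v\<^sup>2 - (\<sigma> / 3 * y - A * w\<^sup>2)\<bar> = \<bar>\<sigma> / 3 * (x - y) - A * (v\<^sup>2 - w\<^sup>2)\<bar>" by (simp add: algebra_simps diff_divide_distrib)
    also have "\<dots> \<le> \<bar>\<sigma>\<bar> / 3 * \<bar>x - y\<bar> + \<bar>A\<bar> * \<bar>v\<^sup>2 - w\<^sup>2\<bar>"
      by (rule order_trans[OF abs_triangle_ineq4]) (simp add: abs_mult)
    finally show ?thesis unfolding RN_eq b_def x_def[symmetric] y_def[symmetric] v_def[symmetric] w_def[symmetric] using 1 2 by linarith
  qed
  have "(\<integral>\<omega>. \<bar>RN \<sigma> A N \<omega> - RN \<sigma> A M \<omega>\<bar> \<partial>(gauss_prod :: (int ^ 'd \<Rightarrow> real) measure)) \<le> (\<integral>\<omega>. b \<omega> \<partial>gauss_prod)"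
    by (rule integral_mono[OF integrable_abs[OF Bochner_Integration.integrable_diff[OF integrable_RN integrable_RN]] int le])
  also have "\<dots> \<le> \<bar>\<sigma>\<bar> / 3 * (\<delta> + 6 * (kap3 TYPE('d) N - kap3 TYPE('d) M) / (4 * \<delta>))
      + \<bar>A\<bar> * (2 * (kap2 TYPE('d) N - kap2 TYPE('d) M) / (4 * \<delta>) + \<delta> * (8 * S))"
    unfolding val using kap2_le[OF S[of N]] kap2_le[OF S[of M]] \<delta>
    by (intro add_left_mono mult_left_mono) auto
  finally show ?thesis .
qed

lemma RN_Cauchy_L1:
  fixes \<sigma> A e :: real
  assumes e: "0 < e"
  shows "\<exists>N0. \<forall>i\<ge>N0. \<forall>j\<ge>N0. (\<integral>\<omega>. \<bar>RN \<sigma> A i \<omega> - RN \<sigma> A j \<omega>\<bar> \<partial>(gauss_prod :: (int ^ 'd \<Rightarrow> real) measure)) < e"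
proof -
  obtain S where S: "0 < S" "\<And>N. (\<Sum>n\<in>(ball_N N :: (int ^ 'd) set). wt n powr (5/4)) \<le> S"
    using sum_wt_powr_bounded[where 'd='d] by blast
  \<comment> \<open>\<open>c\<close> and \<open>d\<close> collect the coefficients of
    \<open>\<delta>\<close> and of the tolerance \<open>\<eta>\<close> for the increments. The
    summand 1 keeps them positive and makes the final inequality strict.\<close>
  define c where "c = \<bar>\<sigma>\<bar> / 3 + 8 * \<bar>A\<bar> * S + 1"
  have c: "0 < c" unfolding c_def using S by (intro add_nonneg_pos add_nonneg_nonneg) auto
  define \<delta> where "\<delta> = e / (2 * c)"
  have \<delta>: "0 < \<delta>" unfolding \<delta>_def using e c by simp
  define d where "d = \<bar>\<sigma>\<bar> / (2 * \<delta>) + \<bar>A\<bar> / (2 * \<delta>) + 1"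
  have d: "0 < d" unfolding d_def using \<delta> by (intro add_nonneg_pos add_nonneg_nonneg) auto
  define \<eta> where "\<eta> = e / (2 * d)"
  have \<eta>: "0 < \<eta>" unfolding \<eta>_def using e d by simp
  obtain N0 where N0: "\<And>i j. i \<ge> N0 \<Longrightarrow> j \<ge> N0 \<Longrightarrow> \<bar>kap2 TYPE('d) i - kap2 TYPE('d) j\<bar> < \<eta> \<and> \<bar>kap3 TYPE('d) i - kap3 TYPE('d) j\<bar> < \<eta>"
  proof -
    obtain N1 N2 where "\<forall>i\<ge>N1. \<forall>j\<ge>N1. \<bar>kap2 TYPE('d) i - kap2 TYPE('d) j\<bar> < \<eta>"
      "\<forall>i\<ge>N2. \<forall>j\<ge>N2. \<bar>kap3 TYPE('d) i - kap3 TYPE('d) j\<bar> < \<eta>"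
      using CauchyD[OF kap_Cauchy(1)[where 'd='d] \<eta>] CauchyD[OF kap_Cauchy(2)[where 'd='d] \<eta>] by auto
    then show ?thesis using that[of "max N1 N2"] by simp
  qed
  have main: "(\<integral>\<omega>. \<bar>RN \<sigma> A i \<omega> - RN \<sigma> A j \<omega>\<bar> \<partial>(gauss_prod :: (int ^ 'd \<Rightarrow> real) measure)) < e"
    if ij: "j \<le> i" "i \<ge> N0" "j \<ge> N0" for i j
  proof -
    define k2 k3 where "k2 = kap2 TYPE('d) i - kap2 TYPE('d) j" and "k3 = kap3 TYPE('d) i - kap3 TYPE('d) j"
    have k: "k2 \<le> \<eta>" "k3 \<le> \<eta>" using N0[OF ij(2,3)] unfolding k2_def k3_def by auto
    have "(\<integral>\<omega>. \<bar>RN \<sigma> A i \<omega> - RN \<sigma> A j \<omega>\<bar> \<partial>(gauss_prod :: (int ^ 'd \<Rightarrow> real) measure))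
      \<le> \<bar>\<sigma>\<bar> / 3 * (\<delta> + 6 * k3 / (4 * \<delta>)) + \<bar>A\<bar> * (2 * k2 / (4 * \<delta>) + \<delta> * (8 * S))"
      unfolding k2_def k3_def by (rule RN_difference_L1[OF S(2) ij(1) \<delta>])
    also have "\<dots> \<le> \<bar>\<sigma>\<bar> / 3 * (\<delta> + 6 * \<eta> / (4 * \<delta>)) + \<bar>A\<bar> * (2 * \<eta> / (4 * \<delta>) + \<delta> * (8 * S))"
      using k \<delta> by (intro add_mono mult_left_mono divide_right_mono order_refl) auto
    also have "\<dots> = \<delta> * (c - 1) + \<eta> * (d - 1)"
      unfolding c_def d_def using \<delta> by (simp add: field_simps)
    also have "\<dots> < \<delta> * c + \<eta> * d" using \<delta> \<eta> by (simp add: algebra_simps)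
    also have "\<delta> * c + \<eta> * d = e"
      unfolding \<delta>_def \<eta>_def divide_double_mult[OF c] divide_double_mult[OF d] by simp
    finally show ?thesis .
  qed
  have "(\<integral>\<omega>. \<bar>RN \<sigma> A i \<omega> - RN \<sigma> A j \<omega>\<bar> \<partial>(gauss_prod :: (int ^ 'd \<Rightarrow> real) measure)) < e"
    if "i \<ge> N0" "j \<ge> N0" for i j
    using main[of i j] main[of j i] that by (cases "j \<le> i") (auto simp: abs_minus_commute)
  then show ?thesis by blast
qed

text \<open>A Cauchy sequence in \<open>L^1\<close> has an almost surely convergent subsequence.
  Fatou's lemma along it, with the other index fixed, gives \<open>L^1\<close> convergence of the
  whole sequence; the subsequence is returned so that further bounds can be passed to the
  limit.\<close>

lemma RN_limit:
  fixes \<sigma> A :: real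
  obtains R :: "(int ^ 'd \<Rightarrow> real) \<Rightarrow> real" and r :: "nat \<Rightarrow> nat"
  where "R \<in> borel_measurable gauss_prod"
    and "AE \<omega> in gauss_prod. (\<lambda>i. RN \<sigma> A (r i) \<omega>) \<longlonglongrightarrow> R \<omega>"
    and "small (\<lambda>N. \<integral>\<^sup>+\<omega>. ennreal \<bar>RN \<sigma> A N \<omega> - R \<omega>\<bar> \<partial>gauss_prod)"
proof -
  obtain r where r: "strict_mono r" "AE \<omega> in (gauss_prod :: (int ^ 'd \<Rightarrow> real) measure). Cauchy (\<lambda>i. RN \<sigma> A (r i) \<omega>)"
    by (rule cauchy_L1_AE_cauchy_subseq[OF integrable_RN[of \<sigma> A]], simp only: real_norm_def, erule RN_Cauchy_L1)
  define R :: "(int ^ 'd \<Rightarrow> real) \<Rightarrow> real" where "R \<omega> = lim (\<lambda>i. RN \<sigma> A (r i) \<omega>)" for \<omega>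
  have Rm[measurable]: "R \<in> borel_measurable gauss_prod"
    unfolding R_def by (rule borel_measurable_lim_metric) measurable
  have conv: "AE \<omega> in gauss_prod. (\<lambda>i. RN \<sigma> A (r i) \<omega>) \<longlonglongrightarrow> R \<omega>"
    using r(2) by eventually_elim (simp add: R_def Cauchy_convergent_iff convergent_LIMSEQ_iff)
  have "small (\<lambda>N. \<integral>\<^sup>+\<omega>. ennreal \<bar>RN \<sigma> A N \<omega> - R \<omega>\<bar> \<partial>gauss_prod)"
    unfolding small_def
  proof (intro allI impI)
    fix e :: real assume e: "0 < e"
    obtain N0 where N0: "\<And>i j. i \<ge> N0 \<Longrightarrow> j \<ge> N0 \<Longrightarrow> (\<integral>\<omega>. \<bar>RN \<sigma> A i \<omega> - RN \<sigma> A j \<omega>\<bar> \<partial>(gauss_prod :: (int ^ 'd \<Rightarrow> real) measure)) < e"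
      using RN_Cauchy_L1[OF e, where 'd='d] by blast
    have "(\<integral>\<^sup>+\<omega>. ennreal \<bar>RN \<sigma> A N \<omega> - R \<omega>\<bar> \<partial>gauss_prod) \<le> ennreal e" if N: "N \<ge> N0" for N
    proof (rule nn_integral_fatou[where f="\<lambda>i \<omega>. \<bar>RN \<sigma> A N \<omega> - RN \<sigma> A (r i) \<omega>\<bar>" and ?i0.0=N0])
      show "AE \<omega> in gauss_prod. (\<lambda>i. \<bar>RN \<sigma> A N \<omega> - RN \<sigma> A (r i) \<omega>\<bar>) \<longlonglongrightarrow> \<bar>RN \<sigma> A N \<omega> - R \<omega>\<bar>"
        using conv by eventually_elim (intro tendsto_intros)
      fix i assume "i \<ge> N0"
      then have "r i \<ge> N0" using seq_suble[OF r(1), of i] by linarith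
      then have "(\<integral>\<omega>. \<bar>RN \<sigma> A N \<omega> - RN \<sigma> A (r i) \<omega>\<bar> \<partial>(gauss_prod :: (int ^ 'd \<Rightarrow> real) measure)) \<le> e"
        using N0[OF N] by force
      moreover have "(\<integral>\<^sup>+\<omega>. ennreal \<bar>RN \<sigma> A N \<omega> - RN \<sigma> A (r i) \<omega>\<bar> \<partial>(gauss_prod :: (int ^ 'd \<Rightarrow> real) measure))
         = ennreal (\<integral>\<omega>. \<bar>RN \<sigma> A N \<omega> - RN \<sigma> A (r i) \<omega>\<bar> \<partial>(gauss_prod :: (int ^ 'd \<Rightarrow> real) measure))"
        by (rule nn_integral_eq_integral[OF integrable_abs[OF Bochner_Integration.integrable_diff[OF integrable_RN integrable_RN]]]) simp
      ultimately show "(\<integral>\<^sup>+\<omega>. ennreal \<bar>RN \<sigma> A N \<omega> - RN \<sigma> A (r i) \<omega>\<bar> \<partial>(gauss_prod :: (int ^ 'd \<Rightarrow> real) measure)) \<le> ennreal e"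
        by (simp add: ennreal_leI)
    qed measurable
    then show "\<exists>N0. \<forall>N\<ge>N0. (\<integral>\<^sup>+\<omega>. ennreal \<bar>RN \<sigma> A N \<omega> - R \<omega>\<bar> \<partial>gauss_prod) \<le> ennreal e" by blast
  qed
  from Rm conv this show thesis by (rule that)
qed

text \<open>The moments and the exponential moments of the limit inherit the uniform bounds by
  Fatou's lemma along the almost surely convergent subsequence.\<close>

lemma gibbs_sequence_RN:
  fixes \<sigma> p A C :: real
  assumes p: "1 \<le> p" and C: "0 < C"
    and bound: "\<And>N. (\<integral>\<^sup>+\<omega>. ennreal (exp (2 * p * RN \<sigma> A N \<omega>)) \<partial>(gauss_prod :: (int ^ 'd \<Rightarrow> real) measure)) \<le> ennreal C"
  shows "\<exists>R. gibbs_sequence (gauss_prod :: (int ^ 'd \<Rightarrow> real) measure) p C (RN \<sigma> A) R"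
proof -
  obtain R :: "(int ^ 'd \<Rightarrow> real) \<Rightarrow> real" and r :: "nat \<Rightarrow> nat"
    where R[measurable]: "R \<in> borel_measurable gauss_prod"
      and conv: "AE \<omega> in gauss_prod. (\<lambda>i. RN \<sigma> A (r i) \<omega>) \<longlonglongrightarrow> R \<omega>"
      and sm: "small (\<lambda>N. \<integral>\<^sup>+\<omega>. ennreal \<bar>RN \<sigma> A N \<omega> - R \<omega>\<bar> \<partial>gauss_prod)"
    by (rule RN_limit)
  have "gibbs_sequence (gauss_prod :: (int ^ 'd \<Rightarrow> real) measure) p C (RN \<sigma> A) R"
  proof (intro gibbs_sequence.intro prob_space_gauss_prod gibbs_sequence_axioms.intro measurable_RN R p sm bound)
    fix m
    obtain D where D: "0 < D" "\<And>N. (\<integral>\<^sup>+\<omega>. ennreal (\<bar>RN \<sigma> A N \<omega>\<bar> ^ m) \<partial>(gauss_prod :: (int ^ 'd \<Rightarrow> real) measure)) \<le> ennreal D"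
      using moments_RN_uniformly_bounded[where 'd='d] by blast
    have "(\<integral>\<^sup>+\<omega>. ennreal (\<bar>R \<omega>\<bar> ^ m) \<partial>gauss_prod) \<le> ennreal D"
    proof (rule nn_integral_fatou[where f="\<lambda>i \<omega>. \<bar>RN \<sigma> A (r i) \<omega>\<bar> ^ m" and ?i0.0=0])
      show "AE \<omega> in gauss_prod. (\<lambda>i. \<bar>RN \<sigma> A (r i) \<omega>\<bar> ^ m) \<longlonglongrightarrow> \<bar>R \<omega>\<bar> ^ m"
        using conv by eventually_elim (intro tendsto_intros)
    qed (auto intro: D)
    then show "\<exists>D\<ge>0. (\<forall>N. (\<integral>\<^sup>+\<omega>. ennreal (\<bar>RN \<sigma> A N \<omega>\<bar> ^ m) \<partial>(gauss_prod :: (int ^ 'd \<Rightarrow> real) measure)) \<le> ennreal D)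
        \<and> (\<integral>\<^sup>+\<omega>. ennreal (\<bar>R \<omega>\<bar> ^ m) \<partial>gauss_prod) \<le> ennreal D"
      using D by (intro exI[of _ D]) auto
  next
    show "(\<integral>\<^sup>+\<omega>. ennreal (exp (2 * p * R \<omega>)) \<partial>gauss_prod) \<le> ennreal C"
    proof (rule nn_integral_fatou[where f="\<lambda>i \<omega>. exp (2 * p * RN \<sigma> A (r i) \<omega>)" and ?i0.0=0])
      show "AE \<omega> in gauss_prod. (\<lambda>i. exp (2 * p * RN \<sigma> A (r i) \<omega>)) \<longlonglongrightarrow> exp (2 * p * R \<omega>)"
        using conv by eventually_elim (intro tendsto_intros)
    qed (auto intro: bound)
  qed (use C in auto)
  then show ?thesis by blast
qed

theorem theorem1p5:
  fixes \<sigma> p :: real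
  assumes "\<sigma> > 0" and "p \<ge> 1"
  shows "\<exists>A0>0. \<forall>A\<ge>A0.
    \<exists>R :: (int ^ 'd \<Rightarrow> real) \<Rightarrow> real.
      let M = (Omega :: (int ^ 'd \<Rightarrow> real) measure);
          Z = (\<integral>\<omega>. exp (R \<omega>) \<partial>M);
          ZN = (\<lambda>N. \<integral>\<omega>. exp (RN \<sigma> A N \<omega>) \<partial>M);
          \<rho> = density M (\<lambda>\<omega>. ennreal (exp (R \<omega>) / Z))
      in (\<forall>N. in_Lp M p (RN \<sigma> A N)) \<and> in_Lp M p R
       \<and> (\<lambda>N. Lp_norm M p (\<lambda>\<omega>. RN \<sigma> A N \<omega> - R \<omega>)) \<longlonglongrightarrow> 0
       \<and> (\<exists>C>0. \<forall>N. in_Lp M p (\<lambda>\<omega>. exp (RN \<sigma> A N \<omega>))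
                    \<and> Lp_norm M p (\<lambda>\<omega>. exp (RN \<sigma> A N \<omega>)) \<le> C)
       \<and> in_Lp M p (\<lambda>\<omega>. exp (R \<omega>))
       \<and> (\<lambda>N. Lp_norm M p (\<lambda>\<omega>. exp (RN \<sigma> A N \<omega>) - exp (R \<omega>))) \<longlonglongrightarrow> 0
       \<and> (\<forall>N. ZN N > 0) \<and> Z > 0
       \<and> (\<lambda>N. Lp_norm M p (\<lambda>\<omega>. exp (RN \<sigma> A N \<omega>) / ZN N - exp (R \<omega>) / Z)) \<longlonglongrightarrow> 0
       \<and> prob_space \<rho>
       \<and> absolutely_continuous M \<rho> \<and> absolutely_continuous \<rho> M"
    (is "\<exists>A0>0. \<forall>A\<ge>A0. \<exists>R. ?gibbs A R")
proof -
  obtain A0 where A0: "0 < A0" and ex: "\<And>A. A0 \<le> A \<Longrightarrow> \<exists>C>0. \<forall>N.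
     (\<integral>\<^sup>+\<omega>. ennreal (exp (2 * p * RN \<sigma> A N \<omega>)) \<partial>(gauss_prod :: (int ^ 'd \<Rightarrow> real) measure)) \<le> ennreal C"
    \<comment> \<open>The threshold is taken for the exponent \<open>2 * p\<close>, leaving the room
      above \<open>p\<close> that interpolation consumes.\<close>
    using exp_RN_uniformly_bounded[of "2 * p" \<sigma>, where 'd='d] assms by auto
  show ?thesis
  proof (intro exI[of _ A0] conjI A0 allI impI)
    fix A assume "A0 \<le> A"
    then obtain C where C: "0 < C" and bound: "\<And>N. (\<integral>\<^sup>+\<omega>. ennreal (exp (2 * p * RN \<sigma> A N \<omega>)) \<partial>(gauss_prod :: (int ^ 'd \<Rightarrow> real) measure)) \<le> ennreal C"
      using ex by blast
    obtain R where "gibbs_sequence (gauss_prod :: (int ^ 'd \<Rightarrow> real) measure) p C (RN \<sigma> A) R"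
      using gibbs_sequence_RN[OF assms(2) C bound] by blast
    then interpret G: gibbs_sequence "gauss_prod :: (int ^ 'd \<Rightarrow> real) measure" p C "RN \<sigma> A" R .
    have p0: "0 < p" using assms by simp
    have "(1 + C) powr (1 / p) > 0" using C by simp
    then have "\<exists>C>0. \<forall>N. in_Lp gauss_prod p (\<lambda>\<omega> :: int ^ 'd \<Rightarrow> real. exp (RN \<sigma> A N \<omega>)) \<and> Lp_norm gauss_prod p (\<lambda>\<omega> :: int ^ 'd \<Rightarrow> real. exp (RN \<sigma> A N \<omega>)) \<le> C"
      by (intro exI[of _ "(1 + C) powr (1 / p)"] conjI allI G.in_Lp_exp(1) G.Lp_norm_exp_le)
    then show "\<exists>R. ?gibbs A R"
      unfolding Let_def Omega_def
      using G.in_Lp_R G.in_Lp_exp(2) Lp_norm_tendsto_0[OF G.small_R_powr[OF assms(2)] p0]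
        Lp_norm_tendsto_0[OF G.small_exp_powr p0] Lp_norm_tendsto_0[OF G.small_normalised p0]
        G.ZN_pos G.Z_pos G.prob_space_limit G.absolutely_continuous_limit
      by (intro exI[of _ R] conjI allI) (assumption | rule G.in_Lp_R G.ZN_pos)+
  qed
qed

end
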